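(* The category $\mathcal{C}(numOp_{(g,n)})^{op}$ described in the context is quasi-Gröbner.
   Context: Quasi-Gröbner categories. Let $\mathcal{C}$ be a small category and $c$ an object. An admissible order on the morphisms out of $c$ is a choice, for every object $c'$, of a well-order on $\mathrm{Hom}(c,c')$ such that $f\prec f'$ implies $g\circ f\prec g\circ f'$ for all $g$. On morphisms out of $c$ put the preorder $f\le g$ iff $g=h\circ f$ for some $h$; $|c/\mathcal{C}|$ is the associated poset. A poset is Noetherian if every sequence $x_1,x_2,\dots$ has $i<j$ with $x_i\le x_j$. $\mathcal{C}$ is Gröbner if for every object $c$: (G1) morphisms out of $c$ admit an admissible order, and (G2) $|c/\mathcal{C}|$ is Noetherian. A functor $\Phi:\mathcal{C}\to\mathcal{D}$ has property (F) if for every object $d$ of $\mathcal{D}$ there are finitely many objects $c_i$ of $\mathcal{C}$ and morphisms $f_i:d\to\Phi(c_i)$ such that every $f:d\to\Phi(c)$ factors as $\Phi(g)\circ f_i$ for some $i$ and $g:c_i\to c$. $\mathcal{D}$ is quasi-Gröbner if there is a Gröbner $\mathcal{C}$ and an essentially surjective functor $\mathcal{C}\to\mathcal{D}$ with property (F). Operadic graphs. A graph with half-edges is finite sets $V$, $H$, an involution $inv$ on $H$ and $t:H\to V$; fixed points of $inv$ are leaves, two-element orbits are edges. An operadic graph additionally has a total order on leaves (indexed $0,1,\dots$), for each vertex $v$ a total order on $t^{-1}(v)$, and a total order on $V$ (indexed $1,\dots,n$); considered up to isomorphism preserving all data. The genus $g(\Gamma)$ of a connected graph is its first Betti number (#edges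 $-$ #vertices $+1$). The category $\mathcal{C}(numOp_{(g,n)})^{op}$: objects are connected operadic graphs with at least one vertex (loops, multiple edges and any number of leaves allowed), endowed with a genus map $g:V\to\mathbb{N}$. If $p$ has vertices $v_1<\dots<v_n$, a morphism $p\to q$ consists of objects $q_1,\dots,q_n$ such that $q_l$ has as many leaves as $v_l$ has half-edges and $g(v_l)=\sum_{v\in V(q_l)}g(v)+g(q_l)$, together with a bijection $\bigsqcup_l V(q_l)\to V(q)$ order preserving on each $V(q_l)$, such that $q$ is obtained by substituting $q_l$ into $v_l$: the $i$-th leaf of $q_l$ is identified with the $i$-th half-edge of $v_l$; an edge of $p$ between the $i$-th half-edge of $v_j$ and the $k$-th half-edge of $v_l$ becomes an edge of $q$ between the $i$-th leaf of $q_j$ and the $k$-th leaf of $q_l$; if the $i$-th half-edge of $v_j$ is the $k$-th leaf of $p$ then the $i$-th leaf of $q_j$ is the $k$-th leaf of $q$; half-edge orders and vertex genera come from the $q_l$, and the vertex order of $q$ is transported along the bijection. Composition is iterated substitution. (This is the opposite of $\mathcal{C}(P)$ for $P$ the operad of genus-graded modular operads, restricted to operations of non-zero arity.) *)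

theory Defs
  imports Main
begin

section \<open>Small categories with explicit carriers\<close>

record ('o, 'm) cat =
  Obj :: "'o set"
  Hom :: "'o \<Rightarrow> 'o \<Rightarrow> 'm set"
  cmp :: "'m \<Rightarrow> 'm \<Rightarrow> 'm"   (* cmp g f = g o f *)
  idm :: "'o \<Rightarrow> 'm"

definition is_category :: "('o, 'm) cat \<Rightarrow> bool" where
  "is_category C \<longleftrightarrow>
     (\<forall>a b. (a \<notin> Obj C \<or> b \<notin> Obj C) \<longrightarrow> Hom C a b = {}) \<and>
     (\<forall>a\<in>Obj C. idm C a \<in> Hom C a a) \<and>
     (\<forall>a b c f g. f \<in> Hom C a b \<longrightarrow> g \<in> Hom C b c \<longrightarrow> cmp C g f \<in> Hom C a c) \<and>
     (\<forall>a b c d f g h. f \<in> Hom C a b \<longrightarrow> g \<in> Hom C b c \<longrightarrow> h \<in> Hom C c d \<longrightarrow>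
        cmp C h (cmp C g f) = cmp C (cmp C h g) f) \<and>
     (\<forall>a b f. f \<in> Hom C a b \<longrightarrow> cmp C (idm C b) f = f \<and> cmp C f (idm C a) = f)"

definition is_functor ::
  "('o, 'm) cat \<Rightarrow> ('p, 'n) cat \<Rightarrow> ('o \<Rightarrow> 'p) \<Rightarrow> ('m \<Rightarrow> 'n) \<Rightarrow> bool" where
  "is_functor C D F0 F1 \<longleftrightarrow>
     (\<forall>a\<in>Obj C. F0 a \<in> Obj D) \<and>
     (\<forall>a b f. f \<in> Hom C a b \<longrightarrow> F1 f \<in> Hom D (F0 a) (F0 b)) \<and>
     (\<forall>a b c f g. f \<in> Hom C a b \<longrightarrow> g \<in> Hom C b c \<longrightarrow>
        F1 (cmp C g f) = cmp D (F1 g) (F1 f)) \<and>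
     (\<forall>a\<in>Obj C. F1 (idm C a) = idm D (F0 a))"

text \<open>Admissible order on morphisms out of c: for every object c' a well-order W c'
  on Hom(c,c') (reflexive version), strictly compatible with post-composition.\<close>
definition admissible_order :: "('o, 'm) cat \<Rightarrow> 'o \<Rightarrow> ('o \<Rightarrow> 'm rel) \<Rightarrow> bool" where
  "admissible_order C c W \<longleftrightarrow>
     (\<forall>c'\<in>Obj C. well_order_on (Hom C c c') (W c')) \<and>
     (\<forall>c' c'' f f' g. c' \<in> Obj C \<longrightarrow> c'' \<in> Obj C \<longrightarrow>
        f \<in> Hom C c c' \<longrightarrow> f' \<in> Hom C c c' \<longrightarrow> g \<in> Hom C c' c'' \<longrightarrow>
        (f, f') \<in> W c' \<longrightarrow> f \<noteq> f' \<longrightarrow>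
        (cmp C g f, cmp C g f') \<in> W c'' \<and> cmp C g f \<noteq> cmp C g f')"

text \<open>|c/C| is Noetherian: every sequence of morphisms out of c has i<j with
  f_i \<le> f_j, i.e. f_j = h o f_i for some h.\<close>
definition noetherian_under :: "('o, 'm) cat \<Rightarrow> 'o \<Rightarrow> bool" where
  "noetherian_under C c \<longleftrightarrow>
     (\<forall>(d :: nat \<Rightarrow> 'o) (f :: nat \<Rightarrow> 'm).
        (\<forall>k. d k \<in> Obj C \<and> f k \<in> Hom C c (d k)) \<longrightarrow>
        (\<exists>i j. i < j \<and> (\<exists>h\<in>Hom C (d i) (d j). f j = cmp C h (f i))))"

definition groebner :: "('o, 'm) cat \<Rightarrow> bool" where
  "groebner C \<longleftrightarrow>
     (\<forall>c\<in>Obj C. (\<exists>W. admissible_order C c W) \<and> noetherian_under C c)"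

definition ess_surj :: "('o, 'm) cat \<Rightarrow> ('p, 'n) cat \<Rightarrow> ('o \<Rightarrow> 'p) \<Rightarrow> bool" where
  "ess_surj C D F0 \<longleftrightarrow>
     (\<forall>d\<in>Obj D. \<exists>c\<in>Obj C. \<exists>u\<in>Hom D d (F0 c). \<exists>v\<in>Hom D (F0 c) d.
        cmp D v u = idm D d \<and> cmp D u v = idm D (F0 c))"

definition property_F ::
  "('o, 'm) cat \<Rightarrow> ('p, 'n) cat \<Rightarrow> ('o \<Rightarrow> 'p) \<Rightarrow> ('m \<Rightarrow> 'n) \<Rightarrow> bool" where
  "property_F C D F0 F1 \<longleftrightarrow>
     (\<forall>d\<in>Obj D. \<exists>(cs :: 'o list) (fs :: 'n list).
        length fs = length cs \<and>
        (\<forall>i<length cs. cs ! i \<in> Obj C \<and> fs ! i \<in> Hom D d (F0 (cs ! i))) \<and>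
        (\<forall>c\<in>Obj C. \<forall>f\<in>Hom D d (F0 c).
           \<exists>i<length cs. \<exists>g\<in>Hom C (cs ! i) c. f = cmp D (F1 g) (fs ! i)))"

text \<open>Quasi-Groebner.  The witnessing Groebner category is taken with objects and
  morphisms encoded as natural numbers (see NOTES.md, FIDELITY).\<close>
definition quasi_groebner :: "('p, 'n) cat \<Rightarrow> bool" where
  "quasi_groebner D \<longleftrightarrow>
     (\<exists>(C :: (nat, nat) cat) (F0 :: nat \<Rightarrow> 'p) (F1 :: nat \<Rightarrow> 'n).
        is_category C \<and> groebner C \<and> is_functor C D F0 F1 \<and>
        ess_surj C D F0 \<and> property_F C D F0 F1)"

section \<open>Operadic graphs (canonical representatives of isomorphism classes)\<close>

text \<open>Since an isomorphism must preserve the vertex order, the half-edge orders at each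
  vertex and the leaf order, every isomorphism class has a unique representative:
  vertices are 0..n-1 (in order), the half-edges of vertex v are (v,0),...,(v,ar!v - 1)
  (in order), inv is the involution (identity outside the half-edge set), lvs lists the
  leaves in their order, and gen!v is the genus of vertex v.\<close>

record ograph =
  ar :: "nat list"
  gen :: "nat list"
  inv :: "nat \<times> nat \<Rightarrow> nat \<times> nat"
  lvs :: "(nat \<times> nat) list"

definition nv :: "ograph \<Rightarrow> nat" where
  "nv G = length (ar G)"

definition hes :: "ograph \<Rightarrow> (nat \<times> nat) set" where
  "hes G = {(v, i). v < nv G \<and> i < ar G ! v}"

definition adj :: "ograph \<Rightarrow> (nat \<times> nat) set" where
  "adj G = {(v, w). \<exists>i j. (v, i) \<in> hes G \<and> inv G (v, i) = (w, j) \<and> inv G (v, i) \<noteq> (v, i)}"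

definition num_edges :: "ograph \<Rightarrow> nat" where
  "num_edges G = card {h \<in> hes G. inv G h \<noteq> h} div 2"

text \<open>First Betti number of a connected graph: #edges - #vertices + 1.\<close>
definition genus :: "ograph \<Rightarrow> nat" where
  "genus G = num_edges G + 1 - nv G"

text \<open>Objects: connected operadic graphs with at least one vertex and a genus map.\<close>
definition is_obj :: "ograph \<Rightarrow> bool" where
  "is_obj G \<longleftrightarrow>
     1 \<le> nv G \<and> length (gen G) = nv G \<and>
     (\<forall>h\<in>hes G. inv G h \<in> hes G \<and> inv G (inv G h) = h) \<and>
     (\<forall>h. h \<notin> hes G \<longrightarrow> inv G h = h) \<and>
     distinct (lvs G) \<and> set (lvs G) = {h \<in> hes G. inv G h = h} \<and>
     (\<forall>v<nv G. \<forall>w<nv G. (v, w) \<in> (adj G)\<^sup>*)"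

definition loc :: "nat list list \<Rightarrow> nat \<Rightarrow> nat \<times> nat" where
  "loc \<sigma> w = (THE (l, j). l < length \<sigma> \<and> j < length (\<sigma> ! l) \<and> \<sigma> ! l ! j = w)"

definition pos :: "'a list \<Rightarrow> 'a \<Rightarrow> nat" where
  "pos xs x = (THE k. k < length xs \<and> xs ! k = x)"

text \<open>Substitution of qs!l into the l-th vertex of p; \<sigma>!l!j is the vertex of the result
  corresponding to the j-th vertex of qs!l.\<close>
definition subst :: "ograph \<Rightarrow> ograph list \<Rightarrow> nat list list \<Rightarrow> ograph" where
  "subst p qs \<sigma> = (let
     N = length (concat \<sigma>);
     A = map (\<lambda>w. case loc \<sigma> w of (l, j) \<Rightarrow> ar (qs ! l) ! j) [0..<N];
     Gn = map (\<lambda>w. case loc \<sigma> w of (l, j) \<Rightarrow> gen (qs ! l) ! j) [0..<N];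
     H = {(w, i). w < N \<and> i < A ! w};
     I = (\<lambda>(w, i). if (w, i) \<in> H then
            (case loc \<sigma> w of (l, j) \<Rightarrow>
              if inv (qs ! l) (j, i) \<noteq> (j, i)
              then (case inv (qs ! l) (j, i) of (j', i') \<Rightarrow> (\<sigma> ! l ! j', i'))
              else (let k = pos (lvs (qs ! l)) (j, i) in
                    if inv p (l, k) = (l, k) then (w, i)
                    else (case inv p (l, k) of (l', k') \<Rightarrow>
                           (case lvs (qs ! l') ! k' of (j'', i'') \<Rightarrow> (\<sigma> ! l' ! j'', i'')))))
          else (w, i));
     L = map (\<lambda>(l, k). case lvs (qs ! l) ! k of (j, i) \<Rightarrow> (\<sigma> ! l ! j, i)) (lvs p)
   in \<lparr>ar = A, gen = Gn, inv = I, lvs = L\<rparr>)"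

text \<open>A morphism is (source, target, q_1..q_n, bijection).\<close>
type_synonym omor = "ograph \<times> ograph \<times> ograph list \<times> nat list list"

definition is_mor :: "ograph \<Rightarrow> ograph \<Rightarrow> omor \<Rightarrow> bool" where
  "is_mor p q m \<longleftrightarrow> (case m of (p', q', qs, \<sigma>) \<Rightarrow>
     p' = p \<and> q' = q \<and> is_obj p \<and> is_obj q \<and>
     length qs = nv p \<and>
     (\<forall>l<nv p. is_obj (qs ! l) \<and> length (lvs (qs ! l)) = ar p ! l \<and>
                gen p ! l = sum_list (gen (qs ! l)) + genus (qs ! l)) \<and>
     length \<sigma> = nv p \<and>
     (\<forall>l<nv p. length (\<sigma> ! l) = nv (qs ! l) \<and> sorted_wrt (<) (\<sigma> ! l)) \<and>
     distinct (concat \<sigma>) \<and> set (concat \<sigma>) = {0..<nv q} \<and>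
     q = subst p qs \<sigma>)"

text \<open>Composition = iterated substitution: cmp g f for f : p \<rightarrow> q, g : q \<rightarrow> r.\<close>
definition mcomp :: "omor \<Rightarrow> omor \<Rightarrow> omor" where
  "mcomp g f = (case f of (p, q, qs, \<sigma>) \<Rightarrow> (case g of (_, r, rs, \<tau>) \<Rightarrow>
     (let img = (\<lambda>l j k. \<tau> ! (\<sigma> ! l ! j) ! k);
          blk = (\<lambda>l. sorted_list_of_set
                   {img l j k | j k. j < length (\<sigma> ! l) \<and> k < length (\<tau> ! (\<sigma> ! l ! j))})
      in (p, r,
          map (\<lambda>l. subst (qs ! l) (map (\<lambda>j. rs ! (\<sigma> ! l ! j)) [0..<length (\<sigma> ! l)])
                     (map (\<lambda>j. map (\<lambda>k. pos (blk l) (img l j k)) [0..<length (\<tau> ! (\<sigma> ! l ! j))])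
                          [0..<length (\<sigma> ! l)]))
              [0..<length qs],
          map blk [0..<length qs]))))"

definition corolla :: "nat \<Rightarrow> nat \<Rightarrow> ograph" where
  "corolla a g = \<lparr>ar = [a], gen = [g], inv = id, lvs = map (\<lambda>i. (0, i)) [0..<a]\<rparr>"

definition midm :: "ograph \<Rightarrow> omor" where
  "midm p = (p, p, map (\<lambda>l. corolla (ar p ! l) (gen p ! l)) [0..<nv p], map (\<lambda>l. [l]) [0..<nv p])"

text \<open>The category C(numOp_(g,n))^op.\<close>
definition numOp_op :: "(ograph, omor) cat" where
  "numOp_op = \<lparr>Obj = {G. is_obj G}, Hom = (\<lambda>p q. {m. is_mor p q m}), cmp = mcomp, idm = midm\<rparr>"

end

theory Submission
  imports Defs "HOL-Library.Ramsey" "HOL-Library.Countable" "HOL-Library.FuncSet"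
begin

text \<open>A morphism of the category contracts the edges of connected subgraphs of its target. It preserves
  the total genus and the leaves, so under a fixed object the first Betti numbers are bounded. The
  Groebner category consists of graphs with a planar rooted spanning tree and an order on the remaining
  half-edges; its morphisms contract tree edges only. Cutting the non-tree edges turns such graphs into
  planar trees with finitely many marks, so Kruskal's theorem yields the Noetherian property, and
  comparing the images of the vertices in depth-first order yields the admissible orders.

  The functor forgets the spanning tree. It is essentially surjective since connected graphs have
  depth-first spanning trees. For property (F), factor a morphism \<open>f\<close> from \<open>p\<close> through the contraction
  of those tree edges that \<open>f\<close> contracts. Each tree edge left is an edge of \<open>p\<close>, and the number
  of non-tree edges is bounded by the total genus, so only finitely many intermediate objects occur.\<close>

section \<open>Kruskal's theorem for binary trees\<close>

datatype 'a bt = Lf | Nd 'a "'a bt" "'a bt"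

text \<open>Read \<^term>\<open>Nd a l r\<close> as a planar forest whose first root is \<open>a\<close>, with \<open>l\<close> the forest of children
  of \<open>a\<close> and \<open>r\<close> the remaining trees. Then this relation yields embeddings of forests that preserve
  and reflect the ancestor order but not meets, which spares the use of Higman's lemma.\<close>

inductive bemb :: "'a bt \<Rightarrow> 'a bt \<Rightarrow> bool" where
  bemb_Lf: "bemb Lf t"
| bemb_left: "bemb s l \<Longrightarrow> bemb s (Nd a l r)"
| bemb_right: "bemb s r \<Longrightarrow> bemb s (Nd a l r)"
| bemb_Nd: "bemb l l' \<Longrightarrow> bemb r r' \<Longrightarrow> bemb (Nd a l r) (Nd a l' r')"

lemma homogeneous_pairs:
  fixes P :: "nat \<Rightarrow> nat \<Rightarrow> bool"
  assumes "infinite Z"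
  shows "\<exists>Y\<subseteq>Z. infinite Y \<and>
    ((\<forall>i\<in>Y. \<forall>j\<in>Y. i < j \<longrightarrow> P i j) \<or> (\<forall>i\<in>Y. \<forall>j\<in>Y. i < j \<longrightarrow> \<not> P i j))"
proof -
  define f where "f S = (if P (Min S) (Max S) then 0 else (1::nat))" for S
  have "\<forall>x\<in>Z. \<forall>y\<in>Z. x \<noteq> y \<longrightarrow> f {x, y} < 2"
    by (auto simp: f_def)
  from Ramsey2[OF assms this] obtain Y t where Y: "Y \<subseteq> Z" "infinite Y"
    and t: "\<forall>x\<in>Y. \<forall>y\<in>Y. x \<noteq> y \<longrightarrow> f {x, y} = t"
    by (elim exE conjE) (rule that)
  have key: "P i j = (t = 0)" if "i \<in> Y" "j \<in> Y" "i < j" for i j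
  proof -
    have "f {i, j} = t"
      using t[rule_format, of i j] that by simp
    then show ?thesis
      using that(3) by (auto simp: f_def split: if_splits)
  qed
  then have "(\<forall>i\<in>Y. \<forall>j\<in>Y. i < j \<longrightarrow> P i j) \<or> (\<forall>i\<in>Y. \<forall>j\<in>Y. i < j \<longrightarrow> \<not> P i j)"
    using key by (cases "t = 0") simp_all
  with Y show ?thesis
    by (intro exI[of _ Y]) simp
qed

lemma minimal_bad_sequence:
  fixes f :: "nat \<Rightarrow> 'a" and sz :: "'a \<Rightarrow> nat" and A P
  defines "bad \<equiv> \<lambda>g :: nat \<Rightarrow> 'a. (\<forall>i. g i \<in> A) \<and> (\<forall>i j. i < j \<longrightarrow> \<not> P (g i) (g j))"
  assumes "bad f"
  shows "\<exists>m. bad m \<and> (\<forall>g n. bad g \<longrightarrow> (\<forall>i<n. g i = m i) \<longrightarrow> sz (m n) \<le> sz (g n))"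
proof -
  define mini where
    "mini n h \<longleftrightarrow> bad h \<and> (\<forall>g. bad g \<longrightarrow> (\<forall>i<n. g i = h i) \<longrightarrow> sz (h n) \<le> sz (g n))" for n h
  have ex: "\<exists>h. mini n h \<and> (\<forall>i<n. h i = g i)" if "bad g" for g n
  proof -
    let ?P = "\<lambda>h. bad h \<and> (\<forall>i<n. h i = g i)"
    have "?P g"
      using that by simp
    from ex_has_least_nat[of ?P, OF this, of "\<lambda>h. sz (h n)"]
    obtain h where "?P h" "\<forall>h'. ?P h' \<longrightarrow> sz (h n) \<le> sz (h' n)"
      by (elim exE conjE) (rule that, auto)
    then show ?thesis
      unfolding mini_def by (intro exI[of _ h]) auto
  qed
  have "\<exists>h. \<forall>n. mini n (h n) \<and> (\<forall>i<Suc n. h (Suc n) i = h n i)"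
  proof (rule dependent_nat_choice)
    show "\<exists>h. mini 0 h"
      using ex[OF assms(2)] by blast
  next
    fix h n
    assume "mini n h"
    then have "bad h"
      by (simp add: mini_def)
    then show "\<exists>h'. mini (Suc n) h' \<and> (\<forall>i<Suc n. h' i = h i)"
      using ex by blast
  qed
  then obtain h where h: "\<And>n. mini n (h n)" "\<And>n i. i < Suc n \<Longrightarrow> h (Suc n) i = h n i"
    by blast
  have agree: "h n i = h i i" if "i \<le> n" for n i
    using that by (induction n rule: dec_induct) (auto simp: h(2))
  show ?thesis
  proof (intro exI[of _ "\<lambda>i. h i i"] conjI allI impI)
    have "h j j \<in> A" for j
      using h(1)[of j] by (auto simp: mini_def bad_def)
    moreover have "\<not> P (h i i) (h j j)" if "i < j" for i j
    proof -
      have "\<not> P (h j i) (h j j)"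
        using h(1)[of j] that unfolding mini_def bad_def by blast
      then show ?thesis
        using agree[of i j] that by simp
    qed
    ultimately show "bad (\<lambda>i. h i i)"
      by (auto simp: bad_def)
  next
    fix g n
    assume "bad g" "\<forall>i<n. g i = h i i"
    moreover have "h i i = h n i" if "i < n" for i
      using agree[of i n] that by simp
    ultimately show "sz (h n n) \<le> sz (g n)"
      using h(1)[of n] unfolding mini_def by metis
  qed
qed

theorem binary_tree_kruskal:
  fixes f :: "nat \<Rightarrow> 'a bt"
  assumes "finite A" "\<And>i. set_bt (f i) \<subseteq> A"
  shows "\<exists>i j. i < j \<and> bemb (f i) (f j)"
proof (rule ccontr)
  let ?T = "{t. set_bt t \<subseteq> A}"
  let ?bad = "\<lambda>g. (\<forall>i. g i \<in> ?T) \<and> (\<forall>i j. i < j \<longrightarrow> \<not> bemb (g i) (g j))"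
  assume "\<not> ?thesis"
  with assms(2) have "?bad f"
    by auto
  from minimal_bad_sequence[where f = f and A = ?T and P = bemb and sz = size, OF this]
  obtain m :: "nat \<Rightarrow> 'a bt" where m: "?bad m"
    and min: "\<forall>g n. ?bad g \<longrightarrow> (\<forall>i<n. g i = m i) \<longrightarrow> size (m n) \<le> size (g n)"
    by (elim exE conjE) (rule that, simp_all)
  have "m i \<noteq> Lf" for i
    using m bemb_Lf by (metis lessI)
  then have "\<forall>i. \<exists>a l r. m i = Nd a l r"
    by (metis bt.exhaust)
  then obtain a l r where alr: "\<And>i. m i = Nd (a i) (l i) (r i)"
    by metis
  have aA: "a i \<in> A" for i
    using m alr[of i] by (metis (no_types, lifting) bt.set_intros(1) mem_Collect_eq subsetD)
  have sub_good: "\<exists>i\<in>Y. \<exists>j\<in>Y. i < j \<and> bemb (s i) (s j)"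
    if s: "\<And>i. s i = l i \<or> s i = r i" and Y: "infinite Y" for s :: "nat \<Rightarrow> 'a bt" and Y :: "nat set"
  proof (rule ccontr)
    assume no: "\<not> ?thesis"
    define k where "k = enumerate Y"
    have kY: "k i \<in> Y" for i
      using Y by (simp add: k_def enumerate_in_set)
    have kmono: "k i < k j" if "i < j" for i j
      using Y that by (simp add: k_def enumerate_mono)
    have kmono': "k 0 \<le> k i" for i
      using kmono[of 0 i] by (cases "i = 0") auto
    define g where "g i = (if i < k 0 then m i else s (k (i - k 0)))" for i
    have to_m: "bemb t (m j)" if "bemb t (s j)" for t j
      using s[of j] that alr[of j] bemb_left bemb_right by metis
    have "g i \<in> ?T" for i
    proof (cases "i < k 0")
      case False
      let ?n = "k (i - k 0)"
      have "set_bt (m ?n) \<subseteq> A"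
        using m by blast
      then have "set_bt (s ?n) \<subseteq> A"
        using s[of ?n] alr[of ?n] by auto
      then show ?thesis using False by (simp add: g_def)
    qed (use m in \<open>simp add: g_def\<close>)
    moreover have "\<not> bemb (g i) (g j)" if "i < j" for i j
    proof -
      consider "j < k 0" | "i < k 0" "k 0 \<le> j" | "k 0 \<le> i"
        by linarith
      then show ?thesis
      proof cases
        case 1
        then show ?thesis using m that by (auto simp: g_def)
      next
        case 2
        then have "i < k (j - k 0)"
          using kmono'[of "j - k 0"] by linarith
        then have "\<not> bemb (m i) (m (k (j - k 0)))"
          using m by blast
        then show ?thesis using 2 to_m by (auto simp: g_def)
      next
        case 3
        then have "k (i - k 0) < k (j - k 0)"
          using that by (intro kmono) linarith
        then show ?thesis using 3 that no kY by (auto simp: g_def)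
      qed
    qed
    ultimately have "?bad g"
      by blast
    then have "size (m (k 0)) \<le> size (g (k 0))"
      by (intro min[rule_format]) (auto simp: g_def)
    then show False
      using s[of "k 0"] alr[of "k 0"] by (auto simp: g_def)
  qed
  obtain X where X: "infinite X"
    "(\<forall>i\<in>X. \<forall>j\<in>X. i < j \<longrightarrow> a i = a j) \<or> (\<forall>i\<in>X. \<forall>j\<in>X. i < j \<longrightarrow> a i \<noteq> a j)"
    using homogeneous_pairs[OF infinite_UNIV_nat, of "\<lambda>i j. a i = a j"] by (elim exE conjE) (rule that)
  have aX: "a i = a j" if "i \<in> X" "j \<in> X" "i < j" for i j
  proof (rule ccontr)
    assume "a i \<noteq> a j"
    with X that have "\<forall>i\<in>X. \<forall>j\<in>X. i < j \<longrightarrow> a i \<noteq> a j"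
      by blast
    then have "inj_on a X"
      by (metis inj_onI linorder_neqE_nat)
    moreover have "finite (a ` X)"
      using assms(1) aA by (meson finite_subset image_subsetI)
    ultimately show False
      using X(1) finite_imageD by blast
  qed
  obtain Y where Y: "Y \<subseteq> X" "infinite Y"
    "(\<forall>i\<in>Y. \<forall>j\<in>Y. i < j \<longrightarrow> bemb (l i) (l j)) \<or> (\<forall>i\<in>Y. \<forall>j\<in>Y. i < j \<longrightarrow> \<not> bemb (l i) (l j))"
    using homogeneous_pairs[OF X(1), of "\<lambda>i j. bemb (l i) (l j)"] by (elim exE conjE) (rule that)
  have "\<exists>i\<in>Y. \<exists>j\<in>Y. i < j \<and> bemb (l i) (l j)"
    by (rule sub_good[OF _ Y(2)]) simp
  with Y(3) have lY: "\<forall>i\<in>Y. \<forall>j\<in>Y. i < j \<longrightarrow> bemb (l i) (l j)"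
    by blast
  have "\<exists>i\<in>Y. \<exists>j\<in>Y. i < j \<and> bemb (r i) (r j)"
    by (rule sub_good[OF _ Y(2)]) simp
  then obtain i j where ij: "i \<in> Y" "j \<in> Y" "i < j" "bemb (r i) (r j)"
    by (elim bexE conjE) (rule that)
  have "a i = a j"
    using aX[of i j] ij Y(1) by blast
  moreover have "bemb (l i) (l j)"
    using lY ij by blast
  ultimately have "bemb (m i) (m j)"
    using ij(4) by (simp add: alr bemb_Nd)
  then show False
    using m ij(3) by blast
qed

section \<open>Planar trees and their contractions\<close>

text \<open>A rooted planar tree has its vertices numbered in depth-first preorder, so that the descendants
  of \<open>i\<close> form an interval; \<open>en ! i\<close> is the end of that interval.\<close>

definition anc :: "nat list \<Rightarrow> nat \<Rightarrow> nat \<Rightarrow> bool" where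
  "anc en i j \<longleftrightarrow> i \<le> j \<and> j < en ! i"

definition tree :: "nat list \<Rightarrow> bool" where
  "tree en \<longleftrightarrow> en \<noteq> [] \<and> en ! 0 = length en \<and> (\<forall>i<length en. i < en ! i \<and> en ! i \<le> length en) \<and>
     (\<forall>i<length en. \<forall>j<length en. anc en i j \<longrightarrow> en ! j \<le> en ! i)"

definition temb :: "nat list \<Rightarrow> nat list \<Rightarrow> nat list \<Rightarrow> bool" where
  "temb en en' e \<longleftrightarrow> tree en \<and> tree en' \<and> length e = length en \<and> sorted_wrt (<) e \<and>
     set e \<subseteq> {..<length en'} \<and> e ! 0 = 0 \<and>
     (\<forall>i<length en. \<forall>j<length en. anc en i j \<longleftrightarrow> anc en' (e ! i) (e ! j))"

text \<open>A contraction of the tree \<open>en'\<close> onto \<open>en\<close> is recorded by the list \<open>e\<close> of the topmost vertices of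
  its fibres; the contraction itself sends \<open>x\<close> to its nearest ancestor in the image of \<open>e\<close>.\<close>

definition ret :: "nat list \<Rightarrow> nat list \<Rightarrow> nat \<Rightarrow> nat" where
  "ret en' e x = Max {i. i < length e \<and> anc en' (e ! i) x}"

lemma anc_refl: "tree en \<Longrightarrow> i < length en \<Longrightarrow> anc en i i"
  by (auto simp: tree_def anc_def)

lemma anc_antisym: "anc en i j \<Longrightarrow> anc en j i \<Longrightarrow> i = j"
  by (simp add: anc_def)

lemma anc_trans:
  assumes "tree en" "anc en i j" "anc en j k" "j < length en"
  shows "anc en i k"
proof -
  have "i < length en"
    using assms(2,4) by (simp add: anc_def)
  then have "en ! j \<le> en ! i"
    using assms by (simp add: tree_def)
  then show ?thesis
    using assms(2,3) by (simp add: anc_def)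
qed

lemma anc_between: "anc en i k \<Longrightarrow> i \<le> j \<Longrightarrow> j \<le> k \<Longrightarrow> anc en i j"
  by (simp add: anc_def)

lemma anc_zero: "tree en \<Longrightarrow> x < length en \<Longrightarrow> anc en 0 x"
  by (simp add: tree_def anc_def)

locale tree_emb =
  fixes en en' e
  assumes temb: "temb en en' e"
begin

lemma tree: "tree en" and tree': "tree en'" and len: "length e = length en"
  and sorted: "sorted_wrt (<) e" and nth_less: "i < length en \<Longrightarrow> e ! i < length en'"
  and nth_0: "e ! 0 = 0"
  and anc_iff: "i < length en \<Longrightarrow> j < length en \<Longrightarrow> anc en' (e ! i) (e ! j) \<longleftrightarrow> anc en i j"
  using temb by (auto simp: temb_def subset_iff)

lemma mono: "i < j \<Longrightarrow> j < length en \<Longrightarrow> e ! i < e ! j"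
  using sorted_wrt_nth_less[OF sorted] len by simp

lemma mono_le: "i \<le> j \<Longrightarrow> j < length en \<Longrightarrow> e ! i \<le> e ! j"
  using mono by (cases "i = j") (auto simp: less_imp_le)

lemma distinct: "distinct e"
  using sorted strict_sorted_iff by blast

lemma len_pos: "0 < length en"
  using tree by (simp add: tree_def)

lemma ret:
  assumes "x < length en'"
  shows ret_less: "ret en' e x < length en" and anc_ret: "anc en' (e ! ret en' e x) x"
    and ret_max: "i < length en \<Longrightarrow> anc en' (e ! i) x \<Longrightarrow> i \<le> ret en' e x"
proof -
  let ?A = "{i. i < length e \<and> anc en' (e ! i) x}"
  have "0 \<in> ?A"
    using len_pos nth_0 anc_zero[OF tree' assms] len by simp
  then have "ret en' e x \<in> ?A"
    unfolding ret_def by (intro Max_in) auto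
  then show "ret en' e x < length en" "anc en' (e ! ret en' e x) x"
    using len by simp_all
  show "i \<le> ret en' e x" if "i < length en" "anc en' (e ! i) x" for i
    unfolding ret_def using that len by (intro Max_ge) auto
qed

text \<open>For the ancestor orders \<^const>\<open>ret\<close> is right adjoint to \<open>e\<close>; this determines it and makes
  contractions functorial.\<close>

lemma anc_ret_iff:
  assumes "x < length en'" "z < length en"
  shows "anc en' (e ! z) x \<longleftrightarrow> anc en z (ret en' e x)"
proof
  assume z: "anc en' (e ! z) x"
  have "z \<le> ret en' e x"
    by (rule ret_max[OF assms z])
  then have "e ! z \<le> e ! ret en' e x"
    by (rule mono_le[OF _ ret_less[OF assms(1)]])
  moreover have "e ! ret en' e x \<le> x"
    using anc_ret[OF assms(1)] by (simp add: anc_def)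
  ultimately have "anc en' (e ! z) (e ! ret en' e x)"
    using z anc_between by blast
  then show "anc en z (ret en' e x)"
    using anc_iff ret_less assms by blast
next
  assume "anc en z (ret en' e x)"
  then have "anc en' (e ! z) (e ! ret en' e x)"
    using anc_iff ret_less assms by blast
  then show "anc en' (e ! z) x"
    using anc_trans[OF tree'] anc_ret[OF assms(1)] nth_less[OF ret_less[OF assms(1)]] by blast
qed

lemma ret_unique:
  assumes "x < length en'" "y < length en"
    "\<And>z. z < length en \<Longrightarrow> anc en' (e ! z) x \<longleftrightarrow> anc en z y"
  shows "ret en' e x = y"
proof -
  have "anc en y (ret en' e x)"
    using assms anc_ret_iff anc_refl[OF tree] by blast
  moreover have "anc en (ret en' e x) y"
    using assms anc_ret_iff ret_less anc_refl[OF tree] by blast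
  ultimately show ?thesis
    using anc_antisym by blast
qed

lemma ret_nth: "i < length en \<Longrightarrow> ret en' e (e ! i) = i"
  using anc_iff by (intro ret_unique nth_less)

end

lemma temb_id: "tree en \<Longrightarrow> temb en en [0..<length en]"
  by (auto simp: temb_def tree_def)

lemma ret_id: "tree en \<Longrightarrow> x < length en \<Longrightarrow> ret en [0..<length en] x = x"
  using tree_emb.ret_nth[of en en "[0..<length en]" x] temb_id by (simp add: tree_emb_def)

lemma temb_comp:
  assumes "temb a b e" "temb b c e'"
  shows "temb a c (map ((!) e') e)"
    and "x < length c \<Longrightarrow> ret c (map ((!) e') e) x = ret b e (ret c e' x)"
proof -
  interpret f: tree_emb a b e using assms(1) by unfold_locales
  interpret g: tree_emb b c e' using assms(2) by unfold_locales
  show *: "temb a c (map ((!) e') e)"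
    unfolding temb_def
  proof (intro conjI allI impI f.tree g.tree')
    show "sorted_wrt (<) (map ((!) e') e)"
      using f.mono g.mono f.nth_less by (auto simp: sorted_wrt_iff_nth_less f.len)
    show "set (map ((!) e') e) \<subseteq> {..<length c}"
      using g.nth_less f.nth_less by (auto simp: in_set_conv_nth f.len)
    show "map ((!) e') e ! 0 = 0"
      using f.len f.len_pos f.nth_0 g.nth_0 by simp
  next
    fix i j
    assume "i < length a" "j < length a"
    then show "anc a i j \<longleftrightarrow> anc c (map ((!) e') e ! i) (map ((!) e') e ! j)"
      using f.anc_iff g.anc_iff f.nth_less f.len by simp
  qed (simp add: f.len)
  interpret gf: tree_emb a c "map ((!) e') e" using * by unfold_locales
  assume x: "x < length c"
  show "ret c (map ((!) e') e) x = ret b e (ret c e' x)"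
  proof (rule gf.ret_unique[OF x])
    show "ret b e (ret c e' x) < length a"
      using f.ret_less g.ret_less x by blast
  next
    fix z
    assume "z < length a"
    then show "anc c (map ((!) e') e ! z) x \<longleftrightarrow> anc a z (ret b e (ret c e' x))"
      using f.anc_ret_iff g.anc_ret_iff g.ret_less x f.nth_less f.len by simp
  qed
qed

section \<open>The Groebner category of marked trees\<close>

text \<open>A graph with a spanning tree, cut open along the other edges: the tree \<open>ends\<close> carries vertex
  genera \<open>tgen\<close> and marks \<open>k\<close> sitting at the vertices \<open>att ! k\<close>. The involution \<open>mate\<close> glues the marks
  back into the non-tree edges; its fixed points are the leaves, listed in order by \<open>leafs\<close>.\<close>

datatype tobj =
  TObj (ends: "nat list") (tgen: "nat list") (att: "nat list") (mate: "nat list") (leafs: "nat list")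

instance tobj :: countable
  by countable_datatype

definition tobj_ok :: "tobj \<Rightarrow> bool" where
  "tobj_ok c \<longleftrightarrow> tree (ends c) \<and> length (tgen c) = length (ends c) \<and>
     set (att c) \<subseteq> {..<length (ends c)} \<and> length (mate c) = length (att c) \<and>
     (\<forall>k<length (att c). mate c ! k < length (att c) \<and> mate c ! (mate c ! k) = k) \<and>
     distinct (leafs c) \<and> set (leafs c) = {k. k < length (att c) \<and> mate c ! k = k}"

definition tmor :: "tobj \<Rightarrow> tobj \<Rightarrow> nat list \<Rightarrow> bool" where
  "tmor c c' e \<longleftrightarrow> tobj_ok c \<and> tobj_ok c' \<and> temb (ends c) (ends c') e \<and> mate c = mate c' \<and>
     leafs c = leafs c' \<and> att c = map (ret (ends c') e) (att c') \<and>
     (\<forall>i<length (ends c). tgen c ! i =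
        (\<Sum>x | x < length (ends c') \<and> ret (ends c') e x = i. tgen c' ! x))"

type_synonym tmorph = "tobj \<times> tobj \<times> nat list"

definition tree_cat :: "(tobj, tmorph) cat" where
  "tree_cat = \<lparr>Obj = {c. tobj_ok c}, Hom = (\<lambda>c c'. {(c, c', e) | e. tmor c c' e}),
     cmp = (\<lambda>(_, d, e') (c, _, e). (c, d, map ((!) e') e)),
     idm = (\<lambda>c. (c, c, [0..<length (ends c)]))\<rparr>"

lemma tmor_id: "tobj_ok c \<Longrightarrow> tmor c c [0..<length (ends c)]"
proof -
  assume c: "tobj_ok c"
  then have "{x. x < length (ends c) \<and> ret (ends c) [0..<length (ends c)] x = i} = {i}"
    if "i < length (ends c)" for i
    using that by (auto simp: ret_id tobj_ok_def)
  moreover have "map (ret (ends c) [0..<length (ends c)]) (att c) = att c"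
    using c by (intro map_idI) (auto simp: ret_id tobj_ok_def)
  ultimately show ?thesis
    using c by (simp add: tmor_def temb_id tobj_ok_def)
qed

lemma sum_fibres:
  fixes f r :: "nat \<Rightarrow> nat"
  assumes "\<And>x. x < n' \<Longrightarrow> r x < n"
  shows "(\<Sum>y | y < n \<and> P y. \<Sum>x | x < n' \<and> r x = y. f x) = (\<Sum>x | x < n' \<and> P (r x). f x)"
proof -
  have "(\<Sum>y | y < n \<and> P y. \<Sum>x | x < n' \<and> r x = y. f x) =
      (\<Sum>y | y < n \<and> P y. \<Sum>x \<in> {x \<in> {x. x < n' \<and> P (r x)}. r x = y}. f x)"
    by (intro sum.cong) auto
  also have "\<dots> = (\<Sum>x | x < n' \<and> P (r x). f x)"
    using assms by (intro sum.group) auto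
  finally show ?thesis .
qed

lemma tmor_comp:
  assumes "tmor a b e" "tmor b c e'"
  shows "tmor a c (map ((!) e') e)"
proof -
  have e: "temb (ends a) (ends b) e" and e': "temb (ends b) (ends c) e'"
    using assms by (simp_all add: tmor_def)
  interpret g: tree_emb "ends b" "ends c" e' using e' by unfold_locales
  note ret = temb_comp(2)[OF e e']
  have "att a = map (ret (ends c) (map ((!) e') e)) (att c)"
    using assms ret by (auto simp: tmor_def tobj_ok_def subset_iff)
  moreover have "tgen a ! i = (\<Sum>x | x < length (ends c) \<and> ret (ends c) (map ((!) e') e) x = i. tgen c ! x)"
    if "i < length (ends a)" for i
  proof -
    have "tgen a ! i = (\<Sum>y | y < length (ends b) \<and> ret (ends b) e y = i. tgen b ! y)"
      using assms that by (simp add: tmor_def)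
    also have "\<dots> = (\<Sum>y | y < length (ends b) \<and> ret (ends b) e y = i.
        \<Sum>x | x < length (ends c) \<and> ret (ends c) e' x = y. tgen c ! x)"
      using assms(2) by (intro sum.cong) (auto simp: tmor_def)
    also have "\<dots> = (\<Sum>x | x < length (ends c) \<and> ret (ends b) e (ret (ends c) e' x) = i. tgen c ! x)"
      using g.ret_less by (rule sum_fibres)
    also have "\<dots> = (\<Sum>x | x < length (ends c) \<and> ret (ends c) (map ((!) e') e) x = i. tgen c ! x)"
      using ret by (intro sum.cong) auto
    finally show ?thesis .
  qed
  ultimately show ?thesis
    using assms temb_comp(1)[OF e e'] by (simp add: tmor_def)
qed

lemma is_category_tree_cat: "is_category tree_cat"
  unfolding is_category_def
proof (intro conjI allI ballI impI)
  fix a b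
  assume "a \<notin> Obj tree_cat \<or> b \<notin> Obj tree_cat"
  then show "Hom tree_cat a b = {}"
    by (auto simp: tree_cat_def tmor_def)
next
  fix a
  assume "a \<in> Obj tree_cat"
  then show "idm tree_cat a \<in> Hom tree_cat a a"
    by (simp add: tree_cat_def tmor_id)
next
  fix a b c f g
  assume "f \<in> Hom tree_cat a b" "g \<in> Hom tree_cat b c"
  then show "cmp tree_cat g f \<in> Hom tree_cat a c"
    by (auto simp: tree_cat_def intro: tmor_comp)
next
  fix a b c d f g h
  assume "f \<in> Hom tree_cat a b" "g \<in> Hom tree_cat b c" "h \<in> Hom tree_cat c d"
  then show "cmp tree_cat h (cmp tree_cat g f) = cmp tree_cat (cmp tree_cat h g) f"
    by (auto simp: tree_cat_def tmor_def temb_def subset_iff)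
next
  fix a b f
  assume "f \<in> Hom tree_cat a b"
  then obtain e where f: "f = (a, b, e)" "temb (ends a) (ends b) e"
    by (auto simp: tree_cat_def tmor_def)
  then interpret tree_emb "ends a" "ends b" e by unfold_locales
  have "map ((!) [0..<length (ends b)]) e = e"
    using nth_less by (intro map_idI) (auto simp: in_set_conv_nth len)
  moreover have "map ((!) e) [0..<length (ends a)] = e"
    using map_nth[of e] by (simp add: len)
  ultimately show "cmp tree_cat (idm tree_cat b) f = f" "cmp tree_cat f (idm tree_cat a) = f"
    by (simp_all add: tree_cat_def f(1))
qed

lemma lenlex_map_mono:
  assumes "(xs, ys) \<in> lenlex {(i, j). i < (j :: nat)}"
    "\<And>i j. i \<in> set xs \<union> set ys \<Longrightarrow> j \<in> set xs \<union> set ys \<Longrightarrow> i < j \<Longrightarrow> f i < (f j :: nat)"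
  shows "(map f xs, map f ys) \<in> lenlex {(i, j). i < j}"
proof -
  consider "length xs < length ys" | "length xs = length ys" "(xs, ys) \<in> lex {(i, j). i < j}"
    using assms(1) by (auto simp: lenlex_conv)
  then show ?thesis
  proof cases
    case 2
    then obtain zs x y xs' ys' where "xs = zs @ x # xs'" "ys = zs @ y # ys'" "x < y"
      by (auto simp: lex_conv)
    moreover from this have "f x < f y"
      using assms(2) by simp
    ultimately show ?thesis
      using 2(1) by (auto simp: lenlex_conv lex_conv)
  qed (simp add: lenlex_conv)
qed

lemma admissible_order_tree_cat: "\<exists>W. admissible_order tree_cat c W"
proof -
  let ?less = "{(i, j). i < (j :: nat)}"
  let ?r = "inv_image (lenlex ?less) (snd \<circ> snd)"
  define W where "W c' = {(f, f'). f \<in> Hom tree_cat c c' \<and> f' \<in> Hom tree_cat c c' \<and> (f = f' \<or> (f, f') \<in> ?r)}"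
    for c'
  have wf: "wf ?r"
    by (intro wf_inv_image wf_lenlex wf_less)
  have trans: "trans ?r"
    by (intro trans_inv_image lenlex_transI transI) auto
  have total: "total (lenlex ?less)"
    by (intro total_lenlex) (auto simp: total_on_def)
  have irr: "(f, f) \<notin> ?r" for f
    by (rule wf_not_refl[OF wf])
  have anti: "f = f'" if "(f, f') \<in> ?r" "(f', f) \<in> ?r" for f f'
    using that trans irr by (meson transD)
  have "well_order_on (Hom tree_cat c c') (W c')" for c'
    unfolding well_order_on_def linear_order_on_def partial_order_on_def preorder_on_def
  proof (intro conjI)
    show "W c' \<subseteq> Hom tree_cat c c' \<times> Hom tree_cat c c'"
      by (auto simp: W_def)
    show "refl_on (Hom tree_cat c c') (W c')"
      by (auto simp: W_def refl_on_def)
    show "trans (W c')"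
      using trans unfolding trans_def W_def by blast
    show "antisym (W c')"
      using anti unfolding antisym_def W_def by blast
    show "total_on (Hom tree_cat c c') (W c')"
      using total unfolding total_on_def W_def by (auto simp: tree_cat_def)
    show "wf (W c' - Id)"
      by (rule wf_subset[OF wf]) (auto simp: W_def)
  qed
  moreover have "(cmp tree_cat g f, cmp tree_cat g f') \<in> W c'' \<and> cmp tree_cat g f \<noteq> cmp tree_cat g f'"
    if f: "f \<in> Hom tree_cat c c'" "f' \<in> Hom tree_cat c c'" and g: "g \<in> Hom tree_cat c' c''"
      and less: "(f, f') \<in> W c'" "f \<noteq> f'" for c' c'' f f' g
  proof -
    obtain e where e: "f = (c, c', e)" "temb (ends c) (ends c') e"
      using f(1) by (auto simp: tree_cat_def tmor_def)
    obtain e' where e': "f' = (c, c', e')" "temb (ends c) (ends c') e'"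
      using f(2) by (auto simp: tree_cat_def tmor_def)
    obtain h where h: "g = (c', c'', h)" "temb (ends c') (ends c'') h"
      using g by (auto simp: tree_cat_def tmor_def)
    interpret h: tree_emb "ends c'" "ends c''" h using h(2) by unfold_locales
    have "(e, e') \<in> lenlex ?less"
      using less by (simp add: W_def e(1) e'(1))
    moreover have "set e \<union> set e' \<subseteq> {..<length (ends c')}"
      using e(2) e'(2) by (auto simp: temb_def)
    ultimately have "(map ((!) h) e, map ((!) h) e') \<in> lenlex ?less"
      by (intro lenlex_map_mono) (auto intro!: h.mono)
    then have "(cmp tree_cat g f, cmp tree_cat g f') \<in> ?r"
      by (simp add: tree_cat_def e(1) e'(1) h(1))
    moreover have "cmp tree_cat g f \<in> Hom tree_cat c c''" "cmp tree_cat g f' \<in> Hom tree_cat c c''"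
      using is_category_tree_cat f g unfolding is_category_def by blast+
    ultimately show ?thesis
      using irr unfolding W_def by auto
  qed
  ultimately show ?thesis
    unfolding admissible_order_def by blast
qed

function bt_of :: "(nat \<Rightarrow> 'l) \<Rightarrow> nat list \<Rightarrow> nat \<Rightarrow> nat \<Rightarrow> 'l bt" where
  "bt_of lab en a b = (if a < b then Nd (lab a) (bt_of lab en (Suc a) (min b (en ! a)))
     (bt_of lab en (max (Suc a) (en ! a)) b) else Lf)"
  by pat_completeness auto
termination
  by (relation "measure (\<lambda>(lab, en, a, b). b - a)") auto

declare bt_of.simps [simp del]

lemma set_bt_of: "set_bt (bt_of lab en a b) \<subseteq> lab ` {a..<b}"
proof (induction lab en a b rule: bt_of.induct)
  case (1 lab en a b)
  show ?case
  proof (cases "a < b")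
    case True
    have "{Suc a..<min b (en ! a)} \<subseteq> {a..<b}" "{max (Suc a) (en ! a)..<b} \<subseteq> {a..<b}"
      by auto
    then show ?thesis
      using 1[OF True] True by (subst bt_of.simps) (auto; blast)
  qed (subst bt_of.simps; simp)
qed

definition span :: "nat list \<Rightarrow> nat \<Rightarrow> nat \<Rightarrow> bool" where
  "span en a b \<longleftrightarrow> (\<forall>i. a \<le> i \<longrightarrow> i < b \<longrightarrow> i < en ! i \<and> en ! i \<le> b)"

lemma span_split:
  assumes "tree en" "b \<le> length en" "span en a b" "a < b"
  shows "span en (Suc a) (en ! a)" "span en (en ! a) b" "en ! a \<le> b" "a < en ! a"
    "max (Suc a) (en ! a) = en ! a" "min b (en ! a) = en ! a"
proof -
  show 1: "a < en ! a" "en ! a \<le> b"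
    using assms(3,4) by (simp_all add: span_def)
  show "span en (en ! a) b"
    using assms(3) 1 by (simp add: span_def)
  have "en ! i \<le> en ! a" if "Suc a \<le> i" "i < en ! a" for i
  proof -
    have "anc en a i" "i < length en" "a < length en"
      using that 1 assms(2) by (simp_all add: anc_def)
    then show ?thesis
      using assms(1) by (simp add: tree_def)
  qed
  then show "span en (Suc a) (en ! a)"
    using assms(3) 1 by (simp add: span_def)
qed (use assms(3,4) in \<open>auto simp: span_def max_def min_def\<close>)

definition span_emb where
  "span_emb lab en a b lab' en' a' b' h \<longleftrightarrow>
     (\<forall>i\<in>{a..<b}. h i \<in> {a'..<b'} \<and> lab' (h i) = lab i) \<and>
     (\<forall>i\<in>{a..<b}. \<forall>j\<in>{a..<b}. (i < j \<longrightarrow> h i < h j) \<and> (anc en i j \<longleftrightarrow> anc en' (h i) (h j)))"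

lemma span_emb_mono:
  "span_emb lab en a b lab' en' a' b' h \<Longrightarrow> a'' \<le> a' \<Longrightarrow> b' \<le> b'' \<Longrightarrow>
    span_emb lab en a b lab' en' a'' b'' h"
  unfolding span_emb_def by fastforce

lemma span_emb_join:
  assumes "span en (Suc a) m" "span en m b" "a < m" "m \<le> b" "en ! a = m"
    and "span en' (Suc a') m'" "span en' m' b'" "a' < m'" "m' \<le> b'" "en' ! a' = m'"
    and "lab' a' = lab a"
    and h1: "span_emb lab en (Suc a) m lab' en' (Suc a') m' h1"
    and h2: "span_emb lab en m b lab' en' m' b' h2"
  shows "span_emb lab en a b lab' en' a' b' (\<lambda>i. if i = a then a' else if i < m then h1 i else h2 i)"
    (is "span_emb lab en a b lab' en' a' b' ?h")
proof -
  have H1: "Suc a' \<le> h1 i" "h1 i < m'" "lab' (h1 i) = lab i" "en ! i \<le> m" "i < en ! i"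
    "en' ! h1 i \<le> m'" "h1 i < en' ! h1 i"
    if "a < i" "i < m" for i
    using that h1 assms(1,6) unfolding span_emb_def span_def by fastforce+
  have H2: "m' \<le> h2 i" "h2 i < b'" "lab' (h2 i) = lab i"
    if "m \<le> i" "i < b" for i
    using that h2 unfolding span_emb_def by auto
  have H11: "i < j \<longrightarrow> h1 i < h1 j" "anc en i j \<longleftrightarrow> anc en' (h1 i) (h1 j)"
    if "a < i" "i < m" "a < j" "j < m" for i j
    using that h1 unfolding span_emb_def by auto
  have H22: "i < j \<longrightarrow> h2 i < h2 j" "anc en i j \<longleftrightarrow> anc en' (h2 i) (h2 j)"
    if "m \<le> i" "i < b" "m \<le> j" "j < b" for i j
    using that h2 unfolding span_emb_def by auto
  show ?thesis
    unfolding span_emb_def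
  proof (intro conjI ballI)
    fix i
    assume "i \<in> {a..<b}"
    then consider "i = a" | "a < i" "i < m" | "m \<le> i" "i < b"
      by fastforce
    note i = this
    show "?h i \<in> {a'..<b'}"
      using i
    proof cases
      case 1
      then show ?thesis using assms(8,9) by simp
    next
      case 2
      then show ?thesis using H1(1,2)[of i] assms(9) by simp
    next
      case 3
      then show ?thesis using H2(1,2)[of i] assms(3,8) by simp
    qed
    show "lab' (?h i) = lab i"
      using i
    proof cases
      case 1
      then show ?thesis using assms(11) by simp
    next
      case 2
      then show ?thesis using H1(3)[of i] by simp
    next
      case 3
      then show ?thesis using H2(3)[of i] assms(3) by simp
    qed
    fix j
    assume "j \<in> {a..<b}"
    then consider "j = a" | "a < j" "j < m" | "m \<le> j" "j < b"
      by fastforce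
    note j = this
    show "i < j \<longrightarrow> ?h i < ?h j"
      using i
    proof cases
      case 1
      then show ?thesis using j H1[of j] H2[of j] assms(3,8) by (cases rule: j) auto
    next
      case 2
      then show ?thesis using H1[of i] H1[of j] H2[of j] H11(1)[of i j] assms(3) by (cases rule: j) auto
    next
      case 3
      then show ?thesis using H22(1)[of i j] assms(3) by (cases rule: j) auto
    qed
    show "anc en i j \<longleftrightarrow> anc en' (?h i) (?h j)"
      using i
    proof cases
      case 1
      then show ?thesis
        using H1[of j] H2[of j] assms(3,5,8,10) by (cases rule: j) (auto simp: anc_def)
    next
      case 2
      then show ?thesis
        using H1[of i] H2[of j] H11(2)[of i j] assms(3) by (cases rule: j) (auto simp: anc_def)
    next
      case 3
      then show ?thesis
        using H2[of i] H1[of j] H22(2)[of i j] assms(3,8) by (cases rule: j) (auto simp: anc_def)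
    qed
  qed
qed

lemma bt_of_eq_Nd:
  assumes "tree en" "b \<le> length en" "span en a b" "Nd x l r = bt_of lab en a b"
  shows "a < b" "x = lab a" "l = bt_of lab en (Suc a) (en ! a)" "r = bt_of lab en (en ! a) b"
proof -
  show "a < b"
    using assms(4) by (subst (asm) bt_of.simps) (auto split: if_splits)
  note split = span_split[OF assms(1-3) this]
  have "bt_of lab en a b = Nd (lab a) (bt_of lab en (Suc a) (en ! a)) (bt_of lab en (en ! a) b)"
    using \<open>a < b\<close> split(5,6) by (subst bt_of.simps) simp
  then show "x = lab a" "l = bt_of lab en (Suc a) (en ! a)" "r = bt_of lab en (en ! a) b"
    using assms(4) by simp_all
qed

lemma span_emb_of_bemb:
  assumes "bemb s t" "tree en" "tree en'"
    "s = bt_of lab en a b" "t = bt_of lab' en' a' b'"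
    "b \<le> length en" "span en a b" "b' \<le> length en'" "span en' a' b'"
  shows "\<exists>h. span_emb lab en a b lab' en' a' b' h"
  using assms(1,4-)
proof (induction arbitrary: a b a' b')
  case (bemb_Lf t)
  then have "\<not> a < b"
    by (subst (asm) bt_of.simps) (auto split: if_splits)
  then show ?case
    by (simp add: span_emb_def)
next
  case (bemb_left s l x r)
  note eq = bt_of_eq_Nd[OF assms(3) bemb_left.prems(5,6,2)]
  note sp = span_split[OF assms(3) bemb_left.prems(5,6) eq(1)]
  obtain h where "span_emb lab en a b lab' en' (Suc a') (en' ! a') h"
    using bemb_left.IH[OF bemb_left.prems(1) eq(3) bemb_left.prems(3,4) _ sp(1)]
      sp(3) bemb_left.prems(5) by auto
  then have "span_emb lab en a b lab' en' a' b' h"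
    by (rule span_emb_mono) (use sp in auto)
  then show ?case
    by (rule exI[of _ h])
next
  case (bemb_right s r x l)
  note eq = bt_of_eq_Nd[OF assms(3) bemb_right.prems(5,6,2)]
  note sp = span_split[OF assms(3) bemb_right.prems(5,6) eq(1)]
  obtain h where "span_emb lab en a b lab' en' (en' ! a') b' h"
    using bemb_right.IH[OF bemb_right.prems(1) eq(4) bemb_right.prems(3,4,5) sp(2)] by auto
  then have "span_emb lab en a b lab' en' a' b' h"
    by (rule span_emb_mono) (use sp in auto)
  then show ?case
    by (rule exI[of _ h])
next
  case (bemb_Nd l l' r r' x)
  note eq = bt_of_eq_Nd[OF assms(2) bemb_Nd.prems(3,4,1)]
  note sp = span_split[OF assms(2) bemb_Nd.prems(3,4) eq(1)]
  note eq' = bt_of_eq_Nd[OF assms(3) bemb_Nd.prems(5,6,2)]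
  note sp' = span_split[OF assms(3) bemb_Nd.prems(5,6) eq'(1)]
  have le: "en ! a \<le> length en" "en' ! a' \<le> length en'"
    using sp(3) sp'(3) bemb_Nd.prems(3,5) by simp_all
  obtain h1 where h1: "span_emb lab en (Suc a) (en ! a) lab' en' (Suc a') (en' ! a') h1"
    using bemb_Nd.IH(1)[OF eq(3) eq'(3) le(1) sp(1) le(2) sp'(1)] by auto
  obtain h2 where h2: "span_emb lab en (en ! a) b lab' en' (en' ! a') b' h2"
    using bemb_Nd.IH(2)[OF eq(4) eq'(4) bemb_Nd.prems(3) sp(2) bemb_Nd.prems(5) sp'(2)] by auto
  have "lab' a' = lab a"
    using eq(2) eq'(2) by simp
  show ?case
    by (rule exI, rule span_emb_join[OF sp(1,2,4,3) refl sp'(1,2,4,3) refl \<open>lab' a' = lab a\<close> h1 h2])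
qed

lemma tmor_sum_tgen:
  assumes "tmor c c' e"
  shows "(\<Sum>i<length (ends c). tgen c ! i) = (\<Sum>x<length (ends c'). tgen c' ! x)"
proof -
  interpret tree_emb "ends c" "ends c'" e
    using assms by unfold_locales (simp add: tmor_def)
  have "(\<Sum>i<length (ends c). tgen c ! i) =
      (\<Sum>i | i < length (ends c) \<and> True. \<Sum>x | x < length (ends c') \<and> ret (ends c') e x = i. tgen c' ! x)"
    using assms by (intro sum.cong) (auto simp: tmor_def)
  also have "\<dots> = (\<Sum>x | x < length (ends c') \<and> True. tgen c' ! x)"
    by (rule sum_fibres[OF ret_less])
  finally show ?thesis
    by (simp add: lessThan_def)
qed

text \<open>All but boundedly many vertices of \<open>d\<close> carry the trivial label, and the nontrivial parts of the
  labels have the same total for every object under \<open>c\<close>. Hence a label-preserving embedding leaves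
  only trivially labelled vertices outside its image and is automatically a morphism under \<open>c\<close>.\<close>

definition vlabel :: "tobj \<Rightarrow> nat list \<Rightarrow> nat \<Rightarrow> nat set \<times> nat \<times> nat set" where
  "vlabel d e x = ({i. i < length e \<and> e ! i = x}, tgen d ! x, {m. m < length (att d) \<and> att d ! m = x})"

lemma noetherian_step:
  assumes d: "tmor c d e" and d': "tmor c d' e'"
    and h: "span_emb (vlabel d e) (ends d) 0 (length (ends d)) (vlabel d' e') (ends d') 0 (length (ends d')) h"
  defines "hs \<equiv> map h [0..<length (ends d)]"
  shows "tmor d d' hs" "map ((!) hs) e = e'"
proof -
  let ?n = "length (ends d)" and ?n' = "length (ends d')"
  interpret f: tree_emb "ends c" "ends d" e
    using d by unfold_locales (simp add: tmor_def)
  interpret f': tree_emb "ends c" "ends d'" e'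
    using d' by unfold_locales (simp add: tmor_def)
  have lab: "vlabel d' e' (h i) = vlabel d e i" and h_less: "h i < ?n'" if "i < ?n" for i
    using h that by (auto simp: span_emb_def)
  have mono: "i < j \<Longrightarrow> h i < h j" and anc: "anc (ends d) i j \<longleftrightarrow> anc (ends d') (h i) (h j)"
    if "i < ?n" "j < ?n" for i j
    using h that by (auto simp: span_emb_def)
  have he: "h (e ! i) = e' ! i" if "i < length (ends c)" for i
  proof -
    have "i \<in> {k. k < length e \<and> e ! k = e ! i}"
      using that f.len by simp
    then have "i \<in> {k. k < length e' \<and> e' ! k = h (e ! i)}"
      using lab[OF f.nth_less[OF that]] by (simp add: vlabel_def)
    then show ?thesis by simp
  qed
  then show comp: "map ((!) hs) e = e'"
    using f.len f'.len f.nth_less by (intro nth_equalityI) (auto simp: hs_def)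
  have ok: "tobj_ok d" "tobj_ok d'"
    using d d' by (simp_all add: tmor_def)
  have h0: "h 0 = 0"
    using he[OF f.len_pos] f.nth_0 f'.nth_0 by simp
  have n_pos: "0 < ?n"
    using f.tree' by (simp add: tree_def)
  have "temb (ends d) (ends d') hs"
    unfolding temb_def hs_def
    using f.tree' f'.tree' mono h_less anc h0 n_pos
    by (auto simp: sorted_wrt_iff_nth_less)
  then interpret g: tree_emb "ends d" "ends d'" hs
    by unfold_locales
  have hs_nth: "hs ! i = h i" if "i < ?n" for i
    using that by (simp add: hs_def)
  have att_len: "length (att d) = length (att d')"
    using d d' by (auto simp: tmor_def dest!: arg_cong[of _ _ length])
  have "att d ! m = ret (ends d') hs (att d' ! m)" if m: "m < length (att d)" for m
  proof -
    have x: "att d ! m < ?n"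
      using ok(1) m by (auto simp: tobj_ok_def subset_iff)
    have "m \<in> {k. k < length (att d) \<and> att d ! k = att d ! m}"
      using m by simp
    then have "m \<in> {k. k < length (att d') \<and> att d' ! k = h (att d ! m)}"
      using lab[OF x] by (simp add: vlabel_def)
    then have "att d' ! m = hs ! (att d ! m)"
      using x by (simp add: hs_nth)
    then show ?thesis
      using g.ret_nth[OF x] by simp
  qed
  then have att: "att d = map (ret (ends d') hs) (att d')"
    using att_len by (intro nth_equalityI) auto
  have gen_h: "tgen d' ! h i = tgen d ! i" if "i < ?n" for i
    using lab[OF that] by (simp add: vlabel_def)
  have inj: "inj_on h {..<?n}"
    using mono by (intro inj_onI) (metis lessThan_iff linorder_neqE_nat nat_neq_iff)
  have "(\<Sum>x<?n'. tgen d' ! x) = (\<Sum>x<?n. tgen d ! x)"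
    using tmor_sum_tgen[OF d] tmor_sum_tgen[OF d'] by simp
  also have "\<dots> = (\<Sum>x<?n. tgen d' ! h x)"
    using gen_h by simp
  also have "\<dots> = (\<Sum>x\<in>h ` {..<?n}. tgen d' ! x)"
    using inj by (simp add: sum.reindex)
  finally have "(\<Sum>x\<in>{..<?n'} - h ` {..<?n}. tgen d' ! x) = 0"
    using h_less by (subst sum_diff_nat) auto
  then have zero: "tgen d' ! x = 0" if "x < ?n'" "x \<notin> h ` {..<?n}" for x
    using that by simp
  have "tgen d ! i = (\<Sum>x | x < ?n' \<and> ret (ends d') hs x = i. tgen d' ! x)" if i: "i < ?n" for i
  proof -
    have "(\<Sum>x | x < ?n' \<and> ret (ends d') hs x = i. tgen d' ! x) = (\<Sum>x\<in>{h i}. tgen d' ! x)"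
    proof (rule sum.mono_neutral_right)
      show "{h i} \<subseteq> {x. x < ?n' \<and> ret (ends d') hs x = i}"
        using g.ret_nth[OF i] h_less i by (simp add: hs_nth)
      show "\<forall>x\<in>{x. x < ?n' \<and> ret (ends d') hs x = i} - {h i}. tgen d' ! x = 0"
      proof (intro ballI zero)
        fix x
        assume x: "x \<in> {x. x < ?n' \<and> ret (ends d') hs x = i} - {h i}"
        then show "x < ?n'"
          by simp
        show "x \<notin> h ` {..<?n}"
        proof
          assume "x \<in> h ` {..<?n}"
          then obtain j where "j < ?n" "x = hs ! j"
            using hs_nth by auto
          then show False
            using x g.ret_nth hs_nth by auto
        qed
      qed
    qed simp
    then show ?thesis
      using gen_h[OF i] by simp
  qed
  then show "tmor d d' hs"
    unfolding tmor_def using ok g.temb att d d' by (auto simp: tmor_def)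
qed

lemma noetherian_tree_cat: "noetherian_under tree_cat c"
  unfolding noetherian_under_def
proof (intro allI impI)
  fix d :: "nat \<Rightarrow> tobj" and f :: "nat \<Rightarrow> tmorph"
  assume df: "\<forall>k. d k \<in> Obj tree_cat \<and> f k \<in> Hom tree_cat c (d k)"
  define e where "e k = snd (snd (f k))" for k
  have f: "f k = (c, d k, e k)" and m: "tmor c (d k) (e k)" for k
    using df[rule_format, of k] by (auto simp: tree_cat_def e_def)
  let ?n = "\<lambda>k. length (ends (d k))"
  define t where "t k = bt_of (vlabel (d k) (e k)) (ends (d k)) 0 (?n k)" for k
  define A where "A = Pow {..<length (ends c)} \<times> {..(\<Sum>i<length (ends c). tgen c ! i)} \<times> Pow {..<length (att c)}"
  have sub: "set_bt (t k) \<subseteq> A" for k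
  proof -
    have len: "length (e k) = length (ends c)" "length (att (d k)) = length (att c)"
      using m[of k] by (auto simp: tmor_def temb_def)
    have "tgen (d k) ! x \<le> (\<Sum>i<length (ends c). tgen c ! i)" if "x < ?n k" for x
      unfolding tmor_sum_tgen[OF m[of k]] using that by (intro member_le_sum) auto
    then have "vlabel (d k) (e k) ` {0..<?n k} \<subseteq> A"
      using len by (auto simp: vlabel_def A_def)
    then show ?thesis
      unfolding t_def by (rule order_trans[OF set_bt_of])
  qed
  have "finite A"
    by (simp add: A_def)
  from binary_tree_kruskal[of A t, OF this sub]
  obtain i j where ij: "i < j" "bemb (t i) (t j)"
    by (elim exE conjE) (rule that)
  have tr: "tree (ends (d k))" for k
    using m[of k] by (simp add: tmor_def temb_def)
  then have sp: "span (ends (d k)) 0 (?n k)" for k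
    by (simp add: span_def tree_def)
  obtain h where h: "span_emb (vlabel (d i) (e i)) (ends (d i)) 0 (?n i)
      (vlabel (d j) (e j)) (ends (d j)) 0 (?n j) h"
    using span_emb_of_bemb[OF ij(2) tr tr t_def t_def le_refl sp le_refl sp] by (elim exE) (rule that)
  note step = noetherian_step[OF m m h]
  show "\<exists>i j. i < j \<and> (\<exists>h\<in>Hom tree_cat (d i) (d j). f j = cmp tree_cat h (f i))"
  proof (intro exI conjI bexI)
    show "i < j"
      by (rule ij(1))
    show "f j = cmp tree_cat (d i, d j, map h [0..<?n i]) (f i)"
      using step(2) by (simp add: f tree_cat_def)
    show "(d i, d j, map h [0..<?n i]) \<in> Hom tree_cat (d i) (d j)"
      using step(1) by (simp add: tree_cat_def)
  qed
qed

theorem groebner_tree_cat: "groebner tree_cat"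
  using admissible_order_tree_cat noetherian_tree_cat by (simp add: groebner_def)

lemma pos_nth: "distinct xs \<Longrightarrow> k < length xs \<Longrightarrow> pos xs (xs ! k) = k"
  unfolding pos_def by (rule the_equality) (auto simp: nth_eq_iff_index_eq)

lemma pos_less: "distinct xs \<Longrightarrow> x \<in> set xs \<Longrightarrow> pos xs x < length xs"
  by (metis in_set_conv_nth pos_nth)

lemma nth_pos: "distinct xs \<Longrightarrow> x \<in> set xs \<Longrightarrow> xs ! pos xs x = x"
  by (metis in_set_conv_nth pos_nth)

lemma pos_eq_iff:
  "distinct xs \<Longrightarrow> x \<in> set xs \<Longrightarrow> y \<in> set xs \<Longrightarrow> pos xs x = pos xs y \<longleftrightarrow> x = y"
  by (metis nth_pos)

lemma pos_less_iff:
  fixes xs :: "'a :: linorder list"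
  assumes "sorted_wrt (<) xs" "x \<in> set xs" "y \<in> set xs"
  shows "pos xs x < pos xs y \<longleftrightarrow> x < y"
proof -
  have d: "distinct xs"
    using assms(1) strict_sorted_iff by blast
  have *: "a < b" if "pos xs a < pos xs b" "a \<in> set xs" "b \<in> set xs" for a b
    using sorted_wrt_nth_less[OF assms(1) that(1)] pos_less[OF d that(3)]
      nth_pos[OF d that(2)] nth_pos[OF d that(3)] by simp
  show ?thesis
    using *[of x y] *[of y x] assms(2,3) pos_eq_iff[OF d assms(2,3)]
    by (metis less_asym linorder_neqE_nat)
qed

lemma disjoint_concat_nth:
  "distinct (concat xss) \<Longrightarrow> l < length xss \<Longrightarrow> l' < length xss \<Longrightarrow> l \<noteq> l' \<Longrightarrow>
    set (xss ! l) \<inter> set (xss ! l') = {}"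
proof (induction xss arbitrary: l l')
  case (Cons xs xss)
  have "set xs \<inter> set (xss ! k) = {}" if "k < length xss" for k
    using Cons.prems(1) that nth_mem[OF that] by fastforce
  then have *: "set xs \<inter> set (xss ! k) = {}" "set (xss ! k) \<inter> set xs = {}" if "k < length xss" for k
    using that by (simp_all add: Int_commute)
  show ?case
    using Cons.prems *(1)[of "l' - 1"] *(2)[of "l - 1"] Cons.IH[of "l - 1" "l' - 1"]
    by (cases l; cases l') simp_all
qed simp

lemma distinct_nth_concat: "distinct (concat xss) \<Longrightarrow> l < length xss \<Longrightarrow> distinct (xss ! l)"
  by (induction xss arbitrary: l) (auto simp: nth_Cons split: nat.splits)

lemma loc_nth:
  assumes "distinct (concat \<sigma>)" "l < length \<sigma>" "j < length (\<sigma> ! l)"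
  shows "loc \<sigma> (\<sigma> ! l ! j) = (l, j)"
  unfolding loc_def
proof (rule the_equality)
  fix x
  assume x: "case x of (l', j') \<Rightarrow> l' < length \<sigma> \<and> j' < length (\<sigma> ! l') \<and> \<sigma> ! l' ! j' = \<sigma> ! l ! j"
  obtain l' j' where x_eq: "x = (l', j')"
    by (cases x)
  have l': "l' < length \<sigma>" "j' < length (\<sigma> ! l')" "\<sigma> ! l' ! j' = \<sigma> ! l ! j"
    using x by (simp_all add: x_eq)
  have "\<sigma> ! l ! j \<in> set (\<sigma> ! l)" "\<sigma> ! l ! j \<in> set (\<sigma> ! l')"
    using assms(3) l' by (metis nth_mem)+
  then have "l' = l"
    using disjoint_concat_nth[OF assms(1,2) l'(1)] by (metis IntI empty_iff)
  then show "x = (l, j)"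
    using l' assms distinct_nth_concat[OF assms(1,2)] by (simp add: x_eq nth_eq_iff_index_eq)
qed (use assms in auto)

section \<open>Substitutions as maps of half-edges\<close>

definition wfg :: "ograph \<Rightarrow> bool" where
  "wfg G \<longleftrightarrow> length (gen G) = nv G \<and>
     (\<forall>h\<in>hes G. inv G h \<in> hes G \<and> inv G (inv G h) = h) \<and>
     (\<forall>h. h \<notin> hes G \<longrightarrow> inv G h = h) \<and>
     distinct (lvs G) \<and> set (lvs G) = {h \<in> hes G. inv G h = h}"

lemma wfg_inv_outside: "wfg G \<Longrightarrow> h \<notin> hes G \<Longrightarrow> inv G h = h"
  unfolding wfg_def by blast

lemma is_obj_iff:
  "is_obj G \<longleftrightarrow> wfg G \<and> 1 \<le> nv G \<and> (\<forall>v<nv G. \<forall>w<nv G. (v, w) \<in> (adj G)\<^sup>*)"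
  unfolding is_obj_def wfg_def by blast

lemma fst_hes: "h \<in> hes G \<Longrightarrow> fst h < nv G"
  by (auto simp: hes_def)

lemma finite_hes: "finite (hes G)"
proof (rule finite_subset)
  show "hes G \<subseteq> Sigma {..<nv G} (\<lambda>v. {..<ar G ! v})"
    by (auto simp: hes_def)
qed simp

definition fib :: "ograph \<Rightarrow> (nat \<Rightarrow> nat) \<Rightarrow> nat \<Rightarrow> nat list" where
  "fib q \<pi> l = sorted_list_of_set {w. w < nv q \<and> \<pi> w = l}"

lemma set_fib [simp]: "set (fib q \<pi> l) = {w. w < nv q \<and> \<pi> w = l}"
  by (simp add: fib_def)

lemma sorted_fib [simp]: "sorted_wrt (<) (fib q \<pi> l)"
  by (simp add: fib_def)

lemma distinct_fib [simp]: "distinct (fib q \<pi> l)"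
  by (simp add: fib_def)

lemma length_fib: "length (fib q \<pi> l) = card {w. w < nv q \<and> \<pi> w = l}"
  by (simp add: fib_def)

lemma fib_nth: "j < length (fib q \<pi> l) \<Longrightarrow> fib q \<pi> l ! j < nv q \<and> \<pi> (fib q \<pi> l ! j) = l"
  using nth_mem[of j "fib q \<pi> l"] by simp

definition lift_he :: "nat list \<Rightarrow> nat \<times> nat \<Rightarrow> nat \<times> nat" where
  "lift_he F h = (F ! fst h, snd h)"

definition restr_he :: "nat list \<Rightarrow> nat \<times> nat \<Rightarrow> nat \<times> nat" where
  "restr_he F h = (pos F (fst h), snd h)"

lemma lift_restr: "distinct F \<Longrightarrow> fst h \<in> set F \<Longrightarrow> lift_he F (restr_he F h) = h"
  by (simp add: lift_he_def restr_he_def nth_pos)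

lemma restr_lift: "distinct F \<Longrightarrow> fst h < length F \<Longrightarrow> restr_he F (lift_he F h) = h"
  by (simp add: lift_he_def restr_he_def pos_nth)

lemma fst_lift [simp]: "fst (lift_he F h) = F ! fst h"
  by (simp add: lift_he_def)

lemma fst_restr [simp]: "fst (restr_he F h) = pos F (fst h)"
  by (simp add: restr_he_def)

definition sub :: "ograph \<Rightarrow> ograph \<Rightarrow> (nat \<times> nat \<Rightarrow> nat \<times> nat) \<Rightarrow> (nat \<Rightarrow> nat) \<Rightarrow> nat \<Rightarrow> ograph"
  where "sub p q \<phi> \<pi> l =
    \<lparr>ar = map (\<lambda>w. ar q ! w) (fib q \<pi> l), gen = map (\<lambda>w. gen q ! w) (fib q \<pi> l),
     inv = (\<lambda>h. if fst h < length (fib q \<pi> l) \<and> lift_he (fib q \<pi> l) h \<in> hes q - \<phi> ` hes p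
             then restr_he (fib q \<pi> l) (inv q (lift_he (fib q \<pi> l) h)) else h),
     lvs = map (\<lambda>k. restr_he (fib q \<pi> l) (\<phi> (l, k))) [0..<ar p ! l]\<rparr>"

definition mk :: "ograph \<Rightarrow> ograph \<Rightarrow> (nat \<times> nat \<Rightarrow> nat \<times> nat) \<Rightarrow> (nat \<Rightarrow> nat) \<Rightarrow> omor" where
  "mk p q \<phi> \<pi> = (p, q, map (sub p q \<phi> \<pi>) [0..<nv p], map (fib q \<pi>) [0..<nv p])"

text \<open>A morphism from \<open>p\<close> to \<open>q\<close> amounts to an injection \<open>\<phi>\<close> of the half-edges of \<open>p\<close> into those of \<open>q\<close> and
  a map \<open>\<pi>\<close> of the vertices of \<open>q\<close> onto those of \<open>p\<close>: the graph substituted into \<open>l\<close> is the fibre of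
  \<open>\<pi>\<close> over \<open>l\<close> with the edges outside the image of \<open>\<phi>\<close>, and \<open>\<phi>\<close> records its leaf order. In these
  terms composition is composition of maps. The predicate \<open>str\<close> collects the conditions that involve neither
  connectedness nor genera.\<close>

definition str :: "ograph \<Rightarrow> ograph \<Rightarrow> (nat \<times> nat \<Rightarrow> nat \<times> nat) \<Rightarrow> (nat \<Rightarrow> nat) \<Rightarrow> bool" where
  "str p q \<phi> \<pi> \<longleftrightarrow> wfg p \<and> wfg q \<and>
     (\<forall>h\<in>hes p. \<phi> h \<in> hes q \<and> inv q (\<phi> h) = \<phi> (inv p h) \<and> \<pi> (fst (\<phi> h)) = fst h) \<and>
     inj_on \<phi> (hes p) \<and> lvs q = map \<phi> (lvs p) \<and> (\<forall>w<nv q. \<pi> w < nv p) \<and>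
     (\<forall>x\<in>hes q - \<phi> ` hes p. \<pi> (fst (inv q x)) = \<pi> (fst x))"

lemma nv_sub: "nv (sub p q \<phi> \<pi> l) = length (fib q \<pi> l)"
  by (simp add: sub_def nv_def)

lemma ar_sub: "ar (sub p q \<phi> \<pi> l) = map (\<lambda>w. ar q ! w) (fib q \<pi> l)"
  by (simp add: sub_def)

lemma hes_sub:
  "h \<in> hes (sub p q \<phi> \<pi> l) \<longleftrightarrow> fst h < length (fib q \<pi> l) \<and> lift_he (fib q \<pi> l) h \<in> hes q"
  using fib_nth[of "fst h" q \<pi> l]
  by (cases h) (auto simp: hes_def nv_sub lift_he_def ar_sub)

locale structural =
  fixes p q \<phi> \<pi>
  assumes str: "str p q \<phi> \<pi>"
begin

abbreviation "F \<equiv> fib q \<pi>"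
abbreviation "S \<equiv> sub p q \<phi> \<pi>"

lemma wp: "wfg p" and wq: "wfg q"
  and phi_hes: "h \<in> hes p \<Longrightarrow> \<phi> h \<in> hes q"
  and phi_inv: "h \<in> hes p \<Longrightarrow> inv q (\<phi> h) = \<phi> (inv p h)"
  and phi_fst: "h \<in> hes p \<Longrightarrow> \<pi> (fst (\<phi> h)) = fst h"
  and phi_inj: "inj_on \<phi> (hes p)"
  and phi_lvs: "lvs q = map \<phi> (lvs p)"
  and pi_less: "w < nv q \<Longrightarrow> \<pi> w < nv p"
  and pi_internal: "x \<in> hes q \<Longrightarrow> x \<notin> \<phi> ` hes p \<Longrightarrow> \<pi> (fst (inv q x)) = \<pi> (fst x)"
  using str by (auto simp: str_def)

lemma inv_q_hes: "x \<in> hes q \<Longrightarrow> inv q x \<in> hes q" and inv_q_inv: "x \<in> hes q \<Longrightarrow> inv q (inv q x) = x"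
  and inv_p_hes: "h \<in> hes p \<Longrightarrow> inv p h \<in> hes p" and inv_p_inv: "h \<in> hes p \<Longrightarrow> inv p (inv p h) = h"
  using wp wq by (auto simp: wfg_def)

lemma internal_neq: "x \<in> hes q \<Longrightarrow> x \<notin> \<phi> ` hes p \<Longrightarrow> inv q x \<noteq> x"
proof
  assume "x \<in> hes q" "x \<notin> \<phi> ` hes p" "inv q x = x"
  then have "x \<in> set (lvs q)"
    using wq by (auto simp: wfg_def)
  then have "x \<in> \<phi> ` set (lvs p)"
    using phi_lvs by simp
  then show False
    using \<open>x \<notin> \<phi> ` hes p\<close> wp by (auto simp: wfg_def)
qed

lemma internal_inv: "x \<in> hes q \<Longrightarrow> x \<notin> \<phi> ` hes p \<Longrightarrow> inv q x \<notin> \<phi> ` hes p"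
proof
  assume x: "x \<in> hes q" "x \<notin> \<phi> ` hes p" "inv q x \<in> \<phi> ` hes p"
  then obtain h where "h \<in> hes p" "inv q x = \<phi> h"
    by blast
  then have "x = \<phi> (inv p h)" "inv p h \<in> hes p"
    using inv_q_inv[OF x(1)] phi_inv inv_p_hes by auto
  then show False
    using x(2) by blast
qed

lemma in_F: "x \<in> hes q \<Longrightarrow> \<pi> (fst x) = l \<Longrightarrow> fst x \<in> set (F l)"
  using fst_hes by simp

lemma restr_hes: "x \<in> hes q \<Longrightarrow> \<pi> (fst x) = l \<Longrightarrow> restr_he (F l) x \<in> hes (S l)"
  using in_F by (simp add: hes_sub lift_restr pos_less)

lemma inv_S_internal:
  assumes "h \<in> hes (S l)" "lift_he (F l) h \<notin> \<phi> ` hes p"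
  shows "lift_he (F l) (inv (S l) h) = inv q (lift_he (F l) h)"
    "inv (S l) h = restr_he (F l) (inv q (lift_he (F l) h))" "inv (S l) h \<noteq> h"
proof -
  have h: "fst h < length (F l)" "lift_he (F l) h \<in> hes q"
    using assms by (simp_all add: hes_sub)
  show eq: "inv (S l) h = restr_he (F l) (inv q (lift_he (F l) h))"
    using h assms by (simp add: sub_def)
  have "\<pi> (fst (inv q (lift_he (F l) h))) = l"
    using pi_internal[OF h(2) assms(2)] fib_nth[OF h(1)] by simp
  then have "fst (inv q (lift_he (F l) h)) \<in> set (F l)"
    using in_F inv_q_hes h(2) by blast
  then show lift: "lift_he (F l) (inv (S l) h) = inv q (lift_he (F l) h)"
    using eq by (simp add: lift_restr)
  show "inv (S l) h \<noteq> h"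
    using lift internal_neq[OF h(2) assms(2)] by metis
qed

lemma inv_S_image: "lift_he (F l) h \<in> \<phi> ` hes p \<Longrightarrow> inv (S l) h = h"
  by (simp add: sub_def)

lemma inv_S_fixed_iff: "h \<in> hes (S l) \<Longrightarrow> inv (S l) h = h \<longleftrightarrow> lift_he (F l) h \<in> \<phi> ` hes p"
  using inv_S_image inv_S_internal(3) by blast

lemma hes_p_iff: "(l, k) \<in> hes p \<longleftrightarrow> l < nv p \<and> k < ar p ! l"
  by (simp add: hes_def)

lemma length_lvs_S: "length (lvs (S l)) = ar p ! l"
  by (simp add: sub_def)

lemma lvs_S_nth: "k < ar p ! l \<Longrightarrow> lvs (S l) ! k = restr_he (F l) (\<phi> (l, k))"
  by (simp add: sub_def)

lemma lift_lvs_S: "(l, k) \<in> hes p \<Longrightarrow> lift_he (F l) (lvs (S l) ! k) = \<phi> (l, k)"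
  using phi_fst[of "(l, k)"] phi_hes[of "(l, k)"] in_F[of "\<phi> (l, k)" l]
  by (simp add: hes_p_iff lvs_S_nth lift_restr)

lemma wfg_S:
  assumes "l < nv p"
  shows "wfg (S l)"
  unfolding wfg_def
proof (intro conjI ballI allI impI)
  show "length (gen (S l)) = nv (S l)"
    by (simp add: nv_sub) (simp add: sub_def)
next
  fix h
  assume h: "h \<in> hes (S l)"
  then have lh: "fst h < length (F l)" "lift_he (F l) h \<in> hes q"
    by (simp_all add: hes_sub)
  show "inv (S l) h \<in> hes (S l)"
  proof (cases "lift_he (F l) h \<in> \<phi> ` hes p")
    case True
    then show ?thesis using h inv_S_image by simp
  next
    case False
    then show ?thesis
      using inv_S_internal(2)[OF h False] restr_hes[OF inv_q_hes[OF lh(2)]]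
        pi_internal[OF lh(2) False] fib_nth[OF lh(1)] by simp
  qed
  note h' = this
  show "inv (S l) (inv (S l) h) = h"
  proof (cases "lift_he (F l) h \<in> \<phi> ` hes p")
    case True
    then show ?thesis using inv_S_image by simp
  next
    case False
    have "inv (S l) (inv (S l) h) = restr_he (F l) (lift_he (F l) h)"
      using inv_S_internal(2)[OF h'] inv_S_internal(1)[OF h False] internal_inv[OF lh(2) False]
        inv_q_inv[OF lh(2)] by simp
    then show ?thesis using lh by (simp add: restr_lift)
  qed
next
  fix h
  assume "h \<notin> hes (S l)"
  then show "inv (S l) h = h"
    by (auto simp: hes_sub) (auto simp: sub_def)
next
  have "lvs (S l) ! k \<noteq> lvs (S l) ! k'" if "k < ar p ! l" "k' < ar p ! l" "k \<noteq> k'" for k k'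
  proof -
    have "(l, k) \<in> hes p" "(l, k') \<in> hes p"
      using that assms by (simp_all add: hes_p_iff)
    then show ?thesis
      using lift_lvs_S phi_inj that(3) by (metis inj_onD snd_conv)
  qed
  then show "distinct (lvs (S l))"
    by (simp add: distinct_conv_nth length_lvs_S)
next
  show "set (lvs (S l)) = {h \<in> hes (S l). inv (S l) h = h}"
  proof (intro equalityI subsetI)
    fix h
    assume "h \<in> set (lvs (S l))"
    then obtain k where k: "k < ar p ! l" "h = lvs (S l) ! k"
      by (metis in_set_conv_nth length_lvs_S)
    then have hp: "(l, k) \<in> hes p"
      using assms by (simp add: hes_p_iff)
    have "h \<in> hes (S l)"
      using restr_hes[OF phi_hes[OF hp]] phi_fst[OF hp] k lvs_S_nth by simp
    then show "h \<in> {h \<in> hes (S l). inv (S l) h = h}"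
      using lift_lvs_S[OF hp] hp inv_S_image k by simp
  next
    fix h
    assume "h \<in> {h \<in> hes (S l). inv (S l) h = h}"
    then have h: "h \<in> hes (S l)" "lift_he (F l) h \<in> \<phi> ` hes p"
      using inv_S_fixed_iff[of h l] by auto
    then obtain g where g: "g \<in> hes p" "lift_he (F l) h = \<phi> g"
      by blast
    have fh: "fst h < length (F l)"
      using h by (simp add: hes_sub)
    have "fst g = l"
      using phi_fst[OF g(1)] g(2) fib_nth[OF fh] by (metis fst_lift)
    then have gk: "g = (l, snd g)" "snd g < ar p ! l"
      using g(1) by (auto simp: hes_def)
    have "h = restr_he (F l) (\<phi> g)"
      using g(2) fh by (metis restr_lift distinct_fib)
    then have "h = lvs (S l) ! snd g"
      using gk lvs_S_nth by metis
    then show "h \<in> set (lvs (S l))"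
      using gk(2) by (simp add: length_lvs_S)
  qed
qed

lemma distinct_concat_fibs: "distinct (concat (map F [0..<n]))"
  by (induction n) auto

lemma set_concat_fibs: "set (concat (map F [0..<nv p])) = {0..<nv q}"
  using pi_less by auto

lemma loc_fibs: "w < nv q \<Longrightarrow> loc (map F [0..<nv p]) w = (\<pi> w, pos (F (\<pi> w)) w)"
proof -
  assume w: "w < nv q"
  then have "w \<in> set (F (\<pi> w))" "\<pi> w < nv p"
    using pi_less by auto
  then show ?thesis
    using loc_nth[of "map F [0..<nv p]" "\<pi> w" "pos (F (\<pi> w)) w"] distinct_concat_fibs
    by (simp add: pos_less nth_pos)
qed

lemma length_concat_fibs: "length (concat (map F [0..<nv p])) = nv q"
  using distinct_card[OF distinct_concat_fibs] set_concat_fibs by (metis card_atLeastLessThan diff_zero)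

theorem subst_sub: "subst p (map S [0..<nv p]) (map F [0..<nv p]) = q"
proof -
  let ?s = "map F [0..<nv p]" and ?qs = "map S [0..<nv p]"
  let ?r = "subst p ?qs ?s"
  have posF: "pos (F (\<pi> w)) w < length (F (\<pi> w))" "F (\<pi> w) ! pos (F (\<pi> w)) w = w" if "w < nv q" for w
    using that by (simp_all add: pos_less nth_pos)
  have A: "map (\<lambda>w. case loc ?s w of (l, j) \<Rightarrow> ar (?qs ! l) ! j) [0..<nv q] = ar q"
  proof (rule nth_equalityI)
    fix w
    assume "w < length (map (\<lambda>w. case loc ?s w of (l, j) \<Rightarrow> ar (?qs ! l) ! j) [0..<nv q])"
    then have "w < nv q"
      by simp
    then show "map (\<lambda>w. case loc ?s w of (l, j) \<Rightarrow> ar (?qs ! l) ! j) [0..<nv q] ! w = ar q ! w"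
      using pi_less by (simp add: loc_fibs posF ar_sub)
  qed (simp add: nv_def)
  have G: "map (\<lambda>w. case loc ?s w of (l, j) \<Rightarrow> gen (?qs ! l) ! j) [0..<nv q] = gen q"
    using pi_less wq by (intro nth_equalityI) (auto simp: loc_fibs posF sub_def wfg_def)
  have ar: "ar ?r = ar q"
    unfolding subst_def Let_def length_concat_fibs using A by simp
  have gen: "gen ?r = gen q"
    unfolding subst_def Let_def length_concat_fibs using G by simp
  have lvs: "lvs ?r = lvs q"
  proof (rule nth_equalityI)
    show "length (lvs ?r) = length (lvs q)"
      by (simp add: subst_def Let_def phi_lvs)
  next
    fix k
    assume "k < length (lvs ?r)"
    then have k: "k < length (lvs p)"
      by (simp add: subst_def Let_def)
    obtain l i where li: "lvs p ! k = (l, i)"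
      by (cases "lvs p ! k")
    have hp: "(l, i) \<in> hes p"
      using k li wp nth_mem[OF k] by (auto simp: wfg_def)
    then have lp: "l < nv p"
      by (simp add: hes_p_iff)
    have "lvs ?r ! k = lift_he (F l) (lvs (S l) ! i)"
      using k li lp by (simp add: subst_def Let_def lift_he_def case_prod_unfold)
    then show "lvs ?r ! k = lvs q ! k"
      using lift_lvs_S[OF hp] k li by (simp add: phi_lvs)
  qed
  have inv: "inv ?r = inv q"
  proof
    fix x :: "nat \<times> nat"
    obtain w i where x: "x = (w, i)"
      by (cases x)
    show "inv ?r x = inv q x"
    proof (cases "x \<in> hes q")
      case False
      then have "\<not> (w < nv q \<and> i < ar q ! w)"
        by (simp add: x hes_def)
      then have "inv ?r x = x"
        unfolding subst_def Let_def length_concat_fibs A by (auto simp: x)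
      then show ?thesis
        using False wfg_inv_outside[OF wq] by simp
    next
      case True
      then have wi: "w < nv q" "i < ar q ! w"
        by (simp_all add: x hes_def)
      define l where "l = \<pi> w"
      define j where "j = pos (F l) w"
      have l: "l < nv p"
        using wi pi_less by (simp add: l_def)
      have j: "j < length (F l)" "F l ! j = w"
        using posF[OF wi(1)] by (simp_all add: j_def l_def)
      have loc: "loc ?s w = (l, j)"
        using loc_fibs[OF wi(1)] by (simp add: l_def j_def)
      have liftx: "lift_he (F l) (j, i) = x"
        using j by (simp add: lift_he_def x)
      then have ji: "(j, i) \<in> hes (S l)"
        using True j by (simp add: hes_sub)
      have rx: "inv ?r x = (if inv (S l) (j, i) \<noteq> (j, i)
              then (case inv (S l) (j, i) of (j', i') \<Rightarrow> (F l ! j', i'))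
              else (let k = pos (lvs (S l)) (j, i) in
                    if inv p (l, k) = (l, k) then (w, i)
                    else (case inv p (l, k) of (l', k') \<Rightarrow>
                           (case lvs (?qs ! l') ! k' of (j'', i'') \<Rightarrow> (?s ! l' ! j'', i'')))))"
        unfolding subst_def Let_def length_concat_fibs A using l wi by (simp add: x loc)
      show ?thesis
      proof (cases "x \<in> \<phi> ` hes p")
        case False
        then have "inv ?r x = lift_he (F l) (inv (S l) (j, i))"
          using rx inv_S_internal(3)[OF ji] liftx by (simp add: lift_he_def case_prod_unfold)
        then show ?thesis
          using inv_S_internal(1)[OF ji] liftx False by simp
      next
        case True
        then obtain h where h: "h \<in> hes p" "x = \<phi> h"
          by blast
        have "fst h = l"
          using phi_fst[OF h(1)] h(2) x by (metis fst_conv l_def)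
        then obtain k where hk: "h = (l, k)"
          by (cases h) simp
        have k: "k < ar p ! l"
          using h hk by (simp add: hes_p_iff)
        have "lvs (S l) ! k = (j, i)"
          using lvs_S_nth[OF k] h(2)[symmetric] hk by (simp add: restr_he_def j_def x)
        then have pos: "pos (lvs (S l)) (j, i) = k"
          using pos_nth[of "lvs (S l)" k] wfg_S[OF l] k by (simp add: wfg_def length_lvs_S)
        have fixd: "inv (S l) (j, i) = (j, i)"
          using inv_S_image liftx True by simp
        obtain l' k' where lk': "inv p h = (l', k')"
          by (cases "inv p h")
        have hp': "(l', k') \<in> hes p"
          using inv_p_hes[OF h(1)] lk' by simp
        then have l': "l' < nv p"
          by (simp add: hes_p_iff)
        have target: "lift_he (F l') (lvs (S l') ! k') = inv q x"
          using lift_lvs_S[OF hp'] phi_inv[OF h(1)] lk' h(2) by simp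
        show ?thesis
        proof (cases "inv p h = h")
          case True
          then show ?thesis
            using rx fixd pos hk phi_inv[OF h(1)] h(2) by (simp add: x)
        next
          case False
          then show ?thesis
            using rx fixd pos hk lk' l' target by (simp add: lift_he_def case_prod_unfold)
        qed
      qed
    qed
  qed
  show ?thesis
    using ar gen inv lvs by simp
qed

end

lemma sorted_list_eqI:
  fixes xs ys :: "'a :: linorder list"
  shows "sorted_wrt (<) xs \<Longrightarrow> sorted_wrt (<) ys \<Longrightarrow> set xs = set ys \<Longrightarrow> xs = ys"
  by (simp add: strict_sorted_equal)

lemma str_comp:
  assumes "str p q \<phi> \<pi>" "str q r \<phi>' \<pi>'"
  shows "str p r (\<phi>' \<circ> \<phi>) (\<pi> \<circ> \<pi>')"
proof -
  interpret f: structural p q \<phi> \<pi> using assms(1) by unfold_locales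
  interpret g: structural q r \<phi>' \<pi>' using assms(2) by unfold_locales
  have "\<phi> ` hes p \<subseteq> hes q"
    using f.phi_hes by blast
  then have "inj_on (\<phi>' \<circ> \<phi>) (hes p)"
    by (meson comp_inj_on f.phi_inj g.phi_inj inj_on_subset)
  moreover have "\<pi> (\<pi>' (fst (inv r x))) = \<pi> (\<pi>' (fst x))"
    if x: "x \<in> hes r" "x \<notin> (\<phi>' \<circ> \<phi>) ` hes p" for x
  proof (cases "x \<in> \<phi>' ` hes q")
    case True
    then obtain y where y: "y \<in> hes q" "x = \<phi>' y"
      by blast
    then have "y \<notin> \<phi> ` hes p"
      using x(2) by auto
    then show ?thesis
      using f.pi_internal[OF y(1)] y g.phi_inv g.phi_fst g.inv_p_hes by simp
  next
    case False
    then show ?thesis using g.pi_internal x(1) by simp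
  qed
  ultimately show ?thesis
    unfolding str_def
    using f.wp g.wq f.phi_hes g.phi_hes f.phi_inv g.phi_inv f.phi_fst g.phi_fst f.phi_lvs g.phi_lvs
      f.pi_less g.pi_less by auto
qed

lemma ograph_eqI:
  fixes G H :: ograph
  shows "ar G = ar H \<Longrightarrow> gen G = gen H \<Longrightarrow> inv G = inv H \<Longrightarrow> lvs G = lvs H \<Longrightarrow> G = H"
  by simp

locale composable = f: structural p q \<phi> \<pi> + g: structural q r \<phi>' \<pi>' for p q \<phi> \<pi> r \<phi>' \<pi>'
begin

sublocale gf: structural p r "\<phi>' \<circ> \<phi>" "\<pi> \<circ> \<pi>'"
  using str_comp[OF f.str g.str] by unfold_locales

context
  fixes l
  assumes l: "l < nv p"
begin

abbreviation "B \<equiv> gf.F l"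
abbreviation "P0 \<equiv> f.S l"
abbreviation "Q0 \<equiv> gf.S l"

definition "\<phi>0 h = restr_he B (\<phi>' (lift_he (f.F l) h))"
definition "\<pi>0 x = pos (f.F l) (\<pi>' (B ! x))"

lemma lift_P0:
  assumes "h \<in> hes P0"
  shows "lift_he (f.F l) h \<in> hes q" "\<pi> (f.F l ! fst h) = l" "fst h < length (f.F l)"
    "\<phi>' (lift_he (f.F l) h) \<in> hes r" "\<pi>' (fst (\<phi>' (lift_he (f.F l) h))) = f.F l ! fst h"
    "fst (\<phi>' (lift_he (f.F l) h)) \<in> set B" "lift_he B (\<phi>0 h) = \<phi>' (lift_he (f.F l) h)"
    "\<phi>0 h \<in> hes Q0"
proof -
  show 1: "lift_he (f.F l) h \<in> hes q" and 2: "fst h < length (f.F l)"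
    using assms by (simp_all add: hes_sub)
  show 3: "\<pi> (f.F l ! fst h) = l"
    using fib_nth[OF 2] by simp
  show 4: "\<phi>' (lift_he (f.F l) h) \<in> hes r"
    by (rule g.phi_hes[OF 1])
  show 5: "\<pi>' (fst (\<phi>' (lift_he (f.F l) h))) = f.F l ! fst h"
    using g.phi_fst[OF 1] by simp
  show 6: "fst (\<phi>' (lift_he (f.F l) h)) \<in> set B"
    using 3 5 fst_hes[OF 4] by simp
  show "lift_he B (\<phi>0 h) = \<phi>' (lift_he (f.F l) h)"
    using 6 by (simp add: \<phi>0_def lift_restr)
  show "\<phi>0 h \<in> hes Q0"
    unfolding \<phi>0_def using gf.restr_hes[OF 4] 3 5 by simp
qed

lemma phi0_image_iff:
  assumes "x \<in> hes Q0"
  shows "x \<in> \<phi>0 ` hes P0 \<longleftrightarrow> lift_he B x \<in> \<phi>' ` hes q"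
proof
  assume "x \<in> \<phi>0 ` hes P0"
  then show "lift_he B x \<in> \<phi>' ` hes q"
    using lift_P0 by auto
next
  assume "lift_he B x \<in> \<phi>' ` hes q"
  then obtain z where z: "z \<in> hes q" "lift_he B x = \<phi>' z"
    by blast
  have x: "fst x < length B"
    using assms by (simp add: hes_sub)
  have "\<pi> (fst z) = l"
    using fib_nth[OF x] g.phi_fst[OF z(1)] z(2) by (metis comp_apply fst_lift)
  then have "restr_he (f.F l) z \<in> hes P0" "lift_he (f.F l) (restr_he (f.F l) z) = z"
    using f.restr_hes[OF z(1)] f.in_F[OF z(1)] by (simp_all add: lift_restr)
  moreover from this have "x = \<phi>0 (restr_he (f.F l) z)"
    using z(2) restr_lift[of B x] x by (simp add: \<phi>0_def)
  ultimately show "x \<in> \<phi>0 ` hes P0"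
    by blast
qed

lemma str0: "str P0 Q0 \<phi>0 \<pi>0"
  unfolding str_def
proof (intro conjI ballI allI impI)
  show "wfg P0" "wfg Q0"
    using f.wfg_S gf.wfg_S l by auto
next
  fix h
  assume h: "h \<in> hes P0"
  note L = lift_P0[OF h]
  show "\<phi>0 h \<in> hes Q0"
    by (rule L(8))
  show "inv Q0 (\<phi>0 h) = \<phi>0 (inv P0 h)"
  proof (cases "lift_he (f.F l) h \<in> \<phi> ` hes p")
    case True
    then have "lift_he B (\<phi>0 h) \<in> (\<phi>' \<circ> \<phi>) ` hes p"
      using L(7) by auto
    then show ?thesis
      using gf.inv_S_image f.inv_S_image[OF True] by simp
  next
    case False
    have "lift_he B (\<phi>0 h) \<notin> (\<phi>' \<circ> \<phi>) ` hes p"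
    proof
      assume "lift_he B (\<phi>0 h) \<in> (\<phi>' \<circ> \<phi>) ` hes p"
      then obtain y where "y \<in> hes p" "\<phi>' (lift_he (f.F l) h) = \<phi>' (\<phi> y)"
        using L(7) by auto
      then show False
        using False L(1) f.phi_hes g.phi_inj by (metis imageI inj_onD)
    qed
    then have "inv Q0 (\<phi>0 h) = restr_he B (\<phi>' (inv q (lift_he (f.F l) h)))"
      using gf.inv_S_internal(2)[OF L(8)] L(7) g.phi_inv[OF L(1)] by simp
    then show ?thesis
      using f.inv_S_internal(1)[OF h False] by (simp add: \<phi>0_def)
  qed
  show "\<pi>0 (fst (\<phi>0 h)) = fst h"
    using L(3,5,6) by (simp add: \<pi>0_def \<phi>0_def nth_pos pos_nth)
next
  show "inj_on \<phi>0 (hes P0)"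
  proof (rule inj_onI)
    fix h h'
    assume h: "h \<in> hes P0" "h' \<in> hes P0" "\<phi>0 h = \<phi>0 h'"
    then have "\<phi>' (lift_he (f.F l) h) = \<phi>' (lift_he (f.F l) h')"
      using lift_P0(7) by metis
    then have "lift_he (f.F l) h = lift_he (f.F l) h'"
      using g.phi_inj lift_P0(1) h by (metis inj_onD)
    then show "h = h'"
      using lift_P0(3) h by (metis restr_lift distinct_fib)
  qed
next
  show "lvs Q0 = map \<phi>0 (lvs P0)"
  proof (rule nth_equalityI)
    fix k
    assume "k < length (lvs Q0)"
    then have k: "k < ar p ! l"
      by (simp add: gf.length_lvs_S)
    then have "(l, k) \<in> hes p"
      using l by (simp add: f.hes_p_iff)
    then show "lvs Q0 ! k = map \<phi>0 (lvs P0) ! k"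
      using k f.lift_lvs_S by (simp add: gf.lvs_S_nth f.length_lvs_S \<phi>0_def)
  qed (simp add: f.length_lvs_S gf.length_lvs_S)
next
  fix x
  assume "x < nv Q0"
  then have "B ! x < nv r" "\<pi> (\<pi>' (B ! x)) = l"
    using fib_nth[of x r "\<pi> \<circ> \<pi>'" l] by (simp_all add: nv_sub)
  then show "\<pi>0 x < nv P0"
    using g.pi_less by (simp add: \<pi>0_def nv_sub pos_less)
next
  fix x
  assume x: "x \<in> hes Q0 - \<phi>0 ` hes P0"
  then have nim: "lift_he B x \<notin> \<phi>' ` hes q"
    using phi0_image_iff[of x] by blast
  then have nim': "lift_he B x \<notin> (\<phi>' \<circ> \<phi>) ` hes p"
    using f.phi_hes by auto
  have xr: "lift_he B x \<in> hes r"
    using x by (simp add: hes_sub)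
  have "\<pi>0 (fst (inv Q0 x)) = pos (f.F l) (\<pi>' (fst (lift_he B (inv Q0 x))))"
    by (simp add: \<pi>0_def)
  also have "\<dots> = pos (f.F l) (\<pi>' (fst (inv r (lift_he B x))))"
    using gf.inv_S_internal(1)[OF _ nim'] x by simp
  also have "\<dots> = \<pi>0 (fst x)"
    using g.pi_internal[OF xr nim] by (simp add: \<pi>0_def)
  finally show "\<pi>0 (fst (inv Q0 x)) = \<pi>0 (fst x)" .
qed

lemma fib0:
  assumes "j < length (f.F l)"
  shows "fib Q0 \<pi>0 j = map (pos B) (g.F (f.F l ! j))"
proof (rule sorted_list_eqI)
  have w: "\<pi> (f.F l ! j) = l" "f.F l ! j < nv q"
    using fib_nth[OF assms] by auto
  then have sub: "set (g.F (f.F l ! j)) \<subseteq> set B"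
    by auto
  have "sorted_wrt (\<lambda>x y. pos B x < pos B y) (g.F (f.F l ! j))"
    by (rule sorted_wrt_mono_rel[of _ "(<)"]) (use sub in \<open>auto simp: pos_less_iff subset_iff\<close>)
  then show "sorted_wrt (<) (map (pos B) (g.F (f.F l ! j)))"
    by (simp add: sorted_wrt_map)
  show "set (fib Q0 \<pi>0 j) = set (map (pos B) (g.F (f.F l ! j)))"
  proof (intro equalityI subsetI)
    fix x
    assume "x \<in> set (fib Q0 \<pi>0 j)"
    then have x: "x < length B" "pos (f.F l) (\<pi>' (B ! x)) = j"
      unfolding set_fib mem_Collect_eq nv_sub \<pi>0_def by blast+
    have B: "B ! x < nv r" "\<pi> (\<pi>' (B ! x)) = l"
      using fib_nth[OF x(1)] by auto
    then have "\<pi>' (B ! x) = f.F l ! j"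
      using x(2) g.pi_less nth_pos[of "f.F l" "\<pi>' (B ! x)"] by simp
    then have "x = pos B (B ! x)" "B ! x \<in> set (g.F (f.F l ! j))"
      using x B by (simp_all add: pos_nth)
    then show "x \<in> set (map (pos B) (g.F (f.F l ! j)))"
      unfolding set_map by (rule image_eqI)
  next
    fix x
    assume "x \<in> set (map (pos B) (g.F (f.F l ! j)))"
    then obtain w where w': "x = pos B w" "w < nv r" "\<pi>' w = f.F l ! j"
      by auto
    then have "w \<in> set B"
      using w by simp
    then show "x \<in> set (fib Q0 \<pi>0 j)"
      using w' w assms by (simp add: nv_sub \<pi>0_def pos_less nth_pos pos_nth)
  qed
qed simp

lemma sub0:
  assumes j: "j < length (f.F l)"
  shows "sub P0 Q0 \<phi>0 \<pi>0 j = g.S (f.F l ! j)"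
proof -
  let ?w = "f.F l ! j"
  let ?K = "g.F ?w"
  let ?M = "fib Q0 \<pi>0 j"
  have w: "\<pi> ?w = l" "?w < nv q"
    using fib_nth[OF assms] by auto
  then have sub: "set ?K \<subseteq> set B"
    by auto
  note K0 = fib0[OF j]
  have B: "pos B x < length B" "B ! pos B x = x" if "x \<in> set ?K" for x
    using sub that by (auto simp: pos_less nth_pos)
  interpret z: structural P0 Q0 \<phi>0 \<pi>0
    using str0 by unfold_locales
  have lift2: "lift_he B (lift_he ?M h) = lift_he ?K h" if "fst h < length ?K" for h
    using that B[OF nth_mem] by (simp add: lift_he_def K0)
  have restr2: "restr_he ?M (restr_he B x) = restr_he ?K x" if x: "fst x \<in> set ?K" for x
  proof -
    have "?M ! pos ?K (fst x) = pos B (fst x)" "pos ?K (fst x) < length ?M"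
      using x unfolding K0 by (simp_all add: nth_pos pos_less del: set_fib)
    then have "pos ?M (pos B (fst x)) = pos ?K (fst x)"
      by (metis distinct_fib pos_nth)
    then show ?thesis
      by (simp add: restr_he_def)
  qed
  show ?thesis
  proof (rule ograph_eqI)
    show "ar (sub P0 Q0 \<phi>0 \<pi>0 j) = ar (g.S ?w)"
      using B by (simp add: ar_sub K0 del: set_fib)
    show "gen (sub P0 Q0 \<phi>0 \<pi>0 j) = gen (g.S ?w)"
      using B by (simp add: sub_def[of P0 Q0] sub_def[of q r] K0 del: set_fib)
        (simp add: sub_def del: set_fib)
    show "lvs (sub P0 Q0 \<phi>0 \<pi>0 j) = lvs (g.S ?w)"
    proof (rule nth_equalityI)
      show "length (lvs (sub P0 Q0 \<phi>0 \<pi>0 j)) = length (lvs (g.S ?w))"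
        using j by (simp add: z.length_lvs_S g.length_lvs_S ar_sub)
      fix k
      assume "k < length (lvs (sub P0 Q0 \<phi>0 \<pi>0 j))"
      then have k: "k < ar q ! ?w" "k < ar P0 ! j"
        using j by (simp_all add: z.length_lvs_S ar_sub)
      then have hq: "(?w, k) \<in> hes q"
        using w by (simp add: hes_def)
      have "fst (\<phi>' (?w, k)) \<in> set ?K"
        using g.in_F[OF g.phi_hes[OF hq]] g.phi_fst[OF hq] by simp
      then show "lvs (sub P0 Q0 \<phi>0 \<pi>0 j) ! k = lvs (g.S ?w) ! k"
        using k by (simp add: z.lvs_S_nth g.lvs_S_nth \<phi>0_def lift_he_def restr2)
    qed
    show "inv (sub P0 Q0 \<phi>0 \<pi>0 j) = inv (g.S ?w)"
    proof
      fix h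
      have hes: "h \<in> hes (sub P0 Q0 \<phi>0 \<pi>0 j) \<longleftrightarrow> h \<in> hes (g.S ?w)"
      proof (cases "fst h < length ?K")
        case True
        have "fst (lift_he ?M h) < length B"
          using True B[OF nth_mem] by (simp add: K0)
        then show ?thesis
          using True lift2[OF True] by (simp add: hes_sub) (simp add: K0)
      qed (simp add: hes_sub K0)
      show "inv (sub P0 Q0 \<phi>0 \<pi>0 j) h = inv (g.S ?w) h"
      proof (cases "h \<in> hes (g.S ?w)")
        case False
        moreover have "wfg (sub P0 Q0 \<phi>0 \<pi>0 j)" "wfg (g.S ?w)"
          using z.wfg_S g.wfg_S j w by (auto simp: nv_sub)
        ultimately show ?thesis
          using hes by (simp add: wfg_inv_outside)
      next
        case True
        then have hK: "fst h < length ?K" "lift_he ?K h \<in> hes r"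
          by (simp_all add: hes_sub)
        have h0: "lift_he ?M h \<in> hes Q0"
          using True hes by (auto simp: hes_sub)
        have im: "lift_he ?M h \<in> \<phi>0 ` hes P0 \<longleftrightarrow> lift_he ?K h \<in> \<phi>' ` hes q"
          using phi0_image_iff[OF h0] lift2[OF hK(1)] by simp
        show ?thesis
        proof (cases "lift_he ?K h \<in> \<phi>' ` hes q")
          case True
          then show ?thesis
            using z.inv_S_image g.inv_S_image im by simp
        next
          case False
          then have nim': "lift_he B (lift_he ?M h) \<notin> (\<phi>' \<circ> \<phi>) ` hes p"
            using lift2[OF hK(1)] f.phi_hes by auto
          have "inv (sub P0 Q0 \<phi>0 \<pi>0 j) h = restr_he ?M (inv Q0 (lift_he ?M h))"
            using z.inv_S_internal(2) True hes im False by simp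
          also have "\<dots> = restr_he ?M (restr_he B (inv r (lift_he ?K h)))"
            using gf.inv_S_internal(2)[OF h0 nim'] lift2[OF hK(1)] by simp
          also have "\<dots> = restr_he ?K (inv r (lift_he ?K h))"
          proof (rule restr2)
            show "fst (inv r (lift_he ?K h)) \<in> set ?K"
              using g.in_F[OF g.inv_q_hes[OF hK(2)]] g.pi_internal[OF hK(2) False]
                fib_nth[OF hK(1)] by simp
          qed
          also have "\<dots> = inv (g.S ?w) h"
            using g.inv_S_internal(2)[OF True False] by simp
          finally show ?thesis .
        qed
      qed
    qed
  qed
qed

lemma subst0:
  "subst P0 (map (\<lambda>j. g.S (f.F l ! j)) [0..<length (f.F l)])
     (map (\<lambda>j. map (pos B) (g.F (f.F l ! j))) [0..<length (f.F l)]) = Q0"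
proof -
  interpret z: structural P0 Q0 \<phi>0 \<pi>0
    using str0 by unfold_locales
  have "map (\<lambda>j. g.S (f.F l ! j)) [0..<length (f.F l)] = map z.S [0..<nv P0]"
    "map (\<lambda>j. map (pos B) (g.F (f.F l ! j))) [0..<length (f.F l)] = map z.F [0..<nv P0]"
    using sub0 fib0 by (simp_all add: nv_sub)
  then show ?thesis
    using z.subst_sub by simp
qed

end

theorem mcomp_mk: "mcomp (mk q r \<phi>' \<pi>') (mk p q \<phi> \<pi>) = mk p r (\<phi>' \<circ> \<phi>) (\<pi> \<circ> \<pi>')"
proof -
  have blk: "sorted_list_of_set {map g.F [0..<nv q] ! (map f.F [0..<nv p] ! l ! j) ! k | j k.
      j < length (map f.F [0..<nv p] ! l) \<and> k < length (map g.F [0..<nv q] ! (map f.F [0..<nv p] ! l ! j))}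
    = gf.F l" (is "sorted_list_of_set ?A = _") if l: "l < nv p" for l
  proof -
    have "?A = {w. w < nv r \<and> (\<pi> \<circ> \<pi>') w = l}"
    proof (intro equalityI subsetI)
      fix w
      assume "w \<in> ?A"
      then obtain j k where jk: "j < length (f.F l)" "k < length (g.F (f.F l ! j))"
        "w = g.F (f.F l ! j) ! k"
        using l fib_nth[of _ q \<pi> l] by auto
      then show "w \<in> {w. w < nv r \<and> (\<pi> \<circ> \<pi>') w = l}"
        using fib_nth[OF jk(1)] fib_nth[OF jk(2)] by simp
    next
      fix w
      assume "w \<in> {w. w < nv r \<and> (\<pi> \<circ> \<pi>') w = l}"
      then have w: "w < nv r" "\<pi> (\<pi>' w) = l" "\<pi>' w < nv q"
        using g.pi_less by auto
      then have 1: "\<pi>' w \<in> set (f.F l)" "w \<in> set (g.F (\<pi>' w))"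
        by auto
      have 2: "pos (f.F l) (\<pi>' w) < length (f.F l)" "f.F l ! pos (f.F l) (\<pi>' w) = \<pi>' w"
        "pos (g.F (\<pi>' w)) w < length (g.F (\<pi>' w))" "g.F (\<pi>' w) ! pos (g.F (\<pi>' w)) w = w"
        using 1 by (simp_all add: pos_less nth_pos del: set_fib)
      show "w \<in> ?A"
        using l 2 w(3)
        by (intro CollectI exI[of _ "pos (f.F l) (\<pi>' w)"] exI[of _ "pos (g.F (\<pi>' w)) w"]) simp
    qed
    then show ?thesis
      by (simp add: fib_def)
  qed
  have gS: "map (\<lambda>j. map g.S [0..<nv q] ! (f.F l ! j)) [0..<length (f.F l)] =
      map (\<lambda>j. g.S (f.F l ! j)) [0..<length (f.F l)]" for l
    using fib_nth[of _ q \<pi> l] by simp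
  have gF: "map (\<lambda>j. map (\<lambda>k. pos (gf.F l) (map g.F [0..<nv q] ! (f.F l ! j) ! k))
        [0..<length (map g.F [0..<nv q] ! (f.F l ! j))]) [0..<length (f.F l)] =
      map (\<lambda>j. map (pos (gf.F l)) (g.F (f.F l ! j))) [0..<length (f.F l)]" for l
    using fib_nth[of _ q \<pi> l] by (auto intro!: nth_equalityI)
  show ?thesis
    unfolding mcomp_def mk_def prod.case Let_def
  proof (intro arg_cong2[where f = Pair] refl map_cong, goal_cases)
    case (2 l)
    then have l: "l < nv p"
      by simp
    show ?case
      unfolding blk[OF l] using l subst0[OF l] by (simp add: gS gF)
  next
    case (4 l)
    then show ?case
      using blk[of l] by simp
  qed simp_all
qed

end

definition links :: "ograph \<Rightarrow> (nat \<times> nat) set \<Rightarrow> (nat \<times> nat) set" where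
  "links q I = (\<lambda>x. (fst x, fst (inv q x))) ` I"

text \<open>The truncated subtraction is that of \<^const>\<open>genus\<close>, applied to the fibre of \<open>\<pi>\<close> over \<open>l\<close>; internal
  half-edges come in pairs, so the division is exact.\<close>

definition contr :: "ograph \<Rightarrow> ograph \<Rightarrow> (nat \<times> nat \<Rightarrow> nat \<times> nat) \<Rightarrow> (nat \<Rightarrow> nat) \<Rightarrow> bool" where
  "contr p q \<phi> \<pi> \<longleftrightarrow> is_obj p \<and> is_obj q \<and> str p q \<phi> \<pi> \<and>
     (\<forall>l<nv p. \<exists>w<nv q. \<pi> w = l) \<and>
     (\<forall>w<nv q. \<forall>w'<nv q. \<pi> w = \<pi> w' \<longrightarrow> (w, w') \<in> (links q (hes q - \<phi> ` hes p))\<^sup>*) \<and>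
     (\<forall>l<nv p. gen p ! l = (\<Sum>w | w < nv q \<and> \<pi> w = l. gen q ! w) +
        (card {x \<in> hes q - \<phi> ` hes p. \<pi> (fst x) = l} div 2 + 1 - card {w. w < nv q \<and> \<pi> w = l}))"

lemma rtrancl_image:
  assumes "(a, b) \<in> r\<^sup>*" "\<And>x y. (x, y) \<in> r \<Longrightarrow> (f x, f y) \<in> s\<^sup>*"
  shows "(f a, f b) \<in> s\<^sup>*"
  using assms(1)
proof induction
  case (step y z)
  then show ?case
    using assms(2)[of y z] by (metis rtrancl_trans)
qed simp

context structural
begin

abbreviation "internal \<equiv> hes q - \<phi> ` hes p"

lemma adj_S_iff:
  "(j, j') \<in> adj (S l) \<longleftrightarrow>
    (\<exists>x\<in>internal. \<pi> (fst x) = l \<and> j = pos (F l) (fst x) \<and> j' = pos (F l) (fst (inv q x)))"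
proof
  assume "(j, j') \<in> adj (S l)"
  then obtain i i' where i: "(j, i) \<in> hes (S l)" "inv (S l) (j, i) = (j', i')"
    "inv (S l) (j, i) \<noteq> (j, i)"
    by (auto simp: adj_def)
  let ?x = "lift_he (F l) (j, i)"
  have ni: "?x \<notin> \<phi> ` hes p"
    using i inv_S_image by blast
  have h: "j < length (F l)" "?x \<in> hes q"
    using i(1) by (simp_all add: hes_sub)
  have "j = pos (F l) (fst ?x)" "\<pi> (fst ?x) = l"
    using h(1) fib_nth[OF h(1)] by (simp_all add: pos_nth)
  moreover have "j' = pos (F l) (fst (inv q ?x))"
    using inv_S_internal(2)[OF i(1) ni] i(2) by (simp add: restr_he_def)
  ultimately show "\<exists>x\<in>internal. \<pi> (fst x) = l \<and> j = pos (F l) (fst x) \<and> j' = pos (F l) (fst (inv q x))"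
    using h(2) ni by blast
next
  assume "\<exists>x\<in>internal. \<pi> (fst x) = l \<and> j = pos (F l) (fst x) \<and> j' = pos (F l) (fst (inv q x))"
  then obtain x where x: "x \<in> hes q" "x \<notin> \<phi> ` hes p" "\<pi> (fst x) = l" "j = pos (F l) (fst x)"
    "j' = pos (F l) (fst (inv q x))"
    by blast
  let ?h = "restr_he (F l) x"
  have h: "?h \<in> hes (S l)" "lift_he (F l) ?h = x"
    using restr_hes[OF x(1,3)] in_F[OF x(1,3)] by (simp_all add: lift_restr)
  have "inv (S l) ?h = restr_he (F l) (inv q x)" "inv (S l) ?h \<noteq> ?h"
    using inv_S_internal(2,3)[OF h(1)] h(2) x(2) by simp_all
  moreover have "?h = (j, snd x)" "restr_he (F l) (inv q x) = (j', snd (inv q x))"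
    using x by (simp_all add: restr_he_def)
  ultimately show "(j, j') \<in> adj (S l)"
    using h(1) unfolding adj_def by auto
qed

lemma links_fibre:
  assumes "(w, w') \<in> (links q internal)\<^sup>*" "\<pi> w = l"
  shows "\<pi> w' = l \<and> (pos (F l) w, pos (F l) w') \<in> (adj (S l))\<^sup>*"
  using assms(1)
proof induction
  case (step y z)
  then obtain x where x: "x \<in> internal" "y = fst x" "z = fst (inv q x)"
    by (auto simp: links_def)
  then have "(pos (F l) y, pos (F l) z) \<in> adj (S l)"
    using step adj_S_iff by blast
  moreover have "\<pi> z = l"
    using pi_internal[of x] x step by simp
  ultimately show ?case
    using step by (meson rtrancl.rtrancl_into_rtrancl)
qed (simp add: assms)

lemma is_obj_S:
  assumes "l < nv p"
  shows "is_obj (S l) \<longleftrightarrow> (\<exists>w<nv q. \<pi> w = l) \<and>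
    (\<forall>w<nv q. \<forall>w'<nv q. \<pi> w = l \<longrightarrow> \<pi> w' = l \<longrightarrow> (w, w') \<in> (links q internal)\<^sup>*)"
proof -
  have "F l = [] \<longleftrightarrow> {w. w < nv q \<and> \<pi> w = l} = {}"
    by (subst set_empty[symmetric]) (simp only: set_fib)
  then have 1: "1 \<le> nv (S l) \<longleftrightarrow> (\<exists>w<nv q. \<pi> w = l)"
    by (cases "F l") (auto simp: nv_sub)
  have 2: "(F l ! j, F l ! j') \<in> (links q internal)\<^sup>*" if "(j, j') \<in> (adj (S l))\<^sup>*" for j j'
    using that
  proof (rule rtrancl_image)
    fix j j'
    assume "(j, j') \<in> adj (S l)"
    then obtain x where x: "x \<in> internal" "\<pi> (fst x) = l" "j = pos (F l) (fst x)"
      "j' = pos (F l) (fst (inv q x))"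
      unfolding adj_S_iff by blast
    then have "\<pi> (fst (inv q x)) = l"
      using pi_internal[of x] by simp
    then have "F l ! j = fst x" "F l ! j' = fst (inv q x)"
      using x in_F[of x l] in_F[of "inv q x" l] inv_q_hes[of x] by (simp_all add: nth_pos)
    then show "(F l ! j, F l ! j') \<in> (links q internal)\<^sup>*"
      using x(1) by (auto simp: links_def)
  qed
  have "(\<forall>v<nv (S l). \<forall>w<nv (S l). (v, w) \<in> (adj (S l))\<^sup>*) \<longleftrightarrow>
    (\<forall>w<nv q. \<forall>w'<nv q. \<pi> w = l \<longrightarrow> \<pi> w' = l \<longrightarrow> (w, w') \<in> (links q internal)\<^sup>*)" (is "?L \<longleftrightarrow> ?R")
  proof
    assume L: ?L
    show ?R
    proof (intro allI impI)
      fix w w'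
      assume "w < nv q" "w' < nv q" "\<pi> w = l" "\<pi> w' = l"
      then have w: "w \<in> set (F l)" "w' \<in> set (F l)"
        by auto
      then show "(w, w') \<in> (links q internal)\<^sup>*"
        using 2[of "pos (F l) w" "pos (F l) w'"] L by (simp add: nth_pos pos_less nv_sub del: set_fib)
    qed
  next
    assume R: ?R
    show ?L
    proof (intro allI impI)
      fix v w
      assume "v < nv (S l)" "w < nv (S l)"
      then have vw: "v < length (F l)" "w < length (F l)"
        by (simp_all add: nv_sub)
      then show "(v, w) \<in> (adj (S l))\<^sup>*"
        using links_fibre[of "F l ! v" "F l ! w" l] R fib_nth[OF vw(1)] fib_nth[OF vw(2)]
        by (simp add: pos_nth)
    qed
  qed
  with 1 show ?thesis
    using wfg_S[OF assms] by (simp add: is_obj_iff)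
qed

lemma num_edges_S: "num_edges (S l) = card {x \<in> internal. \<pi> (fst x) = l} div 2"
proof -
  have "bij_betw (lift_he (F l)) {h \<in> hes (S l). inv (S l) h \<noteq> h} {x \<in> internal. \<pi> (fst x) = l}"
  proof (rule bij_betwI')
    fix h h'
    assume "h \<in> {h \<in> hes (S l). inv (S l) h \<noteq> h}" "h' \<in> {h \<in> hes (S l). inv (S l) h \<noteq> h}"
    then have "fst h < length (F l)" "fst h' < length (F l)"
      by (simp_all add: hes_sub)
    then show "lift_he (F l) h = lift_he (F l) h' \<longleftrightarrow> h = h'"
      by (metis restr_lift distinct_fib)
  next
    fix h
    assume h: "h \<in> {h \<in> hes (S l). inv (S l) h \<noteq> h}"
    then have "lift_he (F l) h \<notin> \<phi> ` hes p"
      using inv_S_image by blast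
    moreover have "fst h < length (F l)" "lift_he (F l) h \<in> hes q"
      using h by (simp_all add: hes_sub)
    ultimately show "lift_he (F l) h \<in> {x \<in> internal. \<pi> (fst x) = l}"
      using fib_nth[of "fst h" q \<pi> l] by simp
  next
    fix x
    assume x: "x \<in> {x \<in> internal. \<pi> (fst x) = l}"
    let ?h = "restr_he (F l) x"
    have h: "?h \<in> hes (S l)" "lift_he (F l) ?h = x"
      using restr_hes[of x l] in_F[of x l] x by (simp_all add: lift_restr)
    then show "\<exists>h\<in>{h \<in> hes (S l). inv (S l) h \<noteq> h}. x = lift_he (F l) h"
      using inv_S_internal(3)[OF h(1)] x by (intro bexI[of _ ?h]) simp_all
  qed
  then show ?thesis
    unfolding num_edges_def by (simp add: bij_betw_same_card)
qed

lemma sum_gen_S: "sum_list (gen (S l)) = (\<Sum>w | w < nv q \<and> \<pi> w = l. gen q ! w)"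
  by (simp add: sub_def sum_list_distinct_conv_sum_set)

lemma genus_S:
  "genus (S l) = card {x \<in> internal. \<pi> (fst x) = l} div 2 + 1 - card {w. w < nv q \<and> \<pi> w = l}"
  by (simp add: genus_def num_edges_S nv_sub length_fib)

end

lemma contr_iff:
  "contr p q \<phi> \<pi> \<longleftrightarrow> is_obj p \<and> is_obj q \<and> str p q \<phi> \<pi> \<and>
    (\<forall>l<nv p. is_obj (sub p q \<phi> \<pi> l) \<and>
      gen p ! l = sum_list (gen (sub p q \<phi> \<pi> l)) + genus (sub p q \<phi> \<pi> l))"
proof (cases "str p q \<phi> \<pi>")
  case True
  then interpret structural p q \<phi> \<pi> by unfold_locales
  let ?R = "(links q (hes q - \<phi> ` hes p))\<^sup>*"
  have "(\<forall>l<nv p. \<forall>w<nv q. \<forall>w'<nv q. \<pi> w = l \<longrightarrow> \<pi> w' = l \<longrightarrow> (w, w') \<in> ?R) \<longleftrightarrow>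
    (\<forall>w<nv q. \<forall>w'<nv q. \<pi> w = \<pi> w' \<longrightarrow> (w, w') \<in> ?R)"
    using pi_less by auto
  moreover have "(\<forall>l<nv p. is_obj (S l)) \<longleftrightarrow> (\<forall>l<nv p. \<exists>w<nv q. \<pi> w = l) \<and>
     (\<forall>l<nv p. \<forall>w<nv q. \<forall>w'<nv q. \<pi> w = l \<longrightarrow> \<pi> w' = l \<longrightarrow> (w, w') \<in> ?R)"
    using is_obj_S by (simp add: all_conj_distrib imp_conjR)
  ultimately have "contr p q \<phi> \<pi> \<longleftrightarrow> is_obj p \<and> is_obj q \<and> str p q \<phi> \<pi> \<and> (\<forall>l<nv p. is_obj (S l)) \<and>
    (\<forall>l<nv p. gen p ! l = sum_list (gen (S l)) + genus (S l))"
    unfolding contr_def sum_gen_S genus_S by simp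
  then show ?thesis
    by (simp add: all_conj_distrib imp_conjR)
qed (simp add: contr_def)

theorem is_mor_mk:
  assumes "contr p q \<phi> \<pi>"
  shows "is_mor p q (mk p q \<phi> \<pi>)"
proof -
  interpret structural p q \<phi> \<pi>
    using assms by unfold_locales (simp add: contr_def)
  show ?thesis
    using assms unfolding contr_iff is_mor_def mk_def prod.case
    by (simp add: length_lvs_S nv_sub distinct_concat_fibs set_concat_fibs subst_sub
        del: set_concat)
qed

theorem is_mor_cases:
  assumes "is_mor p q m"
  obtains \<phi> \<pi> where "contr p q \<phi> \<pi>" "m = mk p q \<phi> \<pi>"
proof -
  obtain qs \<sigma> where m: "m = (p, q, qs, \<sigma>)"
    using assms by (cases m) (auto simp: is_mor_def)
  have obj: "is_obj p" "is_obj q"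
    and len: "length qs = nv p" "length \<sigma> = nv p"
    and qs: "l < nv p \<Longrightarrow> is_obj (qs ! l)" "l < nv p \<Longrightarrow> length (lvs (qs ! l)) = ar p ! l"
      "l < nv p \<Longrightarrow> gen p ! l = sum_list (gen (qs ! l)) + genus (qs ! l)"
    and \<sigma>: "l < nv p \<Longrightarrow> length (\<sigma> ! l) = nv (qs ! l)" "l < nv p \<Longrightarrow> sorted_wrt (<) (\<sigma> ! l)"
    and dist: "distinct (concat \<sigma>)" and cover: "set (concat \<sigma>) = {0..<nv q}"
    and q: "q = subst p qs \<sigma>" for l
    using assms unfolding m is_mor_def by auto
  have wq: "wfg q" and wp: "wfg p" and wqs: "l < nv p \<Longrightarrow> wfg (qs ! l)" for l
    using obj qs(1) by (simp_all add: is_obj_iff)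
  have N: "length (concat \<sigma>) = nv q"
    using distinct_card[OF dist] cover by simp
  define \<phi> where "\<phi> h = lift_he (\<sigma> ! fst h) (lvs (qs ! fst h) ! snd h)" for h
  define \<pi> where "\<pi> w = fst (loc \<sigma> w)" for w
  have d\<sigma>: "distinct (\<sigma> ! l)" if "l < nv p" for l
    using distinct_nth_concat dist that len by metis
  have loc: "loc \<sigma> (\<sigma> ! l ! j) = (l, j)" if "l < nv p" "j < nv (qs ! l)" for l j
    using loc_nth[OF dist] that len \<sigma>(1) by simp
  have \<sigma>_less: "\<sigma> ! l ! j < nv q" if "l < nv p" "j < nv (qs ! l)" for l j
  proof -
    have "\<sigma> ! l ! j \<in> set (concat \<sigma>)"
      using that len \<sigma>(1) by (metis UnionI in_set_conv_nth set_concat image_eqI)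
    then show ?thesis unfolding cover by simp
  qed
  have ex: "\<exists>l<nv p. \<exists>j<nv (qs ! l). w = \<sigma> ! l ! j" if "w < nv q" for w
  proof -
    have "w \<in> set (concat \<sigma>)"
      using that cover by simp
    then obtain xs where "xs \<in> set \<sigma>" "w \<in> set xs"
      by auto
    then obtain l where l: "l < nv p" "w \<in> set (\<sigma> ! l)"
      using len by (metis in_set_conv_nth)
    then obtain j where "j < nv (qs ! l)" "\<sigma> ! l ! j = w"
      using \<sigma>(1) by (metis in_set_conv_nth)
    then show ?thesis
      using l(1) by blast
  qed
  let ?A = "map (\<lambda>w. case loc \<sigma> w of (l, j) \<Rightarrow> ar (qs ! l) ! j) [0..<nv q]"
  have A: "ar q = ?A"
    by (subst q) (simp add: subst_def Let_def N)
  have ar: "ar q ! (\<sigma> ! l ! j) = ar (qs ! l) ! j" if "l < nv p" "j < nv (qs ! l)" for l j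
    using A loc[OF that] \<sigma>_less[OF that] by simp
  have gen: "gen q ! (\<sigma> ! l ! j) = gen (qs ! l) ! j" if "l < nv p" "j < nv (qs ! l)" for l j
  proof -
    have "gen q = map (\<lambda>w. case loc \<sigma> w of (l, j) \<Rightarrow> gen (qs ! l) ! j) [0..<nv q]"
      by (subst q) (simp add: subst_def Let_def N)
    then show ?thesis
      using loc[OF that] \<sigma>_less[OF that] by simp
  qed
  have lift_hes: "lift_he (\<sigma> ! l) h \<in> hes q" if "l < nv p" "h \<in> hes (qs ! l)" for l h
    using that ar \<sigma>_less by (auto simp: hes_def lift_he_def)
  have pi_lift: "\<pi> (fst (lift_he (\<sigma> ! l) h)) = l" if "l < nv p" "h \<in> hes (qs ! l)" for l h
    using that loc fst_hes by (simp add: \<pi>_def)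
  have lift_inj: "h = h'" if "l < nv p" "h \<in> hes (qs ! l)" "h' \<in> hes (qs ! l)"
    "lift_he (\<sigma> ! l) h = lift_he (\<sigma> ! l) h'" for l h h'
    using that d\<sigma> \<sigma>(1) fst_hes by (metis restr_lift)
  have ex_lift: "\<exists>l<nv p. \<exists>h\<in>hes (qs ! l). x = lift_he (\<sigma> ! l) h" if x: "x \<in> hes q" for x
  proof -
    obtain l j where lj: "l < nv p" "j < nv (qs ! l)" "fst x = \<sigma> ! l ! j"
      using ex fst_hes[OF x] by blast
    moreover have "snd x < ar (qs ! l) ! j"
      using x lj ar[OF lj(1,2)] by (auto simp: hes_def)
    ultimately show ?thesis
      by (intro exI[of _ l] conjI bexI[of _ "(j, snd x)"]) (auto simp: lift_he_def hes_def prod_eq_iff)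
  qed
  have lvs_hes: "lvs (qs ! fst h) ! snd h \<in> hes (qs ! fst h)"
      "inv (qs ! fst h) (lvs (qs ! fst h) ! snd h) = lvs (qs ! fst h) ! snd h"
    if "h \<in> hes p" for h
  proof -
    have "fst h < nv p" "snd h < ar p ! fst h"
      using that by (auto simp: hes_def)
    then have "lvs (qs ! fst h) ! snd h \<in> set (lvs (qs ! fst h))"
      using qs(2) by simp
    then show "lvs (qs ! fst h) ! snd h \<in> hes (qs ! fst h)"
      "inv (qs ! fst h) (lvs (qs ! fst h) ! snd h) = lvs (qs ! fst h) ! snd h"
      using wqs[OF \<open>fst h < nv p\<close>] by (auto simp: wfg_def)
  qed
  have im: "lift_he (\<sigma> ! l) h \<in> \<phi> ` hes p \<longleftrightarrow> inv (qs ! l) h = h"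
    if l: "l < nv p" and h: "h \<in> hes (qs ! l)" for l h
  proof
    assume "lift_he (\<sigma> ! l) h \<in> \<phi> ` hes p"
    then obtain g where g: "g \<in> hes p" "lift_he (\<sigma> ! l) h = \<phi> g"
      by blast
    then have "fst g = l"
      using pi_lift[OF l h] pi_lift[OF fst_hes[OF g(1)] lvs_hes(1)[OF g(1)]] by (simp add: \<phi>_def)
    then have "h = lvs (qs ! l) ! snd g"
      using g lift_inj[OF l h] lvs_hes(1)[OF g(1)] by (simp add: \<phi>_def)
    then show "inv (qs ! l) h = h"
      using lvs_hes(2)[OF g(1)] \<open>fst g = l\<close> by simp
  next
    assume "inv (qs ! l) h = h"
    then have "h \<in> set (lvs (qs ! l))"
      using wqs[OF l] h by (auto simp: wfg_def)
    then obtain k where k: "k < ar p ! l" "h = lvs (qs ! l) ! k"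
      using qs(2)[OF l] by (metis in_set_conv_nth)
    then have "(l, k) \<in> hes p" "lift_he (\<sigma> ! l) h = \<phi> (l, k)"
      using l by (simp_all add: hes_def \<phi>_def)
    then show "lift_he (\<sigma> ! l) h \<in> \<phi> ` hes p"
      by blast
  qed
  have inv_q: "inv q (lift_he (\<sigma> ! l) h) = (if inv (qs ! l) h \<noteq> h then lift_he (\<sigma> ! l) (inv (qs ! l) h)
      else let k = pos (lvs (qs ! l)) h in
        if inv p (l, k) = (l, k) then lift_he (\<sigma> ! l) h else \<phi> (inv p (l, k)))"
    if l: "l < nv p" and h: "h \<in> hes (qs ! l)" for l h
  proof -
    obtain j i where ji: "h = (j, i)"
      by (cases h)
    have j: "j < nv (qs ! l)" "i < ar (qs ! l) ! j"
      using h by (simp_all add: ji hes_def)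
    have i: "i < ?A ! (\<sigma> ! l ! j)"
      using ar[OF l j(1)] j(2) A by simp
    show ?thesis
      by (subst q, unfold subst_def Let_def N)
        (use i \<sigma>_less[OF l j(1)] in
          \<open>simp add: ji lift_he_def loc[OF l j(1)] \<phi>_def case_prod_unfold\<close>)
  qed
  have phi_inv: "inv q (\<phi> h) = \<phi> (inv p h)" if hp: "h \<in> hes p" for h
  proof -
    have h: "fst h < nv p" "snd h < ar p ! fst h"
      using hp by (auto simp: hes_def)
    have "pos (lvs (qs ! fst h)) (lvs (qs ! fst h) ! snd h) = snd h"
      using pos_nth[of "lvs (qs ! fst h)" "snd h"] wqs[OF h(1)] qs(2)[OF h(1)] h(2)
      by (simp add: wfg_def)
    then show ?thesis
      using inv_q[OF h(1) lvs_hes(1)[OF hp]] lvs_hes(2)[OF hp] by (simp add: \<phi>_def Let_def)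
  qed
  have str: "str p q \<phi> \<pi>"
    unfolding str_def
  proof (intro conjI ballI allI impI wp wq)
    fix h
    assume h: "h \<in> hes p"
    show "\<phi> h \<in> hes q" "\<pi> (fst (\<phi> h)) = fst h"
      using lift_hes[OF fst_hes[OF h] lvs_hes(1)[OF h]] pi_lift[OF fst_hes[OF h] lvs_hes(1)[OF h]]
      by (simp_all add: \<phi>_def)
    show "inv q (\<phi> h) = \<phi> (inv p h)"
      by (rule phi_inv[OF h])
  next
    show "inj_on \<phi> (hes p)"
    proof (rule inj_onI)
      fix h h'
      assume h: "h \<in> hes p" "h' \<in> hes p" "\<phi> h = \<phi> h'"
      then have 1: "fst h = fst h'"
        using pi_lift[OF fst_hes[OF h(1)] lvs_hes(1)[OF h(1)]]
          pi_lift[OF fst_hes[OF h(2)] lvs_hes(1)[OF h(2)]] by (simp add: \<phi>_def)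
      then have "lvs (qs ! fst h) ! snd h = lvs (qs ! fst h) ! snd h'"
        using lift_inj[OF fst_hes[OF h(1)] lvs_hes(1)[OF h(1)]] lvs_hes(1)[OF h(2)] h(3)
        by (simp add: \<phi>_def)
      moreover have "snd h < length (lvs (qs ! fst h))" "snd h' < length (lvs (qs ! fst h))"
        using h 1 qs(2) by (auto simp: hes_def)
      ultimately have "snd h = snd h'"
        using wqs[OF fst_hes[OF h(1)]] by (simp add: wfg_def nth_eq_iff_index_eq)
      then show "h = h'"
        using 1 by (simp add: prod_eq_iff)
    qed
  next
    have "lvs q = map (\<lambda>(l, k). lift_he (\<sigma> ! l) (lvs (qs ! l) ! k)) (lvs p)"
      by (subst q) (simp add: subst_def Let_def lift_he_def case_prod_unfold)
    then show "lvs q = map \<phi> (lvs p)"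
      by (simp add: \<phi>_def case_prod_unfold)
  next
    fix w
    assume "w < nv q"
    then show "\<pi> w < nv p"
      using ex loc by (metis \<pi>_def fst_conv)
  next
    fix x
    assume "x \<in> hes q - \<phi> ` hes p"
    then obtain l h where lh: "l < nv p" "h \<in> hes (qs ! l)" "x = lift_he (\<sigma> ! l) h"
      "x \<notin> \<phi> ` hes p"
      using ex_lift by blast
    then have "inv (qs ! l) h \<noteq> h"
      using im by blast
    then have "inv q x = lift_he (\<sigma> ! l) (inv (qs ! l) h)" "inv (qs ! l) h \<in> hes (qs ! l)"
      using inv_q lh wqs[OF lh(1)] by (auto simp: wfg_def)
    then show "\<pi> (fst (inv q x)) = \<pi> (fst x)"
      using lh pi_lift by metis
  qed
  then interpret structural p q \<phi> \<pi>
    by unfold_locales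
  have F: "F l = \<sigma> ! l" if l: "l < nv p" for l
  proof (rule sorted_list_eqI)
    show "set (F l) = set (\<sigma> ! l)"
    proof (intro equalityI subsetI)
      fix w
      assume "w \<in> set (F l)"
      then have w: "w < nv q" "\<pi> w = l"
        by simp_all
      then obtain l' j where lj: "l' < nv p" "j < nv (qs ! l')" "w = \<sigma> ! l' ! j"
        using ex by blast
      then have "l' = l"
        using w(2) loc by (simp add: \<pi>_def)
      then show "w \<in> set (\<sigma> ! l)"
        using lj \<sigma>(1) by simp
    next
      fix w
      assume "w \<in> set (\<sigma> ! l)"
      then obtain j where "j < nv (qs ! l)" "w = \<sigma> ! l ! j"
        using \<sigma>(1)[OF l] by (metis in_set_conv_nth)
      then show "w \<in> set (F l)"
        using l \<sigma>_less loc by (simp add: \<pi>_def)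
    qed
  qed (use \<sigma>(2)[OF l] in simp_all)
  have S: "S l = qs ! l" if l: "l < nv p" for l
  proof (rule ograph_eqI)
    show arS: "ar (S l) = ar (qs ! l)"
      using \<sigma>(1)[OF l] ar[OF l] by (intro nth_equalityI) (simp_all add: ar_sub F[OF l] nv_def)
    show "gen (S l) = gen (qs ! l)"
      using \<sigma>(1)[OF l] gen[OF l] wqs[OF l]
      by (intro nth_equalityI) (simp_all add: sub_def F[OF l] wfg_def)
    show "lvs (S l) = lvs (qs ! l)"
    proof (rule nth_equalityI)
      fix k
      assume "k < length (lvs (S l))"
      then have k: "(l, k) \<in> hes p"
        using l by (simp add: length_lvs_S hes_def)
      then show "lvs (S l) ! k = lvs (qs ! l) ! k"
        using lvs_hes(1)[OF k] d\<sigma>[OF l] \<sigma>(1)[OF l] fst_hes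
        by (simp add: sub_def F[OF l] \<phi>_def restr_lift hes_p_iff)
    qed (simp add: length_lvs_S qs(2)[OF l])
    have hesS: "hes (S l) = hes (qs ! l)"
      using arS by (simp add: hes_def nv_def)
    show "inv (S l) = inv (qs ! l)"
    proof
      fix h
      show "inv (S l) h = inv (qs ! l) h"
      proof (cases "h \<in> hes (qs ! l)")
        case False
        then show ?thesis
          using wfg_inv_outside[OF wqs[OF l]] wfg_inv_outside[OF wfg_S[OF l]] hesS by simp
      next
        case True
        show ?thesis
        proof (cases "inv (qs ! l) h = h")
          case True
          then show ?thesis
            using im[OF l \<open>h \<in> hes (qs ! l)\<close>] inv_S_image F[OF l] by simp
        next
          case False
          then have "inv (S l) h = restr_he (\<sigma> ! l) (lift_he (\<sigma> ! l) (inv (qs ! l) h))"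
            using inv_S_internal(2)[of h l] hesS True im[OF l True] inv_q[OF l True] F[OF l] by simp
          moreover have "inv (qs ! l) h \<in> hes (qs ! l)"
            using wqs[OF l] True by (simp add: wfg_def)
          ultimately show ?thesis
            using d\<sigma>[OF l] \<sigma>(1)[OF l] fst_hes by (simp add: restr_lift)
        qed
      qed
    qed
  qed
  show thesis
  proof
    show "contr p q \<phi> \<pi>"
      using obj str S qs(1,3) by (simp add: contr_iff)
    show "m = mk p q \<phi> \<pi>"
      using F S len by (auto simp: m mk_def intro!: nth_equalityI)
  qed
qed

lemma mk_cong:
  assumes "\<And>h. h \<in> hes p \<Longrightarrow> \<phi> h = \<phi>' h" "\<And>w. w < nv q \<Longrightarrow> \<pi> w = \<pi>' w"
  shows "mk p q \<phi> \<pi> = mk p q \<phi>' \<pi>'"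
proof -
  have fib: "fib q \<pi> l = fib q \<pi>' l" for l
  proof -
    have "{w. w < nv q \<and> \<pi> w = l} = {w. w < nv q \<and> \<pi>' w = l}"
      using assms(2) by auto
    then show ?thesis
      by (simp add: fib_def)
  qed
  have "\<phi> ` hes p = \<phi>' ` hes p"
    using assms(1) by force
  moreover have "\<phi> (l, k) = \<phi>' (l, k)" if "l < nv p" "k < ar p ! l" for l k
    using that assms(1) by (simp add: hes_def)
  ultimately show ?thesis
    unfolding mk_def sub_def fib by simp
qed

lemma midm_mk: "midm p = mk p p id id"
proof -
  have fib: "fib p id l = [l]" if "l < nv p" for l
  proof -
    have "{w. w < nv p \<and> id w = l} = {l}"
      using that by auto
    then show ?thesis
      by (simp add: fib_def)
  qed
  moreover have "corolla (ar p ! l) (gen p ! l) = sub p p id id l" if "l < nv p" for l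
    using that pos_nth[of "[l]" 0]
    by (simp add: corolla_def sub_def fib[OF that] restr_he_def) (simp add: id_def)
  ultimately show ?thesis
    by (simp add: midm_def mk_def)
qed

section \<open>Realizing marked trees as graphs\<close>

lemma finite_bij_upto: "finite A \<Longrightarrow> \<exists>f. bij_betw f A {..<card A}"
  using ex_bij_betw_finite_nat[of A] by (simp add: atLeast0LessThan)

lemma realize:
  fixes X :: "'h set" and t :: "'h \<Rightarrow> nat"
  assumes X: "finite X" and t: "\<And>x. x \<in> X \<Longrightarrow> t x < n"
    and \<iota>: "\<And>x. x \<in> X \<Longrightarrow> \<iota> x \<in> X" "\<And>x. x \<in> X \<Longrightarrow> \<iota> (\<iota> x) = x"
    and ls: "distinct ls" "set ls = {x \<in> X. \<iota> x = x}"
    and n: "1 \<le> n" "length gs = n"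
    and conn: "\<And>v w. v < n \<Longrightarrow> w < n \<Longrightarrow> (v, w) \<in> ((\<lambda>x. (t x, t (\<iota> x))) ` X)\<^sup>*"
  shows "\<exists>G \<beta>. is_obj G \<and> nv G = n \<and> gen G = gs \<and> bij_betw \<beta> X (hes G) \<and>
    (\<forall>x\<in>X. fst (\<beta> x) = t x \<and> inv G (\<beta> x) = \<beta> (\<iota> x)) \<and> lvs G = map \<beta> ls"
proof -
  define A where "A v = {x \<in> X. t x = v}" for v
  have "\<exists>f. bij_betw f (A v) {..<card (A v)}" for v
    using X by (intro finite_bij_upto) (simp add: A_def)
  then obtain f where f: "\<And>v. bij_betw (f v) (A v) {..<card (A v)}"
    by metis
  define \<beta> where "\<beta> x = (t x, f (t x) x)" for x
  let ?inv = "\<lambda>h. if h \<in> \<beta> ` X then \<beta> (\<iota> (inv_into X \<beta> h)) else h"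
  define G where "G = \<lparr>ar = map (\<lambda>v. card (A v)) [0..<n], gen = gs, inv = ?inv, lvs = map \<beta> ls\<rparr>"
  have inj: "inj_on \<beta> X"
  proof (rule inj_onI)
    fix x y
    assume xy: "x \<in> X" "y \<in> X" "\<beta> x = \<beta> y"
    then have "x \<in> A (t x)" "y \<in> A (t x)" "f (t x) x = f (t x) y"
      by (auto simp: \<beta>_def A_def)
    then show "x = y"
      using f[of "t x"] by (meson bij_betw_def inj_onD)
  qed
  have nv: "nv G = n"
    by (simp add: G_def nv_def)
  have hes: "hes G = \<beta> ` X"
  proof (intro equalityI subsetI)
    fix h
    assume h: "h \<in> hes G"
    then have "snd h < card (A (fst h))"
      by (auto simp: hes_def nv) (simp add: G_def)
    then have "snd h \<in> f (fst h) ` A (fst h)"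
      using f[of "fst h"] by (simp add: bij_betw_def)
    then obtain x where "x \<in> X" "t x = fst h" "snd h = f (fst h) x"
      by (auto simp: A_def)
    then show "h \<in> \<beta> ` X"
      by (intro image_eqI[of _ _ x]) (simp_all add: \<beta>_def prod_eq_iff)
  next
    fix h
    assume "h \<in> \<beta> ` X"
    then obtain x where x: "x \<in> X" "h = \<beta> x"
      by blast
    have "x \<in> A (t x)"
      using x(1) by (simp add: A_def)
    then have "f (t x) x \<in> {..<card (A (t x))}"
      by (rule bij_betw_apply[OF f])
    then have "fst h < nv G" "snd h < ar G ! fst h"
      using x t[OF x(1)] by (simp_all add: \<beta>_def nv) (simp add: G_def)
    then show "h \<in> hes G"
      by (cases h) (simp add: hes_def)
  qed
  have inv: "inv G (\<beta> x) = \<beta> (\<iota> x)" if "x \<in> X" for x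
    using that inj by (simp add: G_def)
  have inv_iff: "inv G (\<beta> x) = \<beta> x \<longleftrightarrow> \<iota> x = x" if "x \<in> X" for x
    using inv[OF that] inj that \<iota>(1)[OF that] by (auto dest: inj_onD)
  have "wfg G"
    unfolding wfg_def
  proof (intro conjI ballI allI impI)
    show "length (gen G) = nv G"
      using n nv by (simp add: G_def)
    show "distinct (lvs G)"
      using ls inj by (simp add: G_def distinct_map inj_on_subset)
    have "lvs G = map \<beta> ls"
      by (simp add: G_def)
    then show "set (lvs G) = {h \<in> hes G. inv G h = h}"
      using ls(2) inv_iff by (auto simp: hes)
  next
    fix h
    assume "h \<in> hes G"
    then obtain x where "x \<in> X" "h = \<beta> x"
      using hes by blast
    then show "inv G h \<in> hes G" "inv G (inv G h) = h"
      using inv \<iota> hes by auto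
  next
    fix h
    assume "h \<notin> hes G"
    then show "inv G h = h"
      unfolding hes by (simp add: G_def)
  qed
  moreover have "(v, w) \<in> (adj G)\<^sup>*" if "v < nv G" "w < nv G" for v w
  proof -
    have "(v, w) \<in> ((\<lambda>x. (t x, t (\<iota> x))) ` X)\<^sup>*"
      using conn that nv by simp
    then have "(id v, id w) \<in> (adj G)\<^sup>*"
    proof (rule rtrancl_image)
      fix y z
      assume "(y, z) \<in> (\<lambda>x. (t x, t (\<iota> x))) ` X"
      then obtain x where x: "x \<in> X" "y = t x" "z = t (\<iota> x)"
        by blast
      show "(id y, id z) \<in> (adj G)\<^sup>*"
      proof (cases "\<iota> x = x")
        case True
        then show ?thesis using x by simp
      next
        case False
        have "\<beta> x \<in> hes G" "inv G (\<beta> x) = \<beta> (\<iota> x)" "inv G (\<beta> x) \<noteq> \<beta> x"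
          using x(1) hes inv inv_iff False by auto
        then have "(y, z) \<in> adj G"
          unfolding adj_def mem_Collect_eq prod.case \<beta>_def x(2,3) by blast
        then show ?thesis by auto
      qed
    qed
    then show ?thesis by simp
  qed
  ultimately have "is_obj G"
    using n nv by (simp add: is_obj_iff)
  moreover have "gen G = gs" "lvs G = map \<beta> ls"
    by (simp_all add: G_def)
  moreover have "fst (\<beta> x) = t x" for x
    by (simp add: \<beta>_def)
  moreover have "bij_betw \<beta> X (hes G)"
    using inj hes by (simp add: bij_betw_def)
  ultimately show ?thesis
    using nv inv by blast
qed

definition par :: "nat list \<Rightarrow> nat \<Rightarrow> nat" where
  "par en v = Max {u. u < v \<and> anc en u v}"

lemma par:
  assumes "tree en" "1 \<le> v" "v < length en"
  shows par_less: "par en v < v" and anc_par: "anc en (par en v) v"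
    and anc_par_iff: "anc en z (par en v) \<longleftrightarrow> anc en z v \<and> z \<noteq> v"
proof -
  let ?A = "{u. u < v \<and> anc en u v}"
  have "0 \<in> ?A"
    using assms anc_zero by simp
  then have "par en v \<in> ?A"
    unfolding par_def by (intro Max_in) auto
  then show 1: "par en v < v" "anc en (par en v) v"
    by simp_all
  show "anc en z (par en v) \<longleftrightarrow> anc en z v \<and> z \<noteq> v"
  proof
    assume "anc en z (par en v)"
    then show "anc en z v \<and> z \<noteq> v"
      using anc_trans[OF assms(1) _ 1(2)] 1(1) assms(3) by (auto simp: anc_def)
  next
    assume z: "anc en z v \<and> z \<noteq> v"
    then have "z \<in> ?A"
      by (auto simp: anc_def)
    then have "z \<le> par en v"
      unfolding par_def by (intro Max_ge) auto
    then show "anc en z (par en v)"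
      using z 1(1) anc_between by (meson less_imp_le)
  qed
qed

text \<open>The half-edges of the glued graph: \<open>(0, k)\<close> is the mark \<open>k\<close>, and \<open>(1, v)\<close>, \<open>(2, v)\<close> are the halves at
  \<open>v\<close> and at the parent of \<open>v\<close> of the tree edge above \<open>v\<close>.\<close>

definition thes :: "tobj \<Rightarrow> (nat \<times> nat) set" where
  "thes c = {0} \<times> {..<length (att c)} \<union> {1, 2} \<times> {1..<length (ends c)}"

definition tvert :: "tobj \<Rightarrow> nat \<times> nat \<Rightarrow> nat" where
  "tvert c x = (if fst x = 0 then att c ! snd x else if fst x = 1 then snd x else par (ends c) (snd x))"

definition tinv :: "tobj \<Rightarrow> nat \<times> nat \<Rightarrow> nat \<times> nat" where
  "tinv c x = (if fst x = 0 then (0, mate c ! snd x) else if fst x = 1 then (2, snd x) else (1, snd x))"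

definition realizes :: "tobj \<Rightarrow> ograph \<Rightarrow> (nat \<times> nat \<Rightarrow> nat \<times> nat) \<Rightarrow> bool" where
  "realizes c G \<beta> \<longleftrightarrow> is_obj G \<and> nv G = length (ends c) \<and> gen G = tgen c \<and>
     bij_betw \<beta> (thes c) (hes G) \<and>
     (\<forall>x\<in>thes c. fst (\<beta> x) = tvert c x \<and> inv G (\<beta> x) = \<beta> (tinv c x)) \<and>
     lvs G = map (\<beta> \<circ> Pair 0) (leafs c)"

lemma tvert_less:
  assumes "tobj_ok c" "x \<in> thes c"
  shows "tvert c x < length (ends c)"
proof (cases "fst x = 0")
  case True
  then show ?thesis
    using assms by (auto simp: tvert_def thes_def tobj_ok_def subset_iff)
next
  case False
  then have "1 \<le> snd x" "snd x < length (ends c)"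
    using assms(2) by (auto simp: thes_def)
  then show ?thesis
    using False assms(1) par_less[of "ends c" "snd x"] by (auto simp: tvert_def tobj_ok_def)
qed

lemma tinv_thes: "tobj_ok c \<Longrightarrow> x \<in> thes c \<Longrightarrow> tinv c x \<in> thes c"
  by (auto simp: thes_def tinv_def tobj_ok_def)

lemma tinv_tinv: "tobj_ok c \<Longrightarrow> x \<in> thes c \<Longrightarrow> tinv c (tinv c x) = x"
  by (auto simp: thes_def tinv_def tobj_ok_def)

lemma finite_thes: "finite (thes c)"
  by (simp add: thes_def)

lemma tree_connected:
  assumes "tree en" "\<And>v. 1 \<le> v \<Longrightarrow> v < length en \<Longrightarrow> (v, par en v) \<in> R \<and> (par en v, v) \<in> R"
    and "v < length en" "w < length en"
  shows "(v, w) \<in> R\<^sup>*"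
proof -
  have root: "(0, v) \<in> R\<^sup>* \<and> (v, 0) \<in> R\<^sup>*" if "v < length en" for v
    using that
  proof (induction v rule: less_induct)
    case (less v)
    show ?case
    proof (cases "v = 0")
      case False
      then have "1 \<le> v"
        by simp
      then have "(0, par en v) \<in> R\<^sup>* \<and> (par en v, 0) \<in> R\<^sup>*"
        using less par_less[OF assms(1)] by (meson less_trans)
      then show ?thesis
        using assms(2)[OF \<open>1 \<le> v\<close> less.prems]
        by (meson converse_rtrancl_into_rtrancl rtrancl.rtrancl_into_rtrancl)
    qed simp
  qed
  show ?thesis
    using root[OF assms(3)] root[OF assms(4)] by (meson rtrancl_trans)
qed

lemma ex_realizes:
  assumes "tobj_ok c"
  shows "\<exists>G \<beta>. realizes c G \<beta>"
proof -
  have tr: "tree (ends c)" and leafs: "set (leafs c) = {k. k < length (att c) \<and> mate c ! k = k}"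
    and dl: "distinct (leafs c)"
    using assms by (simp_all add: tobj_ok_def)
  have "\<exists>G \<beta>. is_obj G \<and> nv G = length (ends c) \<and> gen G = tgen c \<and> bij_betw \<beta> (thes c) (hes G) \<and>
    (\<forall>x\<in>thes c. fst (\<beta> x) = tvert c x \<and> inv G (\<beta> x) = \<beta> (tinv c x)) \<and>
    lvs G = map \<beta> (map (Pair 0) (leafs c))"
  proof (rule realize)
    show "distinct (map (Pair (0 :: nat)) (leafs c))"
      by (simp add: distinct_map dl inj_on_def)
    show "set (map (Pair 0) (leafs c)) = {x \<in> thes c. tinv c x = x}"
    proof (intro equalityI subsetI)
      fix x :: "nat \<times> nat"
      assume "x \<in> set (map (Pair 0) (leafs c))"
      then obtain k where "x = (0, k)" "k < length (att c)" "mate c ! k = k"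
        using leafs by auto
      then show "x \<in> {x \<in> thes c. tinv c x = x}"
        by (simp add: thes_def tinv_def)
    next
      fix x
      assume "x \<in> {x \<in> thes c. tinv c x = x}"
      then have "fst x = 0" "snd x < length (att c)" "mate c ! snd x = snd x"
        by (auto simp: thes_def tinv_def)
      then show "x \<in> set (map (Pair 0) (leafs c))"
        unfolding set_map leafs by (intro image_eqI[of _ _ "snd x"]) (simp_all add: prod_eq_iff)
    qed
    show "1 \<le> length (ends c)"
      using tr by (cases "ends c") (simp_all add: tree_def)
    show "length (tgen c) = length (ends c)"
      using assms by (simp add: tobj_ok_def)
  next
    fix v w
    assume "v < length (ends c)" "w < length (ends c)"
    then show "(v, w) \<in> ((\<lambda>x. (tvert c x, tvert c (tinv c x))) ` thes c)\<^sup>*"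
    proof (rule tree_connected[OF tr, rotated])
      fix v
      assume "1 \<le> v" "v < length (ends c)"
      then have "(1, v) \<in> thes c" "(2, v) \<in> thes c"
        by (simp_all add: thes_def)
      moreover have "(v, par (ends c) v) = (tvert c (1, v), tvert c (tinv c (1, v)))"
        "(par (ends c) v, v) = (tvert c (2, v), tvert c (tinv c (2, v)))"
        by (simp_all add: tvert_def tinv_def)
      ultimately show "(v, par (ends c) v) \<in> (\<lambda>x. (tvert c x, tvert c (tinv c x))) ` thes c \<and>
        (par (ends c) v, v) \<in> (\<lambda>x. (tvert c x, tvert c (tinv c x))) ` thes c"
        by (intro conjI; elim image_eqI)
    qed
  qed (simp_all add: assms finite_thes tvert_less tinv_thes tinv_tinv)
  then show ?thesis
    by (simp add: realizes_def)
qed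

definition tlinks :: "tobj \<Rightarrow> (nat \<times> nat) set \<Rightarrow> (nat \<times> nat) set" where
  "tlinks c I = (\<lambda>x. (tvert c x, tvert c (tinv c x))) ` I"

definition tcontr :: "ograph \<Rightarrow> tobj \<Rightarrow> (nat \<times> nat \<Rightarrow> nat \<times> nat) \<Rightarrow> (nat \<Rightarrow> nat) \<Rightarrow> bool" where
  "tcontr p c \<psi> \<pi> \<longleftrightarrow> is_obj p \<and>
     (\<forall>h\<in>hes p. \<psi> h \<in> thes c \<and> tinv c (\<psi> h) = \<psi> (inv p h) \<and> \<pi> (tvert c (\<psi> h)) = fst h) \<and>
     inj_on \<psi> (hes p) \<and> map (Pair 0) (leafs c) = map \<psi> (lvs p) \<and>
     (\<forall>w<length (ends c). \<pi> w < nv p) \<and>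
     (\<forall>x\<in>thes c - \<psi> ` hes p. \<pi> (tvert c (tinv c x)) = \<pi> (tvert c x)) \<and>
     (\<forall>l<nv p. \<exists>w<length (ends c). \<pi> w = l) \<and>
     (\<forall>w<length (ends c). \<forall>w'<length (ends c). \<pi> w = \<pi> w' \<longrightarrow>
        (w, w') \<in> (tlinks c (thes c - \<psi> ` hes p))\<^sup>*) \<and>
     (\<forall>l<nv p. gen p ! l = (\<Sum>w | w < length (ends c) \<and> \<pi> w = l. tgen c ! w) +
        (card {x \<in> thes c - \<psi> ` hes p. \<pi> (tvert c x) = l} div 2 + 1
          - card {w. w < length (ends c) \<and> \<pi> w = l}))"

lemma contr_realized_iff:
  assumes c: "tobj_ok c" and G: "realizes c G \<beta>" and p: "is_obj p"
    and \<psi>: "\<And>h. h \<in> hes p \<Longrightarrow> \<psi> h \<in> thes c"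
    and \<phi>: "\<And>h. h \<in> hes p \<Longrightarrow> \<phi> h = \<beta> (\<psi> h)"
  shows "contr p G \<phi> \<pi> \<longleftrightarrow> tcontr p c \<psi> \<pi>"
proof -
  have obj: "is_obj G" "wfg G" "wfg p" and nv: "nv G = length (ends c)" and gen: "gen G = tgen c"
    and bij: "bij_betw \<beta> (thes c) (hes G)"
    and fst: "\<And>x. x \<in> thes c \<Longrightarrow> fst (\<beta> x) = tvert c x"
    and inv: "\<And>x. x \<in> thes c \<Longrightarrow> inv G (\<beta> x) = \<beta> (tinv c x)"
    and lvs: "lvs G = map \<beta> (map (Pair 0) (leafs c))"
    using G p by (auto simp: realizes_def is_obj_iff)
  have inj: "inj_on \<beta> (thes c)" and hes: "hes G = \<beta> ` thes c"
    using bij by (auto simp: bij_betw_def)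
  have eq: "\<beta> x = \<beta> y \<longleftrightarrow> x = y" if "x \<in> thes c" "y \<in> thes c" for x y
    using inj that by (auto dest: inj_onD)
  have p_inv: "inv p h \<in> hes p" if "h \<in> hes p" for h
    using obj(3) that by (simp add: wfg_def)
  have lvs_p: "set (lvs p) \<subseteq> hes p"
    using obj(3) by (auto simp: wfg_def)
  have int: "hes G - \<phi> ` hes p = \<beta> ` (thes c - \<psi> ` hes p)"
  proof -
    have "\<phi> ` hes p = \<beta> ` (\<psi> ` hes p)"
      using \<phi> by (force simp: image_iff)
    moreover have "\<psi> ` hes p \<subseteq> thes c"
      using \<psi> by blast
    ultimately show ?thesis
      using inj by (simp add: hes inj_on_image_set_diff)
  qed
  have 1: "(\<forall>h\<in>hes p. \<phi> h \<in> hes G \<and> inv G (\<phi> h) = \<phi> (inv p h) \<and> \<pi> (fst (\<phi> h)) = fst h) \<longleftrightarrow>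
    (\<forall>h\<in>hes p. \<psi> h \<in> thes c \<and> tinv c (\<psi> h) = \<psi> (inv p h) \<and> \<pi> (tvert c (\<psi> h)) = fst h)"
    using \<psi> \<phi> hes inv fst p_inv eq tinv_thes[OF c] by (intro ball_cong refl) auto
  have 2: "inj_on \<phi> (hes p) \<longleftrightarrow> inj_on \<psi> (hes p)"
    using \<psi> \<phi> eq unfolding inj_on_def by auto
  have 3: "lvs G = map \<phi> (lvs p) \<longleftrightarrow> map (Pair 0) (leafs c) = map \<psi> (lvs p)"
  proof -
    have "map \<phi> (lvs p) = map \<beta> (map \<psi> (lvs p))"
      using \<phi> lvs_p by auto
    moreover have "set (map (Pair 0) (leafs c)) \<subseteq> thes c"
      using c by (auto simp: thes_def tobj_ok_def)
    moreover have "set (map \<psi> (lvs p)) \<subseteq> thes c"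
      using lvs_p \<psi> by auto
    ultimately have "map \<phi> (lvs p) = map \<beta> (map \<psi> (lvs p))"
      "inj_on \<beta> (set (map (Pair 0) (leafs c)) \<union> set (map \<psi> (lvs p)))"
      by (simp_all add: inj_on_subset[OF inj])
    then show ?thesis
      unfolding lvs using inj_on_map_eq_map by metis
  qed
  have 4: "(\<forall>x\<in>hes G - \<phi> ` hes p. \<pi> (fst (inv G x)) = \<pi> (fst x)) \<longleftrightarrow>
    (\<forall>x\<in>thes c - \<psi> ` hes p. \<pi> (tvert c (tinv c x)) = \<pi> (tvert c x))"
    unfolding int using fst inv tinv_thes[OF c] by auto
  have 5: "links G (hes G - \<phi> ` hes p) = tlinks c (thes c - \<psi> ` hes p)"
    unfolding links_def tlinks_def int image_image using fst inv tinv_thes[OF c]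
    by (intro image_cong) auto
  have 6: "card {x \<in> hes G - \<phi> ` hes p. \<pi> (fst x) = l} = card {x \<in> thes c - \<psi> ` hes p. \<pi> (tvert c x) = l}"
    for l
  proof -
    have "{x \<in> hes G - \<phi> ` hes p. \<pi> (fst x) = l} = \<beta> ` {x \<in> thes c - \<psi> ` hes p. \<pi> (tvert c x) = l}"
      unfolding int using fst by auto
    moreover have "inj_on \<beta> {x \<in> thes c - \<psi> ` hes p. \<pi> (tvert c x) = l}"
      by (rule inj_on_subset[OF inj]) auto
    ultimately show ?thesis
      by (simp add: card_image)
  qed
  show ?thesis
    unfolding contr_def tcontr_def str_def 1 2 3 4 5 6 nv gen using p obj by (simp add: conj_ac)
qed

definition he :: "nat list \<Rightarrow> nat \<times> nat \<Rightarrow> nat \<times> nat" where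
  "he e x = (fst x, if fst x = 0 then snd x else e ! snd x)"

locale tree_mor =
  fixes c c' e
  assumes tmor: "tmor c c' e"
begin

sublocale tree_emb "ends c" "ends c'" e
  using tmor by unfold_locales (simp add: tmor_def)

abbreviation "n \<equiv> length (ends c)"
abbreviation "n' \<equiv> length (ends c')"
abbreviation "r \<equiv> ret (ends c') e"
abbreviation "D \<equiv> {v. v < n' \<and> v \<notin> set e}"

lemma ok: "tobj_ok c" and ok': "tobj_ok c'" and mate_eq: "mate c' = mate c"
  and leafs_eq: "leafs c' = leafs c" and att_eq: "att c = map r (att c')"
  and tgen_eq: "i < n \<Longrightarrow> tgen c ! i = (\<Sum>x | x < n' \<and> r x = i. tgen c' ! x)"
  using tmor by (simp_all add: tmor_def)

lemma length_att: "length (att c') = length (att c)"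
  using att_eq by simp

lemma nth_ge_one: "1 \<le> v \<Longrightarrow> v < n \<Longrightarrow> 1 \<le> e ! v"
  using mono[of 0 v] nth_0 by simp

lemma ret_par_nth:
  assumes "1 \<le> v" "v < n"
  shows "r (par (ends c') (e ! v)) = par (ends c) v"
proof (rule ret_unique)
  note p = par[OF tree assms] and p' = par[OF tree' nth_ge_one[OF assms] nth_less[OF assms(2)]]
  show "par (ends c') (e ! v) < n'"
    using p'(1) nth_less[OF assms(2)] by simp
  show "par (ends c) v < n"
    using p(1) assms(2) by simp
  fix z
  assume z: "z < n"
  have "e ! z = e ! v \<longleftrightarrow> z = v"
    using distinct z assms(2) len by (simp add: nth_eq_iff_index_eq)
  then show "anc (ends c') (e ! z) (par (ends c') (e ! v)) \<longleftrightarrow> anc (ends c) z (par (ends c) v)"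
    using p(3) p'(3) anc_iff[OF z assms(2)] by simp
qed

lemma zero_in: "0 \<in> set e"
  using nth_0 len len_pos by (metis nth_mem)

lemma D_pos: "v \<in> D \<Longrightarrow> 1 \<le> v"
  using zero_in by (cases v) simp_all

lemma ret_par:
  assumes "v \<in> D"
  shows "r (par (ends c') v) = r v"
proof (rule ret_unique)
  have v: "v < n'"
    using assms by simp
  note p = par[OF tree' D_pos[OF assms] v]
  show "par (ends c') v < n'"
    using p(1) v by simp
  show "r v < n"
    by (rule ret_less[OF v])
  fix z
  assume z: "z < n"
  then have "e ! z \<noteq> v"
    using assms len by auto
  then show "anc (ends c') (e ! z) (par (ends c') v) \<longleftrightarrow> anc (ends c) z (r v)"
    using p(3) anc_ret_iff[OF v z] by simp
qed

lemma he_thes: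
  assumes "x \<in> thes c"
  shows "he e x \<in> thes c'"
proof (cases "fst x = 0")
  case True
  then show ?thesis
    using assms length_att by (auto simp: thes_def he_def)
next
  case False
  then have x: "fst x = 1 \<or> fst x = 2" "1 \<le> snd x" "snd x < n"
    using assms by (auto simp: thes_def)
  then show ?thesis
    using nth_less[OF x(3)] nth_ge_one[OF x(2,3)] by (auto simp: thes_def he_def)
qed

lemma tinv_he: "tinv c' (he e x) = he e (tinv c x)"
  using mate_eq by (simp add: tinv_def he_def)

lemma ret_tvert_he:
  assumes "x \<in> thes c"
  shows "r (tvert c' (he e x)) = tvert c x"
proof -
  consider "fst x = 0" "snd x < length (att c)" | "fst x = 1" "1 \<le> snd x" "snd x < n"
    | "fst x = 2" "1 \<le> snd x" "snd x < n"
    using assms by (auto simp: thes_def)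
  then show ?thesis
  proof cases
    case 1
    then have "att c ! snd x = r (att c' ! snd x)"
      using length_att by (subst att_eq) simp
    then show ?thesis using 1 by (simp add: tvert_def he_def)
  next
    case 2
    then show ?thesis using ret_nth by (simp add: tvert_def he_def)
  next
    case 3
    then show ?thesis using ret_par_nth by (simp add: tvert_def he_def)
  qed
qed

lemma he_inj: "inj_on (he e) (thes c)"
proof (rule inj_onI)
  fix x y
  assume xy: "x \<in> thes c" "y \<in> thes c" "he e x = he e y"
  then have f: "fst x = fst y"
    by (simp add: he_def)
  have "snd x = snd y"
  proof (cases "fst x = 0")
    case True
    then show ?thesis using xy(3) by (simp add: he_def split: if_splits)
  next
    case False
    then have "e ! snd x = e ! snd y" "snd x < n" "snd y < n"
      using xy f by (auto simp: he_def thes_def)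
    then show ?thesis
      using distinct len by (simp add: nth_eq_iff_index_eq)
  qed
  then show "x = y"
    using f by (simp add: prod_eq_iff)
qed

lemma he_image: "thes c' - he e ` thes c = {1, 2} \<times> D"
proof (intro equalityI subsetI)
  fix x
  assume x: "x \<in> thes c' - he e ` thes c"
  have "fst x \<noteq> 0"
  proof
    assume "fst x = 0"
    then have "x \<in> thes c" "x = he e x"
      using x length_att by (auto simp: thes_def he_def prod_eq_iff)
    then show False using x by blast
  qed
  then have x': "fst x \<in> {1, 2}" "1 \<le> snd x" "snd x < n'"
    using x by (auto simp: thes_def)
  have "snd x \<notin> set e"
  proof
    assume "snd x \<in> set e"
    then obtain v where v: "v < n" "e ! v = snd x"
      using len by (metis in_set_conv_nth)
    have "v \<noteq> 0"
      using v(2) nth_0 x'(2) by (intro notI) simp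
    then have "(fst x, v) \<in> thes c" "x = he e (fst x, v)"
      using x'(1) v by (auto simp: thes_def he_def prod_eq_iff)
    then show False using x by blast
  qed
  then show "x \<in> {1, 2} \<times> D"
    using x' by (cases x) simp
next
  fix x :: "nat \<times> nat"
  assume x: "x \<in> {1, 2} \<times> D"
  then have "1 \<le> snd x"
    using D_pos by auto
  then have "x \<in> thes c'"
    using x by (auto simp: thes_def)
  moreover have "x \<notin> he e ` thes c"
  proof
    assume "x \<in> he e ` thes c"
    then obtain y where y: "y \<in> thes c" "x = he e y"
      by blast
    then have "snd x = e ! snd y" "snd y < n"
      using x by (auto simp: he_def thes_def)
    then show False
      using x len by auto
  qed
  ultimately show "x \<in> thes c' - he e ` thes c"
    by simp
qed

lemma ret_collapsed:
  assumes "x \<in> {1, 2} \<times> D"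
  shows "r (tvert c' x) = r (snd x)" "r (tvert c' (tinv c' x)) = r (snd x)"
  using assms ret_par[of "snd x"] by (auto simp: tvert_def tinv_def)

lemma ret_path: "w < n' \<Longrightarrow> (w, e ! r w) \<in> (tlinks c' ({1, 2} \<times> D))\<^sup>* \<and> (e ! r w, w) \<in> (tlinks c' ({1, 2} \<times> D))\<^sup>*"
proof (induction w rule: less_induct)
  case (less w)
  show ?case
  proof (cases "w \<in> set e")
    case True
    then obtain i where "i < n" "w = e ! i"
      using len by (metis in_set_conv_nth)
    then show ?thesis
      using ret_nth by simp
  next
    case False
    then have D: "w \<in> D"
      using less.prems by simp
    note p = par_less[OF tree' D_pos[OF D] less.prems]
    have IH: "(par (ends c') w, e ! r w) \<in> (tlinks c' ({1, 2} \<times> D))\<^sup>*"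
      "(e ! r w, par (ends c') w) \<in> (tlinks c' ({1, 2} \<times> D))\<^sup>*"
      using less.IH[OF p] p less.prems ret_par[OF D] by simp_all
    have "(tvert c' x, tvert c' (tinv c' x)) \<in> tlinks c' ({1, 2} \<times> D)" if "x = (1, w) \<or> x = (2, w)" for x
      unfolding tlinks_def using that D by (intro imageI) auto
    from this[of "(1, w)"] this[of "(2, w)"]
    have "(w, par (ends c') w) \<in> tlinks c' ({1, 2} \<times> D)"
      "(par (ends c') w, w) \<in> tlinks c' ({1, 2} \<times> D)"
      by (simp_all add: tvert_def tinv_def)
    then show ?thesis
      using IH by (meson converse_rtrancl_into_rtrancl rtrancl.rtrancl_into_rtrancl)
  qed
qed

lemma card_collapsed:
  "card {x \<in> {1, 2 :: nat} \<times> D. r (snd x) = l} = 2 * card {v \<in> D. r v = l}"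
proof -
  have "{x \<in> {1, 2 :: nat} \<times> D. r (snd x) = l} = {1, 2} \<times> {v \<in> D. r v = l}"
    by auto
  then show ?thesis
    by (simp add: card_cartesian_product)
qed

lemma fibre_eq: "i < n \<Longrightarrow> {x. x < n' \<and> r x = i} = insert (e ! i) {v \<in> D. r v = i}"
  using nth_less ret_nth len by (auto simp: in_set_conv_nth)

lemma card_fibre: "i < n \<Longrightarrow> card {x. x < n' \<and> r x = i} = Suc (card {v \<in> D. r v = i})"
  unfolding fibre_eq using len by (subst card_insert_disjoint) auto

theorem tcontr_functor:
  assumes G: "realizes c G \<beta>"
  shows "tcontr G c' (he e \<circ> inv_into (thes c) \<beta>) r"
proof -
  let ?\<gamma> = "inv_into (thes c) \<beta>"
  let ?\<psi> = "he e \<circ> ?\<gamma>"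
  have obj: "is_obj G" and nv: "nv G = n" and gen: "gen G = tgen c"
    and bij: "bij_betw \<beta> (thes c) (hes G)"
    and fst: "\<And>x. x \<in> thes c \<Longrightarrow> fst (\<beta> x) = tvert c x"
    and inv: "\<And>x. x \<in> thes c \<Longrightarrow> inv G (\<beta> x) = \<beta> (tinv c x)"
    and lvs: "lvs G = map (\<beta> \<circ> Pair 0) (leafs c)"
    using G by (simp_all add: realizes_def)
  have \<gamma>\<beta>: "?\<gamma> (\<beta> x) = x" if "x \<in> thes c" for x
    using bij that by (simp add: bij_betw_def)
  have ex: "\<exists>x\<in>thes c. h = \<beta> x" if "h \<in> hes G" for h
    using bij that by (auto simp: bij_betw_def)
  have im: "?\<psi> ` hes G = he e ` thes c"
  proof -
    have "?\<gamma> ` hes G = thes c"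
      using bij_betw_inv_into[OF bij] by (simp add: bij_betw_def)
    then show ?thesis
      by (metis image_comp)
  qed
  have int: "thes c' - ?\<psi> ` hes G = {1, 2} \<times> D"
    unfolding im by (rule he_image)
  show ?thesis
    unfolding tcontr_def int
  proof (intro conjI ballI allI impI obj)
    fix h
    assume "h \<in> hes G"
    then obtain x where x: "x \<in> thes c" "h = \<beta> x"
      using ex by blast
    then show "?\<psi> h \<in> thes c'" "r (tvert c' (?\<psi> h)) = fst h" "tinv c' (?\<psi> h) = ?\<psi> (inv G h)"
      using he_thes ret_tvert_he fst inv tinv_thes[OF ok] by (simp_all add: \<gamma>\<beta> tinv_he)
  next
    have "inj_on ?\<gamma> (hes G)"
      using bij_betw_inv_into[OF bij] by (simp add: bij_betw_def)
    moreover have "?\<gamma> ` hes G \<subseteq> thes c"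
      using bij_betw_inv_into[OF bij] by (simp add: bij_betw_def)
    ultimately show "inj_on ?\<psi> (hes G)"
      using he_inj by (meson comp_inj_on inj_on_subset)
  next
    have "(0, k) \<in> thes c" if "k \<in> set (leafs c)" for k
      using that ok by (auto simp: tobj_ok_def thes_def)
    then show "map (Pair 0) (leafs c') = map ?\<psi> (lvs G)"
      unfolding lvs leafs_eq by (simp add: \<gamma>\<beta> he_def)
  next
    show "r w < nv G" if "w < n'" for w
      using ret_less[OF that] nv by simp
  next
    show "r (tvert c' (tinv c' x)) = r (tvert c' x)" if "x \<in> {1, 2} \<times> D" for x
      using ret_collapsed[OF that] by simp
  next
    show "\<exists>w<n'. r w = l" if "l < nv G" for l
      using that nth_less ret_nth nv by metis
  next
    show "(w, w') \<in> (tlinks c' ({1, 2} \<times> D))\<^sup>*" if "w < n'" "w' < n'" "r w = r w'" for w w'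
      using rtrancl_trans[OF conjunct1[OF ret_path[OF that(1)]]] conjunct2[OF ret_path[OF that(2)]] that(3)
      by simp
  next
    fix l
    assume "l < nv G"
    then have l: "l < n"
      using nv by simp
    have eq: "{x \<in> {1, 2} \<times> D. r (tvert c' x) = l} = {x \<in> {1, 2} \<times> D. r (snd x) = l}"
      using ret_collapsed(1) by (intro Collect_cong) metis
    then show "gen G ! l = (\<Sum>w | w < n' \<and> r w = l. tgen c' ! w) +
        (card {x \<in> {1, 2} \<times> D. r (tvert c' x) = l} div 2 + 1 - card {w. w < n' \<and> r w = l})"
      unfolding card_fibre[OF l] eq card_collapsed using tgen_eq[OF l] gen by simp
  qed
qed

end

section \<open>Bounded factorizations\<close>

lemma sum_fibres_set:
  fixes g :: "'a \<Rightarrow> nat"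
  assumes "finite A" "\<And>x. x \<in> A \<Longrightarrow> g x < m"
  shows "(\<Sum>l<m. \<Sum>x | x \<in> A \<and> g x = l. f x) = sum f A"
  using assms by (intro sum.group[of A "{..<m}" g f, simplified]) auto

lemma tcontr_bound:
  assumes c: "tobj_ok c" and f: "tcontr p c \<psi> \<pi>"
  shows "length (att c) + 2 * (\<Sum>x<length (ends c). tgen c ! x)
    \<le> 2 * (\<Sum>l<nv p. gen p ! l) + card (hes p) + 2"
proof -
  let ?n = "length (ends c)"
  let ?I = "thes c - \<psi> ` hes p"
  have \<psi>: "inj_on \<psi> (hes p)" "\<psi> ` hes p \<subseteq> thes c"
    using f by (auto simp: tcontr_def)
  have pi_less: "\<pi> w < nv p" if "w < ?n" for w
    using f that by (simp add: tcontr_def)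
  let ?i = "\<lambda>l. card {x \<in> ?I. \<pi> (tvert c x) = l}"
  let ?v = "\<lambda>l. card {w. w < ?n \<and> \<pi> w = l}"
  let ?g = "\<lambda>l. \<Sum>w | w < ?n \<and> \<pi> w = l. tgen c ! w"
  have "?i l + 2 * ?g l + 1 \<le> 2 * gen p ! l + 2 * ?v l" if "l < nv p" for l
  proof -
    have "gen p ! l = ?g l + (?i l div 2 + 1 - ?v l)"
      using f that by (simp add: tcontr_def)
    then show ?thesis
      by linarith
  qed
  then have "(\<Sum>l<nv p. ?i l + 2 * ?g l + 1) \<le> (\<Sum>l<nv p. 2 * gen p ! l + 2 * ?v l)"
    by (intro sum_mono) simp
  then have *: "(\<Sum>l<nv p. ?i l) + 2 * (\<Sum>l<nv p. ?g l) + nv p \<le> 2 * (\<Sum>l<nv p. gen p ! l) + 2 * (\<Sum>l<nv p. ?v l)"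
  proof -
    have "(\<Sum>l<m. a l + 2 * b l + 1) = (\<Sum>l<m. a l) + 2 * (\<Sum>l<m. b l) + m"
      "(\<Sum>l<m. 2 * a l + 2 * b l) = 2 * (\<Sum>l<m. a l) + 2 * (\<Sum>l<m. b l)" for a b :: "nat \<Rightarrow> nat" and m
      by (induction m) auto
    then show ?thesis
      using \<open>(\<Sum>l<nv p. ?i l + 2 * ?g l + 1) \<le> _\<close> by simp
  qed
  have I: "(\<Sum>l<nv p. ?i l) = card ?I"
    unfolding card_eq_sum
    by (rule sum_fibres_set) (simp_all add: finite_thes pi_less tvert_less[OF c])
  have V: "(\<Sum>l<nv p. ?v l) = ?n"
  proof -
    have "(\<Sum>l<nv p. ?v l) = card {..<?n}"
      unfolding card_eq_sum
      using sum_fibres_set[of "{..<?n}" \<pi> "nv p" "\<lambda>_. 1 :: nat"] pi_less by simp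
    then show ?thesis by simp
  qed
  have G: "(\<Sum>l<nv p. ?g l) = (\<Sum>x<?n. tgen c ! x)"
    using sum_fibres_set[of "{..<?n}" \<pi> "nv p" "\<lambda>x. tgen c ! x"] pi_less by simp
  have "card ?I = card (thes c) - card (hes p)"
    using \<psi> finite_thes[of c] by (simp add: card_Diff_subset finite_subset card_image)
  moreover have "card (thes c) = length (att c) + 2 * (?n - 1)"
  proof -
    have "card (thes c) = card ({0 :: nat} \<times> {..<length (att c)}) + card ({1 :: nat, 2} \<times> {1..<?n})"
      unfolding thes_def by (rule card_Un_disjoint) auto
    then show ?thesis
      by (simp add: card_cartesian_product)
  qed
  moreover have "1 \<le> ?n"
    using c by (cases "ends c") (auto simp: tobj_ok_def tree_def)
  ultimately show ?thesis
    using * unfolding I V G by linarith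
qed

lemma initial_segment:
  fixes e :: "nat list"
  assumes "sorted_wrt (<) e" "j < length e"
  shows "j < card {i. i < length e \<and> e ! i < b} \<longleftrightarrow> e ! j < b"
proof -
  let ?A = "{i. i < length e \<and> e ! i < b}"
  have down: "i \<in> ?A" if "k \<in> ?A" "i \<le> k" for i k
  proof -
    have "e ! i \<le> e ! k"
      using that sorted_wrt_nth_less[OF assms(1), of i k] by (cases "i = k") auto
    then show ?thesis using that by simp
  qed
  show ?thesis
  proof
    assume "j < card ?A"
    show "e ! j < b"
    proof (rule ccontr)
      assume "\<not> e ! j < b"
      then have "?A \<subseteq> {..<j}"
        using down by (metis (mono_tags, lifting) lessThan_iff linorder_not_less mem_Collect_eq subsetI)
      then have "card ?A \<le> j"
        using card_mono[of "{..<j}" ?A] by simp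
      then show False using \<open>j < card ?A\<close> by simp
    qed
  next
    assume "e ! j < b"
    then have "{..j} \<subseteq> ?A"
      using down[of j] assms(2) by auto
    then have "card {..j} \<le> card ?A"
      by (intro card_mono) auto
    then show "j < card ?A" by simp
  qed
qed

lemma restrict_tree:
  assumes "tree en" "sorted_wrt (<) e" "set e \<subseteq> {..<length en}" "0 \<in> set e"
  shows "temb (map (\<lambda>i. card {j. j < length e \<and> e ! j < en ! (e ! i)}) [0..<length e]) en e"
    (is "temb ?en en e")
proof -
  let ?m = "length e"
  note seg = initial_segment[OF assms(2)]
  have e_less: "e ! i < length en" if "i < ?m" for i
    using assms(3) nth_mem[OF that] by auto
  have e0: "e ! 0 = 0"
  proof -
    obtain k where "k < ?m" "e ! k = 0"
      using assms(4) by (metis in_set_conv_nth)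
    then show ?thesis
      using sorted_wrt_nth_less[OF assms(2), of 0 k] by (cases "k = 0") auto
  qed
  have m: "0 < ?m"
    using assms(4) by auto
  have nth: "?en ! i = card {j. j < ?m \<and> e ! j < en ! (e ! i)}" if "i < ?m" for i
    using that by simp
  have le: "?en ! i \<le> ?m" if "i < ?m" for i
    unfolding nth[OF that] using card_mono[of "{..<?m}" "{j. j < ?m \<and> e ! j < en ! (e ! i)}"] by auto
  have mono: "e ! i \<le> e ! j \<longleftrightarrow> i \<le> j" if "i < ?m" "j < ?m" for i j
    using that sorted_wrt_nth_less[OF assms(2)] by (metis linorder_not_less order_less_imp_le order_le_less)
  have anc: "anc ?en i j \<longleftrightarrow> anc en (e ! i) (e ! j)" if "i < ?m" "j < ?m" for i j
    unfolding anc_def nth[OF that(1)] seg[OF that(2)] mono[OF that] ..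
  have "tree ?en"
    unfolding tree_def
  proof (intro conjI allI impI)
    show "?en \<noteq> []"
      using m by simp
    have "{j. j < ?m \<and> e ! j < en ! (e ! 0)} = {..<?m}"
      using e0 e_less assms(1) by (auto simp: tree_def)
    then show "?en ! 0 = length ?en"
      using nth[OF m] by simp
  next
    fix i
    assume "i < length ?en"
    then have i: "i < ?m"
      by simp
    have "anc en (e ! i) (e ! i)"
      using anc_refl[OF assms(1)] e_less i by simp
    then show "i < ?en ! i"
      using anc[OF i i] by (simp add: anc_def)
    show "?en ! i \<le> length ?en"
      using le[OF i] by simp
  next
    fix i j
    assume "i < length ?en" "j < length ?en" "anc ?en i j"
    then have ij: "i < ?m" "j < ?m" "anc en (e ! i) (e ! j)"
      using anc by simp_all
    then have "en ! (e ! j) \<le> en ! (e ! i)"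
      using assms(1) e_less by (simp add: tree_def)
    then show "?en ! j \<le> ?en ! i"
      unfolding nth[OF ij(1)] nth[OF ij(2)] by (intro card_mono) auto
  qed
  then show ?thesis
    unfolding temb_def using assms e0 anc by auto
qed

lemma restrict_tobj:
  assumes c: "tobj_ok c" and e: "sorted_wrt (<) e" "set e \<subseteq> {..<length (ends c)}" "0 \<in> set e"
  shows "\<exists>d. tmor d c e \<and> length (ends d) = length e"
proof -
  let ?en = "map (\<lambda>i. card {j. j < length e \<and> e ! j < ends c ! (e ! i)}) [0..<length e]"
  let ?r = "ret (ends c) e"
  have te: "temb ?en (ends c) e"
    using c e by (intro restrict_tree) (simp_all add: tobj_ok_def)
  interpret tree_emb ?en "ends c" e
    using te by unfold_locales
  define d where "d = TObj ?en (map (\<lambda>i. \<Sum>x | x < length (ends c) \<and> ?r x = i. tgen c ! x) [0..<length e])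
    (map ?r (att c)) (mate c) (leafs c)"
  have "?r x < length e" if "x \<in> set (att c)" for x
    using that c ret_less[of x] by (auto simp: tobj_ok_def)
  then have "tobj_ok d"
    using c tree unfolding tobj_ok_def d_def by auto
  then have "tmor d c e"
    unfolding tmor_def using c te by (simp add: d_def)
  then show ?thesis
    by (intro exI[of _ d]) (simp add: d_def)
qed

text \<open>\<open>d\<close> arises from \<open>c\<close> by contracting only those edges contracted by \<open>\<pi>\<close> that lie in the tree.\<close>

lemma factor:
  assumes c: "tobj_ok c" and f: "tcontr p c \<psi> \<pi>"
  obtains d e \<psi>' \<pi>' where "tmor d c e" "tcontr p d \<psi>' \<pi>'" "length (ends d) \<le> 1 + card (hes p)"
    "\<And>h. h \<in> hes p \<Longrightarrow> he e (\<psi>' h) = \<psi> h"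
    "\<And>x. x < length (ends c) \<Longrightarrow> \<pi>' (ret (ends c) e x) = \<pi> x"
proof -
  have obj: "is_obj p" and \<psi>: "\<And>h. h \<in> hes p \<Longrightarrow> \<psi> h \<in> thes c"
    and \<psi>_inv: "\<And>h. h \<in> hes p \<Longrightarrow> tinv c (\<psi> h) = \<psi> (inv p h)"
    and \<psi>_vert: "\<And>h. h \<in> hes p \<Longrightarrow> \<pi> (tvert c (\<psi> h)) = fst h"
    and \<psi>_inj: "inj_on \<psi> (hes p)" and \<psi>_lvs: "map (Pair 0) (leafs c) = map \<psi> (lvs p)"
    and pi_less: "\<And>w. w < length (ends c) \<Longrightarrow> \<pi> w < nv p"
    and internal: "\<And>x. x \<in> thes c - \<psi> ` hes p \<Longrightarrow> \<pi> (tvert c (tinv c x)) = \<pi> (tvert c x)"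
    and surj: "\<And>l. l < nv p \<Longrightarrow> \<exists>w<length (ends c). \<pi> w = l"
    and conn: "\<And>w w'. w < length (ends c) \<Longrightarrow> w' < length (ends c) \<Longrightarrow> \<pi> w = \<pi> w' \<Longrightarrow>
        (w, w') \<in> (tlinks c (thes c - \<psi> ` hes p))\<^sup>*"
    and gen: "\<And>l. l < nv p \<Longrightarrow> gen p ! l = (\<Sum>w | w < length (ends c) \<and> \<pi> w = l. tgen c ! w) +
        (card {x \<in> thes c - \<psi> ` hes p. \<pi> (tvert c x) = l} div 2 + 1
          - card {w. w < length (ends c) \<and> \<pi> w = l})"
    using f unfolding tcontr_def by blast+
  have p_inv: "inv p h \<in> hes p" if "h \<in> hes p" for h
    using obj that by (simp add: is_obj_iff wfg_def)
  have lvs_p: "set (lvs p) \<subseteq> hes p"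
    using obj by (auto simp: is_obj_iff wfg_def)
  have n_pos: "0 < length (ends c)"
    using c by (simp add: tobj_ok_def tree_def)
  define S where "S = insert 0 (snd ` ({x \<in> \<psi> ` hes p. fst x = 1}))"
  define e where "e = sorted_list_of_set S"
  have fin: "finite S"
    using finite_hes by (simp add: S_def)
  have S_less: "S \<subseteq> {..<length (ends c)}"
    using \<psi> n_pos by (fastforce simp: S_def thes_def)
  have set_e: "set e = S" and sorted_e: "sorted_wrt (<) e" and len_e: "length e = card S"
    using fin by (simp_all add: e_def)
  have card_S: "card S \<le> 1 + card (hes p)"
  proof -
    have "card S \<le> Suc (card (snd ` {x \<in> \<psi> ` hes p. fst x = 1}))"
      unfolding S_def by (rule card_insert_le_m1[of "Suc _", simplified]) auto
    also have "card (snd ` {x \<in> \<psi> ` hes p. fst x = 1}) \<le> card {x \<in> \<psi> ` hes p. fst x = 1}"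
      using finite_hes by (intro card_image_le) simp
    also have "\<dots> \<le> card (\<psi> ` hes p)"
      using finite_hes by (intro card_mono) auto
    also have "\<dots> \<le> card (hes p)"
      using finite_hes by (rule card_image_le)
    finally show ?thesis by simp
  qed
  obtain d where d: "tmor d c e" "length (ends d) = length e"
    using restrict_tobj[OF c sorted_e] S_less set_e S_def by blast
  interpret tree_mor d c e
    using d(1) by unfold_locales
  have in_S: "snd x \<in> S" if x: "x \<in> \<psi> ` hes p" "fst x \<noteq> 0" for x
  proof -
    obtain h where h: "h \<in> hes p" "x = \<psi> h"
      using x(1) by blast
    have "fst x = 1 \<or> fst x = 2"
      using \<psi>[OF h(1)] h(2) x(2) by (auto simp: thes_def)
    then show ?thesis
    proof
      assume "fst x = 2"
      then have "tinv c x = (1, snd x)"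
        by (simp add: tinv_def)
      then have "(1, snd x) \<in> \<psi> ` hes p"
        using \<psi>_inv[OF h(1)] h p_inv by (metis imageI)
      then show ?thesis
        unfolding S_def by (force simp: image_iff)
    qed (use x in \<open>auto simp: S_def\<close>)
  qed
  have D_out: "x \<notin> \<psi> ` hes p" if "x \<in> {1, 2} \<times> D" for x
  proof
    assume "x \<in> \<psi> ` hes p"
    moreover have "fst x \<noteq> 0" "snd x \<notin> set e"
      using that by auto
    ultimately show False
      using in_S set_e by blast
  qed
  then have im: "\<psi> ` hes p \<subseteq> he e ` thes d"
    using he_image \<psi> by blast
  define \<psi>' where "\<psi>' h = inv_into (thes d) (he e) (\<psi> h)" for h
  define \<pi>' where "\<pi>' i = \<pi> (e ! i)" for i
  have he_psi': "he e (\<psi>' h) = \<psi> h" "\<psi>' h \<in> thes d" if "h \<in> hes p" for h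
    using im that by (auto simp: \<psi>'_def f_inv_into_f inv_into_into)
  have im': "he e x \<in> \<psi> ` hes p \<longleftrightarrow> x \<in> \<psi>' ` hes p" if "x \<in> thes d" for x
  proof
    assume "he e x \<in> \<psi> ` hes p"
    then obtain h where "h \<in> hes p" "he e x = he e (\<psi>' h)"
      using he_psi' by auto
    then show "x \<in> \<psi>' ` hes p"
      using he_inj that he_psi' by (metis imageI inj_onD)
  next
    assume "x \<in> \<psi>' ` hes p"
    then show "he e x \<in> \<psi> ` hes p"
      using he_psi' by auto
  qed
  have pi_par: "\<pi> (par (ends c) v) = \<pi> v" if "v \<in> D" for v
  proof -
    have "(1, v) \<in> thes c - \<psi> ` hes p"
      using that D_out[of "(1, v)"] he_image by auto
    from internal[OF this] show ?thesis
      by (simp add: tinv_def tvert_def)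
  qed
  have pi': "\<pi>' (r x) = \<pi> x" if "x < n'" for x
    using that
  proof (induction x rule: less_induct)
    case (less x)
    show ?case
    proof (cases "x \<in> set e")
      case True
      then obtain i where "i < n" "x = e ! i"
        using len by (metis in_set_conv_nth)
      then show ?thesis
        using ret_nth by (simp add: \<pi>'_def)
    next
      case False
      then have D: "x \<in> D"
        using less.prems by simp
      then have "par (ends c) x < x"
        using par_less[OF tree' D_pos[OF D]] by simp
      then show ?thesis
        using less.IH[of "par (ends c) x"] less.prems ret_par[OF D] pi_par[OF D] by simp
    qed
  qed
  have vert': "\<pi>' (tvert d x) = \<pi> (tvert c (he e x))" if "x \<in> thes d" for x
    using ret_tvert_he[OF that] pi' tvert_less[OF c he_thes[OF that]] by metis
  have int_split: "thes c - \<psi> ` hes p = he e ` (thes d - \<psi>' ` hes p) \<union> {1, 2} \<times> D"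
  proof (intro equalityI subsetI)
    fix x
    assume x: "x \<in> thes c - \<psi> ` hes p"
    show "x \<in> he e ` (thes d - \<psi>' ` hes p) \<union> {1, 2} \<times> D"
    proof (cases "x \<in> he e ` thes d")
      case True
      then show ?thesis using x im' by auto
    next
      case False
      then show ?thesis using x he_image by blast
    qed
  next
    fix x
    assume "x \<in> he e ` (thes d - \<psi>' ` hes p) \<union> {1, 2} \<times> D"
    then show "x \<in> thes c - \<psi> ` hes p"
    proof
      assume "x \<in> he e ` (thes d - \<psi>' ` hes p)"
      then obtain u where "u \<in> thes d" "u \<notin> \<psi>' ` hes p" "x = he e u"
        by blast
      then show ?thesis
        using im'[of u] he_thes[of u] by simp
    next
      assume "x \<in> {1, 2} \<times> D"
      then show ?thesis
        using D_out[of x] he_image by (metis Diff_iff)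
    qed
  qed
  have "tcontr p d \<psi>' \<pi>'"
    unfolding tcontr_def
  proof (intro conjI ballI allI impI obj)
    fix h
    assume h: "h \<in> hes p"
    show "\<psi>' h \<in> thes d"
      by (rule he_psi'(2)[OF h])
    have "he e (tinv d (\<psi>' h)) = he e (\<psi>' (inv p h))"
      using tinv_he[of "\<psi>' h"] he_psi'(1)[OF h] he_psi'(1)[OF p_inv[OF h]] \<psi>_inv[OF h] by simp
    then show "tinv d (\<psi>' h) = \<psi>' (inv p h)"
      using he_inj he_psi'(2)[OF h] he_psi'(2)[OF p_inv[OF h]] tinv_thes[OF ok] by (metis inj_onD)
    show "\<pi>' (tvert d (\<psi>' h)) = fst h"
      using vert'[OF he_psi'(2)[OF h]] he_psi'(1)[OF h] \<psi>_vert[OF h] by simp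
  next
    show "inj_on \<psi>' (hes p)"
    proof (rule inj_onI)
      fix h h'
      assume h: "h \<in> hes p" "h' \<in> hes p" "\<psi>' h = \<psi>' h'"
      then have "\<psi> h = \<psi> h'"
        using he_psi'(1)[OF h(1)] he_psi'(1)[OF h(2)] by simp
      then show "h = h'"
        using inj_onD[OF \<psi>_inj] h(1,2) by blast
    qed
  next
    have "map (he e) (map (Pair 0) (leafs d)) = map (he e) (map \<psi>' (lvs p))"
    proof -
      have "map (he e) (map \<psi>' (lvs p)) = map \<psi> (lvs p)"
        using lvs_p he_psi'(1) by auto
      moreover have "map (he e) (map (Pair 0) (leafs d)) = map (Pair 0) (leafs c)"
        unfolding leafs_eq by (simp add: he_def)
      ultimately show ?thesis
        using \<psi>_lvs by simp
    qed
    moreover have "set (map (Pair 0) (leafs d)) \<subseteq> thes d"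
      using ok by (auto simp: tobj_ok_def thes_def)
    moreover have "set (map \<psi>' (lvs p)) \<subseteq> thes d"
      using lvs_p he_psi'(2) by auto
    ultimately show "map (Pair 0) (leafs d) = map \<psi>' (lvs p)"
      using he_inj by (metis (no_types, lifting) Un_least inj_on_map_eq_map inj_on_subset)
  next
    show "\<pi>' w < nv p" if "w < n" for w
      using pi_less nth_less[OF that] by (simp add: \<pi>'_def)
  next
    fix x
    assume "x \<in> thes d - \<psi>' ` hes p"
    then have x: "x \<in> thes d" "he e x \<in> thes c - \<psi> ` hes p"
      using int_split by auto
    show "\<pi>' (tvert d (tinv d x)) = \<pi>' (tvert d x)"
      using internal[OF x(2)] vert'[OF x(1)] vert'[OF tinv_thes[OF ok x(1)]] tinv_he[of x] by simp
  next
    fix l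
    assume "l < nv p"
    then obtain w where "w < n'" "\<pi> w = l"
      using surj by blast
    then show "\<exists>w<n. \<pi>' w = l"
      using pi' ret_less by metis
  next
    fix w w'
    assume w: "w < n" "w' < n" "\<pi>' w = \<pi>' w'"
    have "(e ! w, e ! w') \<in> (tlinks c (thes c - \<psi> ` hes p))\<^sup>*"
      using conn nth_less w by (simp add: \<pi>'_def)
    then have "(r (e ! w), r (e ! w')) \<in> (tlinks d (thes d - \<psi>' ` hes p))\<^sup>*"
    proof (rule rtrancl_image)
      fix y z
      assume "(y, z) \<in> tlinks c (thes c - \<psi> ` hes p)"
      then obtain x where x: "x \<in> thes c - \<psi> ` hes p" "y = tvert c x" "z = tvert c (tinv c x)"
        by (auto simp: tlinks_def)
      then consider u where "u \<in> thes d - \<psi>' ` hes p" "x = he e u" | "x \<in> {1, 2} \<times> D"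
        unfolding int_split by blast
      then show "(r y, r z) \<in> (tlinks d (thes d - \<psi>' ` hes p))\<^sup>*"
      proof cases
        case 1
        then have "r y = tvert d u" "r z = tvert d (tinv d u)"
          using x ret_tvert_he[of u] ret_tvert_he[of "tinv d u"] tinv_thes[OF ok] tinv_he by simp_all
        then show ?thesis
          using 1(1) by (auto simp: tlinks_def)
      next
        case 2
        then show ?thesis
          using ret_collapsed x by simp
      qed
    qed
    then show "(w, w') \<in> (tlinks d (thes d - \<psi>' ` hes p))\<^sup>*"
      using ret_nth w by simp
  next
    fix l
    assume l: "l < nv p"
    let ?m = "card {v \<in> D. \<pi> v = l}"
    have "(\<Sum>w | w < n \<and> \<pi>' w = l. tgen d ! w) = (\<Sum>w | w < n \<and> \<pi>' w = l. \<Sum>x | x < n' \<and> r x = w. tgen c ! x)"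
      using tgen_eq by (intro sum.cong) auto
    also have "\<dots> = (\<Sum>x | x < n' \<and> \<pi>' (r x) = l. tgen c ! x)"
      by (rule sum_fibres[OF ret_less])
    also have "\<dots> = (\<Sum>x | x < n' \<and> \<pi> x = l. tgen c ! x)"
      using pi' by (intro sum.cong) auto
    finally have 1: "(\<Sum>w | w < n \<and> \<pi>' w = l. tgen d ! w) = (\<Sum>x | x < n' \<and> \<pi> x = l. tgen c ! x)" .
    have "{x. x < n' \<and> \<pi> x = l} = (!) e ` {w. w < n \<and> \<pi>' w = l} \<union> {v \<in> D. \<pi> v = l}"
      using nth_less len by (auto simp: \<pi>'_def in_set_conv_nth)
    moreover have "card ((!) e ` {w. w < n \<and> \<pi>' w = l}) = card {w. w < n \<and> \<pi>' w = l}"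
      using distinct len by (intro card_image) (auto simp: inj_on_def nth_eq_iff_index_eq)
    moreover have "(!) e ` {w. w < n \<and> \<pi>' w = l} \<inter> {v \<in> D. \<pi> v = l} = {}"
      using len by auto
    ultimately have 2: "card {x. x < n' \<and> \<pi> x = l} = card {w. w < n \<and> \<pi>' w = l} + ?m"
      by (simp add: card_Un_disjoint)
    have pi_D: "\<pi> (tvert c x) = \<pi> (snd x)" if "x \<in> {1, 2} \<times> D" for x
      using that pi_par[of "snd x"] by (auto simp: tvert_def)
    let ?A = "{x \<in> thes d - \<psi>' ` hes p. \<pi>' (tvert d x) = l}"
    let ?B = "{1, 2 :: nat} \<times> {v \<in> D. \<pi> v = l}"
    have "{x \<in> thes c - \<psi> ` hes p. \<pi> (tvert c x) = l} = he e ` ?A \<union> ?B"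
      unfolding int_split using vert' pi_D by auto
    moreover have "card (he e ` ?A) = card ?A"
      by (intro card_image inj_on_subset[OF he_inj]) auto
    moreover have "he e ` ?A \<inter> ?B = {}"
    proof -
      have "he e ` ?A \<inter> ?B \<subseteq> he e ` thes d \<inter> ({1, 2} \<times> D)"
        by (intro Int_mono image_mono) auto
      also have "\<dots> = {}"
        unfolding he_image[symmetric] by (rule Diff_disjoint)
      finally show ?thesis by simp
    qed
    moreover have "finite ?A" "finite ?B"
      using finite_thes[of d] by simp_all
    ultimately have 3: "card {x \<in> thes c - \<psi> ` hes p. \<pi> (tvert c x) = l} = card ?A + 2 * ?m"
      by (simp add: card_Un_disjoint card_cartesian_product)
    show "gen p ! l = (\<Sum>w | w < n \<and> \<pi>' w = l. tgen d ! w) +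
        (card ?A div 2 + 1 - card {w. w < n \<and> \<pi>' w = l})"
      using gen[OF l] unfolding 1 2 3 by simp
  qed
  then show thesis
    using that[OF d(1)] he_psi'(1) pi' d(2) len_e card_S by simp
qed

section \<open>Spanning trees by depth-first search\<close>

lemma rtrancl_leaves:
  assumes "(a, b) \<in> R\<^sup>*" "a \<in> A" "b \<notin> A"
  shows "\<exists>(u, v)\<in>R. u \<in> A \<and> v \<notin> A"
  using assms(1,3)
proof induction
  case (step y z)
  then show ?case
    by (cases "y \<in> A") auto
qed (use assms in simp)

definition grow :: "nat list \<Rightarrow> nat \<Rightarrow> nat list" where
  "grow en i = map (\<lambda>k. if anc en k i then Suc (length en) else en ! k) [0..<length en] @ [Suc (length en)]"

lemma grow:
  assumes tr: "tree en" and i: "i < length en" "en ! i = length en"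
  shows "tree (grow en i)" "length (grow en i) = Suc (length en)"
    "1 \<le> k \<Longrightarrow> k < length en \<Longrightarrow> par (grow en i) k = par en k"
    "par (grow en i) (length en) = i"
    "k < length en \<Longrightarrow> grow en i ! k = (if anc en k i then Suc (length en) else en ! k)"
proof -
  let ?m = "length en" and ?g = "grow en i"
  show len: "length ?g = Suc ?m"
    by (simp add: grow_def)
  have nth: "?g ! k = (if anc en k i then Suc ?m else en ! k)" if "k < ?m" for k
    using that by (simp add: grow_def nth_append)
  then show "k < ?m \<Longrightarrow> ?g ! k = (if anc en k i then Suc ?m else en ! k)"
    by simp
  have last: "?g ! ?m = Suc ?m"
    by (simp add: grow_def nth_append)
  have bounds: "k < en ! k" "en ! k \<le> ?m" if "k < ?m" for k
    using tr that by (simp_all add: tree_def)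
  have top: "en ! k = ?m" if "k < ?m" "anc en k i" for k
  proof -
    have "en ! i \<le> en ! k"
      using tr that i(1) unfolding tree_def by blast
    then show ?thesis
      using bounds(2)[OF that(1)] i(2) by simp
  qed
  have anc_old: "anc ?g u k \<longleftrightarrow> anc en u k" if "k < ?m" "u \<le> k" for u k
  proof (cases "anc en u i")
    case True
    then have "?g ! u = Suc ?m" "en ! u = ?m"
      using that nth[of u] top[of u] by simp_all
    then show ?thesis
      using that by (simp add: anc_def)
  next
    case False
    then have "?g ! u = en ! u"
      using that nth[of u] by simp
    then show ?thesis
      by (simp add: anc_def)
  qed
  have anc_new: "anc ?g u ?m \<longleftrightarrow> anc en u i" if "u < ?m" for u
  proof (cases "anc en u i")
    case True
    then have "?g ! u = Suc ?m"
      using nth[OF that] by simp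
    then show ?thesis
      using that True by (simp add: anc_def[of ?g])
  next
    case False
    then have "?g ! u \<le> ?m"
      using nth[OF that] bounds(2)[OF that] by simp
    then show ?thesis
      using False by (simp add: anc_def[of ?g])
  qed
  show "tree ?g"
    unfolding tree_def len
  proof (intro conjI allI impI)
    show "?g \<noteq> []"
      by (simp add: grow_def)
    have "0 < ?m"
      using i(1) by (rule order.strict_trans1[OF le0])
    then show "?g ! 0 = Suc ?m"
      using nth[of 0] anc_zero[OF tr i(1)] by simp
  next
    fix k
    assume k: "k < Suc ?m"
    show "k < ?g ! k"
      using k bounds(1)[of k] nth[of k] last by (cases "k = ?m") auto
    show "?g ! k \<le> Suc ?m"
      using k bounds(2)[of k] nth[of k] last by (cases "k = ?m") auto
  next
    fix a b
    assume a: "a < Suc ?m" and b: "b < Suc ?m" and ab: "anc ?g a b"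
    show "?g ! b \<le> ?g ! a"
    proof (cases "b = ?m")
      case True
      then show ?thesis
        using ab last by (simp add: anc_def)
    next
      case False
      then have lt: "b < ?m" "a < ?m" "a \<le> b"
        using b ab by (simp_all add: anc_def)
      then have "anc en a b"
        using ab anc_old by blast
      then have "en ! b \<le> en ! a" "anc en b i \<Longrightarrow> anc en a i"
        using tr lt anc_trans[OF tr _ _ lt(1)] unfolding tree_def by blast+
      then show ?thesis
        using nth[OF lt(1)] nth[OF lt(2)] bounds(2)[OF lt(1)] by auto
    qed
  qed
  show "par ?g k = par en k" if "1 \<le> k" "k < ?m" for k
    unfolding par_def using that(2) anc_old by (metis (no_types, lifting) less_imp_le)
  have "{u. u < ?m \<and> anc ?g u ?m} = {u. u < ?m \<and> anc en u i}"
    using anc_new by blast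
  moreover have "Max {u. u < ?m \<and> anc en u i} = i"
    using i anc_refl[OF tr i(1)] by (intro Max_eqI) (auto simp: anc_def)
  ultimately show "par ?g ?m = i"
    by (simp add: par_def)
qed

definition dfs where
  "dfs G m vs en up \<longleftrightarrow> length vs = m \<and> length en = m \<and> distinct vs \<and> set vs \<subseteq> {..<nv G} \<and> tree en \<and>
    (\<forall>v. 1 \<le> v \<longrightarrow> v < m \<longrightarrow> up v \<in> hes G \<and> fst (up v) = vs ! v \<and> fst (inv G (up v)) = vs ! par en v) \<and>
    (\<forall>k<m. en ! k \<noteq> m \<longrightarrow> (\<forall>x\<in>hes G. fst x = vs ! k \<longrightarrow> fst (inv G x) \<in> set vs))"

text \<open>Depth-first search: the parent of the next vertex is the last vertex with an unvisited
  neighbour, so vertices off the rightmost branch never acquire new children.\<close>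

lemma depth_first_prefix:
  assumes G: "is_obj G" and m: "1 \<le> m" "m \<le> nv G"
  shows "\<exists>vs en up. dfs G m vs en up"
  using m
proof (induction m rule: dec_induct)
  case base
  have "tree [1]"
    by (simp add: tree_def anc_def)
  then show ?case
    using base unfolding dfs_def by (intro exI[of _ "[0]"] exI[of _ "[1]"]) auto
next
  case (step m)
  then obtain vs en up where dfs: "dfs G m vs en up"
    by auto
  have len: "length vs = m" "length en = m" and vs: "distinct vs" "set vs \<subseteq> {..<nv G}"
    and tr: "tree en"
    and up: "\<And>v. 1 \<le> v \<Longrightarrow> v < m \<Longrightarrow> up v \<in> hes G \<and> fst (up v) = vs ! v \<and> fst (inv G (up v)) = vs ! par en v"
    and closed: "\<And>k x. k < m \<Longrightarrow> en ! k \<noteq> m \<Longrightarrow> x \<in> hes G \<Longrightarrow> fst x = vs ! k \<Longrightarrow> fst (inv G x) \<in> set vs"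
    using dfs unfolding dfs_def by blast+
  let ?A = "{k. k < m \<and> (\<exists>x\<in>hes G. fst x = vs ! k \<and> fst (inv G x) \<notin> set vs)}"
  have "card (set vs) < card {..<nv G}"
    using step.prems len vs(1) distinct_card[of vs] by simp
  then obtain b where b: "b < nv G" "b \<notin> set vs"
    using vs(2) by (metis lessThan_iff less_irrefl subset_antisym subsetI)
  have "vs ! 0 \<in> set vs"
    using step.hyps len by simp
  moreover have "(vs ! 0, b) \<in> (adj G)\<^sup>*"
    using G calculation vs(2) b(1) by (auto simp: is_obj_iff)
  ultimately obtain u v where uv: "(u, v) \<in> adj G" "u \<in> set vs" "v \<notin> set vs"
    using rtrancl_leaves[of "vs ! 0" b "adj G" "set vs"] b(2) by blast
  then obtain s t where st: "(u, s) \<in> hes G" "inv G (u, s) = (v, t)"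
    by (auto simp: adj_def)
  obtain k where "k < m" "vs ! k = u"
    using uv(2) len by (metis in_set_conv_nth)
  then have "k \<in> ?A"
    using st uv(3) by force
  then have "Max ?A \<in> ?A"
    by (intro Max_in) auto
  define i where "i = Max ?A"
  obtain x where i: "i < m" and x: "x \<in> hes G" "fst x = vs ! i" "fst (inv G x) \<notin> set vs"
    using \<open>Max ?A \<in> ?A\<close> by (auto simp: i_def)
  have not_A: "k \<notin> ?A" if "i < k" for k
  proof
    assume "k \<in> ?A"
    then have "k \<le> Max ?A"
      by (intro Max_ge) auto
    then show False
      using that by (simp add: i_def)
  qed
  have en_i: "en ! i = m"
    using closed[OF i _ x(1,2)] x(3) by blast
  note g = grow[OF tr, of i, unfolded len, OF i en_i]
  let ?w = "fst (inv G x)"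
  have inv_x: "inv G x \<in> hes G" "inv G (inv G x) = x"
    using G x(1) by (auto simp: is_obj_iff wfg_def)
  have "dfs G (Suc m) (vs @ [?w]) (grow en i) (up (m := inv G x))"
    unfolding dfs_def
  proof (intro conjI allI impI ballI)
    show "length (vs @ [?w]) = Suc m" "length (grow en i) = Suc m" "distinct (vs @ [?w])" "tree (grow en i)"
      using len vs(1) x(3) g by simp_all
    show "set (vs @ [?w]) \<subseteq> {..<nv G}"
      using vs(2) fst_hes[OF inv_x(1)] by simp
  next
    fix v
    assume v: "1 \<le> v" "v < Suc m"
    let ?up = "up (m := inv G x)"
    have "?up v \<in> hes G \<and> fst (?up v) = (vs @ [?w]) ! v \<and>
      fst (inv G (?up v)) = (vs @ [?w]) ! par (grow en i) v"
    proof (cases "v = m")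
      case True
      then show ?thesis
        using inv_x x(2) len i g(4) by (simp add: nth_append)
    next
      case False
      then have v': "v < m"
        using v by simp
      then have "par en v < m"
        using par_less[OF tr v(1)] len by simp
      then show ?thesis
        using up[OF v(1) v'] v' len g(3)[OF v(1) v'] by (simp add: nth_append)
    qed
    then show "?up v \<in> hes G" "fst (?up v) = (vs @ [?w]) ! v"
      "fst (inv G (?up v)) = (vs @ [?w]) ! par (grow en i) v"
      by blast+
  next
    fix k y
    assume k: "k < Suc m" "grow en i ! k \<noteq> Suc m" and y: "y \<in> hes G" "fst y = (vs @ [?w]) ! k"
    have "grow en i ! m = Suc m"
      using len by (simp add: grow_def nth_append)
    then have km: "k < m"
      using k by (cases "k = m") auto
    then have na: "\<not> anc en k i"
      using g(5) k(2) by auto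
    have yk: "fst y = vs ! k"
      using y(2) km len by (simp add: nth_append)
    have "fst (inv G y) \<in> set vs"
    proof (cases "en ! k = m")
      case True
      then have "i < k"
        using na i by (auto simp: anc_def)
      then show ?thesis
        using not_A[of k] km y(1) yk by blast
    next
      case False
      then show ?thesis
        using closed km y(1) yk by blast
    qed
    then show "fst (inv G y) \<in> set (vs @ [?w])"
      by simp
  qed
  then show ?case by blast
qed

lemma iso_contr:
  assumes obj: "is_obj p" "is_obj q"
    and \<phi>: "bij_betw \<phi> (hes p) (hes q)" "\<And>h. h \<in> hes p \<Longrightarrow> inv q (\<phi> h) = \<phi> (inv p h)"
    and lvs: "lvs q = map \<phi> (lvs p)"
    and \<pi>: "bij_betw \<pi> {..<nv q} {..<nv p}" "\<And>h. h \<in> hes p \<Longrightarrow> \<pi> (fst (\<phi> h)) = fst h"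
    and gen: "\<And>w. w < nv q \<Longrightarrow> gen p ! \<pi> w = gen q ! w"
  shows "contr p q \<phi> \<pi>"
proof -
  have im: "\<phi> ` hes p = hes q" and inj: "inj_on \<phi> (hes p)"
    using \<phi>(1) by (simp_all add: bij_betw_def)
  have \<pi>_less: "\<pi> w < nv p" if "w < nv q" for w
    using bij_betw_apply[OF \<pi>(1)] that by simp
  have \<pi>_inj: "w = w'" if "w < nv q" "w' < nv q" "\<pi> w = \<pi> w'" for w w'
    using \<pi>(1) that by (auto simp: bij_betw_def dest: inj_onD)
  have ex: "\<exists>w<nv q. \<pi> w = l" if "l < nv p" for l
  proof -
    have "l \<in> \<pi> ` {..<nv q}"
      using \<pi>(1) that by (simp add: bij_betw_def)
    then show ?thesis by auto
  qed
  have "str p q \<phi> \<pi>"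
    using obj inj im lvs \<phi>(2) \<pi>(2) \<pi>_less by (auto simp: str_def is_obj_iff)
  moreover have "gen p ! l = (\<Sum>w | w < nv q \<and> \<pi> w = l. gen q ! w) +
      (card {x \<in> hes q - \<phi> ` hes p. \<pi> (fst x) = l} div 2 + 1 - card {w. w < nv q \<and> \<pi> w = l})"
    if l: "l < nv p" for l
  proof -
    obtain w where w: "w < nv q" "\<pi> w = l"
      using ex[OF l] by blast
    then have "{w. w < nv q \<and> \<pi> w = l} = {w}"
      using \<pi>_inj by blast
    then show ?thesis
      using gen[OF w(1)] w(2) im by simp
  qed
  ultimately show ?thesis
    unfolding contr_def using obj ex \<pi>_inj by blast
qed

definition models :: "ograph \<Rightarrow> tobj \<Rightarrow> nat list \<Rightarrow> (nat \<times> nat \<Rightarrow> nat \<times> nat) \<Rightarrow> bool" where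
  "models G c vs \<alpha> \<longleftrightarrow> tobj_ok c \<and> bij_betw ((!) vs) {..<length (ends c)} {..<nv G} \<and>
     bij_betw \<alpha> (thes c) (hes G) \<and>
     (\<forall>x\<in>thes c. fst (\<alpha> x) = vs ! tvert c x \<and> inv G (\<alpha> x) = \<alpha> (tinv c x)) \<and>
     lvs G = map (\<alpha> \<circ> Pair 0) (leafs c) \<and> (\<forall>v<length (ends c). tgen c ! v = gen G ! (vs ! v))"

lemma ex_models:
  assumes G: "is_obj G"
  shows "\<exists>c vs \<alpha>. models G c vs \<alpha>"
proof -
  have wf: "wfg G" and n1: "1 \<le> nv G"
    using G by (simp_all add: is_obj_iff)
  have inv_hes: "inv G h \<in> hes G" "inv G (inv G h) = h" if "h \<in> hes G" for h
    using wf that by (simp_all add: wfg_def)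
  have lvs: "distinct (lvs G)" "set (lvs G) = {h \<in> hes G. inv G h = h}"
    using wf by (simp_all add: wfg_def)
  let ?n = "nv G"
  obtain vs en up where dfs: "dfs G ?n vs en up"
    using depth_first_prefix[OF G n1 order_refl] by blast
  have len: "length vs = ?n" "length en = ?n" and vs: "distinct vs" "set vs \<subseteq> {..<?n}"
    and tr: "tree en"
    and up: "\<And>v. 1 \<le> v \<Longrightarrow> v < ?n \<Longrightarrow> up v \<in> hes G"
      "\<And>v. 1 \<le> v \<Longrightarrow> v < ?n \<Longrightarrow> fst (up v) = vs ! v"
      "\<And>v. 1 \<le> v \<Longrightarrow> v < ?n \<Longrightarrow> fst (inv G (up v)) = vs ! par en v"
    using dfs unfolding dfs_def by blast+
  have set_vs: "set vs = {..<?n}"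
    using vs len distinct_card[OF vs(1)] by (intro card_subset_eq) auto
  have vs_eq: "vs ! a = vs ! b \<longleftrightarrow> a = b" if "a < ?n" "b < ?n" for a b
    using vs(1) len that by (simp add: nth_eq_iff_index_eq)
  have par_lt: "par en v < v" if "1 \<le> v" "v < ?n" for v
    using par_less[OF tr that(1)] that(2) len by simp
  have up_inj: "v = w" if "1 \<le> v" "v < ?n" "1 \<le> w" "w < ?n" "up v = up w" for v w
  proof -
    have "vs ! v = vs ! w"
      using up(2)[OF that(1,2)] up(2)[OF that(3,4)] that(5) by simp
    then show ?thesis
      using vs_eq[OF that(2,4)] by simp
  qed
  have up_inv: "up v \<noteq> inv G (up w)" if v: "1 \<le> v" "v < ?n" and w: "1 \<le> w" "w < ?n" for v w
  proof
    assume eq: "up v = inv G (up w)"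
    then have "vs ! v = vs ! par en w"
      using up(2)[OF v] up(3)[OF w] by simp
    then have "v = par en w"
      using vs_eq[OF v(2), of "par en w"] par_lt[OF w] w(2) by simp
    have "inv G (up v) = up w"
      using eq inv_hes(2)[OF up(1)[OF w]] by simp
    then have "vs ! w = vs ! par en v"
      using up(2)[OF w] up(3)[OF v] by simp
    then have "w = par en v"
      using vs_eq[OF w(2), of "par en v"] par_lt[OF v] v(2) by simp
    then show False
      using \<open>v = par en w\<close> par_lt[OF v] par_lt[OF w] by simp
  qed
  define T where "T = up ` {1..<?n} \<union> (\<lambda>v. inv G (up v)) ` {1..<?n}"
  have T_I: "up v \<in> T" "inv G (up v) \<in> T" if "1 \<le> v" "v < ?n" for v
    using that by (simp_all add: T_def)
  have T_E: "\<exists>v. 1 \<le> v \<and> v < ?n \<and> (h = up v \<or> h = inv G (up v))" if "h \<in> T" for h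
    using that by (auto simp: T_def)
  have T_inv: "inv G h \<in> T" if "h \<in> T" for h
    using T_E[OF that] T_I up(1) inv_hes(2) by metis
  have rest_inv: "inv G h \<in> hes G - T" if "h \<in> hes G - T" for h
    using that T_inv[of "inv G h"] inv_hes[of h] by auto
  obtain ml where ml: "distinct ml" "set ml = hes G - T"
    using finite_distinct_list[of "hes G - T"] finite_hes by auto
  have lvs_ml: "set (lvs G) \<subseteq> set ml"
  proof
    fix h
    assume "h \<in> set (lvs G)"
    then have h: "h \<in> hes G" "inv G h = h"
      using lvs by auto
    have "h \<notin> T"
    proof
      assume "h \<in> T"
      then obtain v where "1 \<le> v" "v < ?n" "h = up v \<or> h = inv G (up v)"
        using T_E by blast
      then show False
        using up_inv[of v v] up(1)[of v] inv_hes(2)[of "up v"] h(2) by auto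
    qed
    then show "h \<in> set ml"
      using h ml by simp
  qed
  have pos_ml: "pos ml h < length ml" "ml ! pos ml h = h" if "h \<in> set ml" for h
    using that ml(1) by (simp_all add: pos_less nth_pos)
  have ml_pos: "pos ml (ml ! k) = k" if "k < length ml" for k
    using that ml(1) by (simp add: pos_nth)
  have ml_nth: "ml ! k \<in> hes G" "inv G (ml ! k) \<in> set ml" if "k < length ml" for k
    using nth_mem[OF that] ml(2) rest_inv by auto
  define c where "c = TObj en (map (\<lambda>v. gen G ! (vs ! v)) [0..<?n]) (map (\<lambda>h. pos vs (fst h)) ml)
    (map (\<lambda>h. pos ml (inv G h)) ml) (map (pos ml) (lvs G))"
  have sel: "ends c = en" "tgen c = map (\<lambda>v. gen G ! (vs ! v)) [0..<?n]"
    "att c = map (\<lambda>h. pos vs (fst h)) ml" "mate c = map (\<lambda>h. pos ml (inv G h)) ml"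
    "leafs c = map (pos ml) (lvs G)"
    by (simp_all add: c_def)
  have pos_vs: "pos vs v < ?n" "vs ! pos vs v = v" if "v < ?n" for v
    using that vs(1) set_vs len by (simp_all add: pos_less[of vs, unfolded len] nth_pos)
  have mate: "mate c ! k = pos ml (inv G (ml ! k))" if "k < length ml" for k
    using that by (simp add: sel)
  have ok: "tobj_ok c"
    unfolding tobj_ok_def
  proof (intro conjI allI impI)
    show "set (att c) \<subseteq> {..<length (ends c)}"
      using pos_vs(1) fst_hes ml(2) len by (auto simp: sel)
    show "distinct (leafs c)"
      using lvs(1) lvs_ml ml(1) by (auto simp: sel distinct_map inj_on_def pos_eq_iff subset_iff)
    show "set (leafs c) = {k. k < length (att c) \<and> mate c ! k = k}"
    proof (intro equalityI subsetI)
      fix k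
      assume "k \<in> set (leafs c)"
      then obtain h where "h \<in> set (lvs G)" "k = pos ml h"
        by (auto simp: sel)
      then have h: "h \<in> set ml" "k = pos ml h" "inv G h = h"
        using lvs_ml lvs(2) by auto
      then show "k \<in> {k. k < length (att c) \<and> mate c ! k = k}"
        using pos_ml[OF h(1)] mate by (simp add: sel(3))
    next
      fix k
      assume "k \<in> {k. k < length (att c) \<and> mate c ! k = k}"
      then have k: "k < length ml" "pos ml (inv G (ml ! k)) = k"
        using mate by (auto simp: sel(3))
      then have "inv G (ml ! k) = ml ! k"
        using pos_ml(2)[OF ml_nth(2)[OF k(1)]] by simp
      then have "ml ! k \<in> set (lvs G)"
        using lvs(2) ml_nth(1)[OF k(1)] by simp
      then show "k \<in> set (leafs c)"
        using ml_pos[OF k(1)] by (force simp: sel(5))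
    qed
  next
    fix k
    assume "k < length (att c)"
    then have k: "k < length ml"
      by (simp add: sel)
    note p = pos_ml[OF ml_nth(2)[OF k]]
    show "mate c ! k < length (att c)"
      using mate[OF k] p(1) by (simp add: sel(3))
    show "mate c ! (mate c ! k) = k"
      using mate[OF k] mate[OF p(1)] p(2) inv_hes(2)[OF ml_nth(1)[OF k]] ml_pos[OF k] by simp
  qed (simp_all add: sel tr len)
  define \<alpha> where "\<alpha> x = (if fst x = 0 then ml ! snd x else if fst x = 1 then up (snd x) else inv G (up (snd x)))"
    for x :: "nat \<times> nat"
  have thes_cases: "(fst x = 0 \<and> snd x < length ml) \<or> (fst x = 1 \<and> 1 \<le> snd x \<and> snd x < ?n) \<or>
      (fst x = 2 \<and> 1 \<le> snd x \<and> snd x < ?n)" if "x \<in> thes c" for x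
    using that len by (auto simp: thes_def sel)
  have \<alpha>_im: "\<alpha> ` thes c = hes G"
  proof (intro equalityI subsetI)
    fix h
    assume "h \<in> \<alpha> ` thes c"
    then obtain x where x: "x \<in> thes c" "h = \<alpha> x"
      by blast
    show "h \<in> hes G"
      using thes_cases[OF x(1)] x(2) ml_nth(1)[of "snd x"] up(1)[of "snd x"] inv_hes(1)[of "up (snd x)"]
      by (auto simp: \<alpha>_def)
  next
    fix h
    assume h: "h \<in> hes G"
    show "h \<in> \<alpha> ` thes c"
    proof (cases "h \<in> T")
      case True
      then obtain v where v: "1 \<le> v" "v < ?n" "h = up v \<or> h = inv G (up v)"
        using T_E by blast
      then have "(1, v) \<in> thes c" "(2, v) \<in> thes c" "h = \<alpha> (1, v) \<or> h = \<alpha> (2, v)"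
        using len by (auto simp: thes_def sel \<alpha>_def)
      then show ?thesis by blast
    next
      case False
      then have "h \<in> set ml"
        using h ml(2) by simp
      then have "(0, pos ml h) \<in> thes c" "h = \<alpha> (0, pos ml h)"
        using pos_ml by (simp_all add: thes_def sel \<alpha>_def)
      then show ?thesis by blast
    qed
  qed
  have inv_up_inj: "v = w" if "1 \<le> v" "v < ?n" "1 \<le> w" "w < ?n" "inv G (up v) = inv G (up w)" for v w
    using that up(1) inv_hes(2) up_inj by metis
  have ml_T: "ml ! k \<noteq> up v" "ml ! k \<noteq> inv G (up v)" if "k < length ml" "1 \<le> v" "v < ?n" for k v
    using nth_mem[OF that(1)] ml(2) that(2,3) by (auto simp: T_def)
  have \<alpha>_inj: "inj_on \<alpha> (thes c)"
  proof (rule inj_onI)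
    fix x y
    assume xy: "x \<in> thes c" "y \<in> thes c" and eq: "\<alpha> x = \<alpha> y"
    have "fst x = fst y \<and> snd x = snd y"
    proof -
      note facts = ml_T[of "snd x" "snd y"] ml_T[of "snd y" "snd x"] up_inv[of "snd x" "snd y"]
        up_inv[of "snd y" "snd x"] up_inj[of "snd x" "snd y"] inv_up_inj[of "snd x" "snd y"]
      have ml_eq: "snd x = snd y" if "snd x < length ml" "snd y < length ml" "ml ! snd x = ml ! snd y"
        using that ml(1) by (simp add: nth_eq_iff_index_eq)
      have eq': "\<alpha> y = \<alpha> x"
        using eq by simp
      show ?thesis
        using thes_cases[OF xy(1)] thes_cases[OF xy(2)]
        by (elim disjE conjE) (use eq eq' facts ml_eq in \<open>simp_all add: \<alpha>_def\<close>)
    qed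
    then show "x = y"
      by (simp add: prod_eq_iff)
  qed
  have "fst (\<alpha> x) = vs ! tvert c x \<and> inv G (\<alpha> x) = \<alpha> (tinv c x)" if "x \<in> thes c" for x
    using thes_cases[OF that]
  proof (elim disjE conjE)
    assume x: "fst x = 0" "snd x < length ml"
    then show ?thesis
      using mate[OF x(2)] pos_ml[OF ml_nth(2)[OF x(2)]] pos_vs(2)[OF fst_hes[OF ml_nth(1)[OF x(2)]]]
      by (simp add: \<alpha>_def tvert_def tinv_def) (simp add: sel)
  next
    assume x: "fst x = 1" "1 \<le> snd x" "snd x < ?n"
    then show ?thesis
      using up(2)[OF x(2,3)] by (simp add: \<alpha>_def tvert_def tinv_def)
  next
    assume x: "fst x = 2" "1 \<le> snd x" "snd x < ?n"
    then show ?thesis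
      using up(3)[OF x(2,3)] inv_hes(2)[OF up(1)[OF x(2,3)]] by (simp add: \<alpha>_def tvert_def tinv_def sel)
  qed
  moreover have "lvs G = map (\<alpha> \<circ> Pair 0) (leafs c)"
    unfolding sel(5) map_map
    by (rule map_idI[symmetric]) (use subsetD[OF lvs_ml] pos_ml(2) in \<open>simp add: \<alpha>_def\<close>)
  moreover have "bij_betw ((!) vs) {..<length (ends c)} {..<nv G}"
    using vs(1) len set_vs by (intro bij_betw_nth) (simp_all add: sel)
  moreover have "bij_betw \<alpha> (thes c) (hes G)"
    using \<alpha>_im \<alpha>_inj by (simp add: bij_betw_def)
  moreover have "\<forall>v<length (ends c). tgen c ! v = gen G ! (vs ! v)"
    by (simp add: sel len)
  ultimately have "models G c vs \<alpha>"
    using ok by (simp add: models_def)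
  then show ?thesis by blast
qed

section \<open>The functor from marked trees to graphs\<close>

definition realization :: "tobj \<Rightarrow> ograph \<times> (nat \<times> nat \<Rightarrow> nat \<times> nat)" where
  "realization c = (SOME (G, \<beta>). realizes c G \<beta>)"

abbreviation "real_graph c \<equiv> fst (realization c)"
abbreviation "real_he c \<equiv> snd (realization c)"

lemma realizes_realization: "tobj_ok c \<Longrightarrow> realizes c (real_graph c) (real_he c)"
  using ex_realizes[of c] someI_ex[of "\<lambda>(G, \<beta>). realizes c G \<beta>"]
  by (auto simp: realization_def case_prod_unfold)

definition real_inv :: "tobj \<Rightarrow> nat \<times> nat \<Rightarrow> nat \<times> nat" where
  "real_inv c = inv_into (thes c) (real_he c)"

lemma realization:
  assumes "tobj_ok c"
  shows real_obj: "is_obj (real_graph c)" and nv_real: "nv (real_graph c) = length (ends c)"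
    and gen_real: "gen (real_graph c) = tgen c"
    and real_he_bij: "bij_betw (real_he c) (thes c) (hes (real_graph c))"
    and real_he_fst: "x \<in> thes c \<Longrightarrow> fst (real_he c x) = tvert c x"
    and real_he_inv: "x \<in> thes c \<Longrightarrow> inv (real_graph c) (real_he c x) = real_he c (tinv c x)"
    and real_lvs: "lvs (real_graph c) = map (real_he c \<circ> Pair 0) (leafs c)"
    and real_inv_bij: "bij_betw (real_inv c) (hes (real_graph c)) (thes c)"
    and real_he_real_inv: "h \<in> hes (real_graph c) \<Longrightarrow> real_he c (real_inv c h) = h"
    and real_inv_real_he: "x \<in> thes c \<Longrightarrow> real_inv c (real_he c x) = x"
    and real_inv_thes: "h \<in> hes (real_graph c) \<Longrightarrow> real_inv c h \<in> thes c"
proof -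
  note r = realizes_realization[OF assms, unfolded realizes_def]
  then show "is_obj (real_graph c)" "nv (real_graph c) = length (ends c)" "gen (real_graph c) = tgen c"
    "x \<in> thes c \<Longrightarrow> fst (real_he c x) = tvert c x"
    "x \<in> thes c \<Longrightarrow> inv (real_graph c) (real_he c x) = real_he c (tinv c x)"
    "lvs (real_graph c) = map (real_he c \<circ> Pair 0) (leafs c)"
    and bij: "bij_betw (real_he c) (thes c) (hes (real_graph c))"
    by simp_all
  show bij': "bij_betw (real_inv c) (hes (real_graph c)) (thes c)"
    unfolding real_inv_def by (rule bij_betw_inv_into[OF bij])
  show "h \<in> hes (real_graph c) \<Longrightarrow> real_he c (real_inv c h) = h"
    unfolding real_inv_def using bij by (simp add: bij_betw_inv_into_right)
  show "x \<in> thes c \<Longrightarrow> real_inv c (real_he c x) = x"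
    unfolding real_inv_def using bij by (simp add: bij_betw_inv_into_left)
  show "h \<in> hes (real_graph c) \<Longrightarrow> real_inv c h \<in> thes c"
    by (rule bij_betw_apply[OF bij'])
qed

definition real_mor :: "tmorph \<Rightarrow> omor" where
  "real_mor = (\<lambda>(c, d, e). mk (real_graph c) (real_graph d)
     (real_he d \<circ> he e \<circ> real_inv c) (ret (ends d) e))"

lemma contr_real_mor:
  assumes "tmor c d e"
  shows "contr (real_graph c) (real_graph d) (real_he d \<circ> he e \<circ> real_inv c) (ret (ends d) e)"
proof -
  interpret tree_mor c d e
    using assms by unfold_locales
  show ?thesis
  proof (rule contr_realized_iff[OF ok' realizes_realization[OF ok'] real_obj[OF ok], THEN iffD2])
    show "tcontr (real_graph c) d (he e \<circ> real_inv c) r"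
      unfolding real_inv_def by (rule tcontr_functor[OF realizes_realization[OF ok]])
  qed (use real_inv_thes[OF ok] he_thes in auto)
qed

lemma contr_str: "contr p q \<phi> \<pi> \<Longrightarrow> str p q \<phi> \<pi>"
  by (simp add: contr_def)

lemma mcomp_mk_contr:
  assumes "contr p q \<phi> \<pi>" "contr q r \<phi>' \<pi>'"
  shows "mcomp (mk q r \<phi>' \<pi>') (mk p q \<phi> \<pi>) = mk p r (\<phi>' \<circ> \<phi>) (\<pi> \<circ> \<pi>')"
proof -
  interpret composable p q \<phi> \<pi> r \<phi>' \<pi>'
    using assms contr_str by unfold_locales
  show ?thesis
    by (rule mcomp_mk)
qed

lemma numOp_op_sel [simp]:
  "Obj numOp_op = {G. is_obj G}" "Hom numOp_op p q = {m. is_mor p q m}"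
  "cmp numOp_op = mcomp" "idm numOp_op = midm"
  by (simp_all add: numOp_op_def)

lemma tree_cat_sel [simp]:
  "Obj tree_cat = {c. tobj_ok c}" "Hom tree_cat c d = {(c, d, e) | e. tmor c d e}"
  "cmp tree_cat (b', d, e') (c, b, e) = (c, d, map ((!) e') e)"
  "idm tree_cat c = (c, c, [0..<length (ends c)])"
  by (simp_all add: tree_cat_def)

lemma he_comp:
  assumes "tmor a b e" "x \<in> thes a"
  shows "he e' (he e x) = he (map ((!) e') e) x"
proof -
  have "length e = length (ends a)"
    using assms(1) by (simp add: tmor_def temb_def)
  then show ?thesis
    using assms(2) by (auto simp: he_def thes_def)
qed

theorem is_functor_real: "is_functor tree_cat numOp_op real_graph real_mor"
  unfolding is_functor_def
proof (intro conjI ballI allI impI)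
  fix a
  assume "a \<in> Obj tree_cat"
  then have a: "tobj_ok a"
    by simp
  then show "real_graph a \<in> Obj numOp_op"
    using real_obj by simp
  have tr: "tree (ends a)"
    using a by (simp add: tobj_ok_def)
  have "he [0..<length (ends a)] x = x" if "x \<in> thes a" for x
    using that by (auto simp: he_def thes_def)
  then show "real_mor (idm tree_cat a) = idm numOp_op (real_graph a)"
    unfolding real_mor_def tree_cat_sel(4) numOp_op_sel(4) midm_mk prod.case
    using real_inv_thes[OF a] real_he_real_inv[OF a] nv_real[OF a] ret_id[OF tr]
    by (intro mk_cong) simp_all
next
  fix a b f
  assume "f \<in> Hom tree_cat a b"
  then show "real_mor f \<in> Hom numOp_op (real_graph a) (real_graph b)"
    using contr_real_mor is_mor_mk by (auto simp: real_mor_def)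
next
  fix a b c f g
  assume "f \<in> Hom tree_cat a b" "g \<in> Hom tree_cat b c"
  then obtain e e' where f: "f = (a, b, e)" "tmor a b e" and g: "g = (b, c, e')" "tmor b c e'"
    by auto
  interpret f: tree_mor a b e
    using f(2) by unfold_locales
  interpret g: tree_mor b c e'
    using g(2) by unfold_locales
  have "mcomp (real_mor g) (real_mor f) = mk (real_graph a) (real_graph c)
      ((real_he c \<circ> he e' \<circ> real_inv b) \<circ> (real_he b \<circ> he e \<circ> real_inv a)) (f.r \<circ> g.r)"
    using mcomp_mk_contr[OF contr_real_mor[OF f(2)] contr_real_mor[OF g(2)]]
    by (simp add: real_mor_def f g)
  also have "\<dots> = real_mor (a, c, map ((!) e') e)"
    unfolding real_mor_def prod.case
  proof (rule mk_cong)
    fix h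
    assume "h \<in> hes (real_graph a)"
    then have x: "real_inv a h \<in> thes a"
      by (rule real_inv_thes[OF f.ok])
    show "((real_he c \<circ> he e' \<circ> real_inv b) \<circ> (real_he b \<circ> he e \<circ> real_inv a)) h =
        (real_he c \<circ> he (map ((!) e') e) \<circ> real_inv a) h"
      using he_comp[OF f(2) x] real_inv_real_he[OF f.ok' f.he_thes[OF x]] by simp
  next
    fix w
    assume "w < nv (real_graph c)"
    then show "(f.r \<circ> g.r) w = ret (ends c) (map ((!) e') e) w"
      using temb_comp(2)[OF f.temb g.temb] nv_real[OF g.ok'] by simp
  qed
  finally show "real_mor (cmp tree_cat g f) = cmp numOp_op (real_mor g) (real_mor f)"
    by (simp add: f g)
qed

theorem ess_surj_real: "ess_surj tree_cat numOp_op real_graph"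
  unfolding ess_surj_def
proof
  fix G
  assume "G \<in> Obj numOp_op"
  then have G: "is_obj G"
    by simp
  then obtain c vs \<alpha> where "models G c vs \<alpha>"
    using ex_models by blast
  then have c: "tobj_ok c" and vs: "bij_betw ((!) vs) {..<length (ends c)} {..<nv G}"
    and \<alpha>: "bij_betw \<alpha> (thes c) (hes G)" "\<And>x. x \<in> thes c \<Longrightarrow> fst (\<alpha> x) = vs ! tvert c x"
      "\<And>x. x \<in> thes c \<Longrightarrow> inv G (\<alpha> x) = \<alpha> (tinv c x)" "lvs G = map (\<alpha> \<circ> Pair 0) (leafs c)"
    and gen: "\<And>v. v < length (ends c) \<Longrightarrow> tgen c ! v = gen G ! (vs ! v)"
    by (auto simp: models_def)
  define \<alpha>' where "\<alpha>' = inv_into (thes c) \<alpha>"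
  define vs' where "vs' = inv_into {..<length (ends c)} ((!) vs)"
  have \<alpha>': "bij_betw \<alpha>' (hes G) (thes c)" "\<And>h. h \<in> hes G \<Longrightarrow> \<alpha> (\<alpha>' h) = h"
    "\<And>x. x \<in> thes c \<Longrightarrow> \<alpha>' (\<alpha> x) = x"
    using \<alpha>(1) by (simp_all add: \<alpha>'_def bij_betw_inv_into bij_betw_inv_into_right bij_betw_inv_into_left)
  have vs': "bij_betw vs' {..<nv G} {..<length (ends c)}" "\<And>v. v < nv G \<Longrightarrow> vs ! vs' v = v"
    "\<And>v. v < length (ends c) \<Longrightarrow> vs' (vs ! v) = v"
    using vs bij_betw_inv_into_right[OF vs] bij_betw_inv_into_left[OF vs]
    by (simp_all add: vs'_def bij_betw_inv_into)
  have \<alpha>'_thes: "\<alpha>' h \<in> thes c" if "h \<in> hes G" for h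
    using bij_betw_apply[OF \<alpha>'(1) that] .
  have leafs: "(0, k) \<in> thes c" if "k \<in> set (leafs c)" for k
    using that c by (auto simp: tobj_ok_def thes_def)
  note R = realization[OF c]
  let ?R = "real_graph c"
  have u: "contr G ?R (real_he c \<circ> \<alpha>') ((!) vs)"
  proof (rule iso_contr[OF G R(1)])
    show "bij_betw (real_he c \<circ> \<alpha>') (hes G) (hes ?R)"
      by (rule bij_betw_trans[OF \<alpha>'(1) R(4)])
    show "bij_betw ((!) vs) {..<nv ?R} {..<nv G}"
      using vs R(2) by simp
    show "lvs ?R = map (real_he c \<circ> \<alpha>') (lvs G)"
      unfolding R(7) \<alpha>(4) using leafs \<alpha>'(3) by simp
    show "gen G ! (vs ! w) = gen ?R ! w" if "w < nv ?R" for w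
      using gen that R(2,3) by simp
  next
    fix h
    assume h: "h \<in> hes G"
    have "\<alpha>' (inv G h) = tinv c (\<alpha>' h)"
      using \<alpha>(3)[OF \<alpha>'_thes[OF h]] \<alpha>'(2)[OF h] \<alpha>'(3)[OF tinv_thes[OF c \<alpha>'_thes[OF h]]] by simp
    then show "inv ?R ((real_he c \<circ> \<alpha>') h) = (real_he c \<circ> \<alpha>') (inv G h)"
      using R(6)[OF \<alpha>'_thes[OF h]] by simp
    show "vs ! fst ((real_he c \<circ> \<alpha>') h) = fst h"
      using R(5)[OF \<alpha>'_thes[OF h]] \<alpha>(2)[OF \<alpha>'_thes[OF h]] \<alpha>'(2)[OF h] by simp
  qed
  have v: "contr ?R G (\<alpha> \<circ> real_inv c) vs'"
  proof (rule iso_contr[OF R(1) G])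
    show "bij_betw (\<alpha> \<circ> real_inv c) (hes ?R) (hes G)"
      by (rule bij_betw_trans[OF R(8) \<alpha>(1)])
    show "bij_betw vs' {..<nv G} {..<nv ?R}"
      using vs' R(2) by simp
    show "lvs G = map (\<alpha> \<circ> real_inv c) (lvs ?R)"
      unfolding R(7) \<alpha>(4) using leafs R(10) by simp
    show "gen ?R ! vs' w = gen G ! w" if "w < nv G" for w
      using gen[of "vs' w"] bij_betw_apply[OF vs'(1), of w] vs'(2)[OF that] that R(3) by simp
  next
    fix h
    assume h: "h \<in> hes ?R"
    have x: "real_inv c h \<in> thes c"
      by (rule R(11)[OF h])
    have "real_inv c (inv ?R h) = tinv c (real_inv c h)"
      using R(6)[OF x] R(9)[OF h] R(10)[OF tinv_thes[OF c x]] by simp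
    then show "inv G ((\<alpha> \<circ> real_inv c) h) = (\<alpha> \<circ> real_inv c) (inv ?R h)"
      using \<alpha>(3)[OF x] by simp
    show "vs' (fst ((\<alpha> \<circ> real_inv c) h)) = fst h"
      using \<alpha>(2)[OF x] vs'(3)[OF tvert_less[OF c x]] R(5)[OF x] R(9)[OF h] by simp
  qed
  let ?u = "mk G ?R (real_he c \<circ> \<alpha>') ((!) vs)" and ?v = "mk ?R G (\<alpha> \<circ> real_inv c) vs'"
  have "mcomp ?v ?u = midm G"
    unfolding mcomp_mk_contr[OF u v] midm_mk
    using \<alpha>'_thes \<alpha>'(2) R(10) vs'(2) by (intro mk_cong) simp_all
  moreover have "mcomp ?u ?v = midm ?R"
    unfolding mcomp_mk_contr[OF v u] midm_mk
    using R(9,11) \<alpha>'(3) vs'(3) R(2) by (intro mk_cong) simp_all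
  ultimately show "\<exists>c\<in>Obj tree_cat. \<exists>u\<in>Hom numOp_op G (real_graph c). \<exists>v\<in>Hom numOp_op (real_graph c) G.
      cmp numOp_op v u = idm numOp_op G \<and> cmp numOp_op u v = idm numOp_op (real_graph c)"
    using c is_mor_mk[OF u] is_mor_mk[OF v]
    by (intro bexI[of _ c] bexI[of _ ?u] bexI[of _ ?v]) simp_all
qed

lemma finite_mor: "finite {m. is_mor p q m}"
proof (rule finite_subset)
  let ?A = "(hes p \<rightarrow>\<^sub>E hes q) \<times> ({..<nv q} \<rightarrow>\<^sub>E {..<nv p})"
  show "{m. is_mor p q m} \<subseteq> (\<lambda>(\<phi>, \<pi>). mk p q \<phi> \<pi>) ` ?A"
  proof
    fix m
    assume "m \<in> {m. is_mor p q m}"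
    then obtain \<phi> \<pi> where c: "contr p q \<phi> \<pi>" and m: "m = mk p q \<phi> \<pi>"
      using is_mor_cases by blast
    have "m = mk p q (restrict \<phi> (hes p)) (restrict \<pi> {..<nv q})"
      unfolding m by (rule mk_cong) simp_all
    moreover have "(restrict \<phi> (hes p), restrict \<pi> {..<nv q}) \<in> ?A"
      using c by (auto simp: contr_def str_def restrict_PiE_iff)
    ultimately show "m \<in> (\<lambda>(\<phi>, \<pi>). mk p q \<phi> \<pi>) ` ?A"
      by (intro image_eqI[of _ _ "(restrict \<phi> (hes p), restrict \<pi> {..<nv q})"]) simp_all
  qed
  show "finite ((\<lambda>(\<phi>, \<pi>). mk p q \<phi> \<pi>) ` ?A)"
    using finite_hes by (intro finite_imageI finite_cartesian_product finite_PiE) auto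
qed

definition small_tobj :: "nat \<Rightarrow> nat \<Rightarrow> tobj \<Rightarrow> bool" where
  "small_tobj n b c \<longleftrightarrow> tobj_ok c \<and> length (ends c) \<le> n \<and>
     length (att c) + 2 * (\<Sum>x<length (ends c). tgen c ! x) \<le> b"

lemma finite_small_tobj: "finite {c. small_tobj n b c}"
proof (rule finite_subset)
  let ?L = "\<lambda>k l. {xs :: nat list. set xs \<subseteq> {..k} \<and> length xs \<le> l}"
  let ?A = "?L n n \<times> ?L b n \<times> ?L n b \<times> ?L b b \<times> ?L b b"
  show "{c. small_tobj n b c} \<subseteq> (\<lambda>(e, g, a, m, l). TObj e g a m l) ` ?A"
  proof
    fix c
    assume "c \<in> {c. small_tobj n b c}"
    then have c: "tobj_ok c" "length (ends c) \<le> n" "length (att c) \<le> b"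
      and g: "(\<Sum>x<length (ends c). tgen c ! x) \<le> b"
      by (auto simp: small_tobj_def)
    have len: "length (tgen c) = length (ends c)" "length (mate c) = length (att c)"
      using c by (simp_all add: tobj_ok_def)
    have e: "set (ends c) \<subseteq> {..n}"
      using c by (force simp: tobj_ok_def tree_def in_set_conv_nth)
    have "tgen c ! x \<le> b" if "x < length (ends c)" for x
    proof -
      have "tgen c ! x \<le> (\<Sum>x<length (ends c). tgen c ! x)"
        using that by (intro member_le_sum) auto
      then show ?thesis using g by simp
    qed
    then have t: "set (tgen c) \<subseteq> {..b}"
      using len by (auto simp: in_set_conv_nth)
    have a: "set (att c) \<subseteq> {..n}"
      using c by (auto simp: tobj_ok_def subset_iff)
    have m: "set (mate c) \<subseteq> {..b}"
      using c len by (force simp: tobj_ok_def in_set_conv_nth)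
    have sub: "set (leafs c) \<subseteq> {..<length (att c)}"
      using c by (auto simp: tobj_ok_def)
    then have l: "set (leafs c) \<subseteq> {..b}"
      using c(3) by auto
    have "distinct (leafs c)"
      using c by (simp add: tobj_ok_def)
    then have "length (leafs c) \<le> b"
      using card_mono[OF _ sub] c(3) distinct_card[of "leafs c"] by simp
    then have "(ends c, tgen c, att c, mate c, leafs c) \<in> ?A"
      using c len e t a m l by simp
    then show "c \<in> (\<lambda>(e, g, a, m, l). TObj e g a m l) ` ?A"
      by (rule image_eqI[rotated]) simp
  qed
  show "finite ((\<lambda>(e, g, a, m, l). TObj e g a m l) ` ?A)"
    by (intro finite_imageI finite_cartesian_product finite_lists_length_le) auto
qed

theorem property_F_real: "property_F tree_cat numOp_op real_graph real_mor"
  unfolding property_F_def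
proof
  fix p
  assume "p \<in> Obj numOp_op"
  then have p: "is_obj p"
    by simp
  define n where "n = 1 + card (hes p)"
  define b where "b = 2 * (\<Sum>l<nv p. gen p ! l) + card (hes p) + 2"
  define A where "A = (SIGMA c:{c. small_tobj n b c}. {m. is_mor p (real_graph c) m})"
  have "finite A"
    unfolding A_def by (intro finite_SigmaI finite_small_tobj finite_mor)
  then obtain xs where xs: "set xs = A"
    using finite_list by blast
  have "\<exists>i<length (map fst xs). \<exists>g\<in>Hom tree_cat (map fst xs ! i) c. f = cmp numOp_op (real_mor g) (map snd xs ! i)"
    if cf: "c \<in> Obj tree_cat" "f \<in> Hom numOp_op p (real_graph c)" for c f
  proof -
    have c: "tobj_ok c"
      using cf by simp
    obtain \<phi> \<pi> where \<phi>: "contr p (real_graph c) \<phi> \<pi>" "f = mk p (real_graph c) \<phi> \<pi>"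
      using is_mor_cases[of p "real_graph c" f] cf(2) by auto
    have \<phi>_hes: "\<phi> h \<in> hes (real_graph c)" if "h \<in> hes p" for h
      using \<phi>(1) that by (simp add: contr_def str_def)
    have "tcontr p c (real_inv c \<circ> \<phi>) \<pi>"
    proof (rule contr_realized_iff[OF c realizes_realization[OF c] p, THEN iffD1])
      show "contr p (real_graph c) \<phi> \<pi>"
        by (rule \<phi>(1))
    qed (simp_all add: real_inv_thes[OF c \<phi>_hes] real_he_real_inv[OF c \<phi>_hes])
    from factor[OF c this]
    obtain d e \<psi> \<rho> where d: "tmor d c e" and \<psi>: "tcontr p d \<psi> \<rho>"
      and small: "length (ends d) \<le> 1 + card (hes p)"
      and he: "\<And>h. h \<in> hes p \<Longrightarrow> he e (\<psi> h) = (real_inv c \<circ> \<phi>) h"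
      and ret: "\<And>x. x < length (ends c) \<Longrightarrow> \<rho> (ret (ends c) e x) = \<pi> x"
      by metis
    have d_ok: "tobj_ok d"
      using d by (simp add: tmor_def)
    have \<psi>_thes: "\<psi> h \<in> thes d" if "h \<in> hes p" for h
      using \<psi> that by (simp add: tcontr_def)
    have f': "contr p (real_graph d) (real_he d \<circ> \<psi>) \<rho>"
    proof (rule contr_realized_iff[OF d_ok realizes_realization[OF d_ok] p, THEN iffD2])
      show "tcontr p d \<psi> \<rho>"
        by (rule \<psi>)
    qed (simp_all add: \<psi>_thes)
    let ?f = "mk p (real_graph d) (real_he d \<circ> \<psi>) \<rho>"
    have "(d, ?f) \<in> A"
      using is_mor_mk[OF f'] d_ok small tcontr_bound[OF d_ok \<psi>]
      by (simp add: A_def small_tobj_def n_def b_def)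
    then obtain i where i: "i < length xs" "xs ! i = (d, ?f)"
      using xs by (metis in_set_conv_nth)
    have "mcomp (real_mor (d, c, e)) ?f =
        mk p (real_graph c) ((real_he c \<circ> he e \<circ> real_inv d) \<circ> (real_he d \<circ> \<psi>)) (\<rho> \<circ> ret (ends c) e)"
      using mcomp_mk_contr[OF f' contr_real_mor[OF d]] by (simp add: real_mor_def)
    also have "\<dots> = f"
      unfolding \<phi>(2)
    proof (rule mk_cong)
      fix h
      assume h: "h \<in> hes p"
      show "((real_he c \<circ> he e \<circ> real_inv d) \<circ> (real_he d \<circ> \<psi>)) h = \<phi> h"
        using real_inv_real_he[OF d_ok \<psi>_thes[OF h]] he[OF h] real_he_real_inv[OF c \<phi>_hes[OF h]] by simp
    next
      fix w
      assume "w < nv (real_graph c)"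
      then show "(\<rho> \<circ> ret (ends c) e) w = \<pi> w"
        using ret nv_real[OF c] by simp
    qed
    finally have "f = cmp numOp_op (real_mor (d, c, e)) (map snd xs ! i)"
      using i by simp
    moreover have "(d, c, e) \<in> Hom tree_cat (map fst xs ! i) c"
      using i d by simp
    moreover have "i < length (map fst xs)"
      using i(1) by simp
    ultimately show ?thesis
      by blast
  qed
  moreover have "map fst xs ! i \<in> Obj tree_cat \<and> map snd xs ! i \<in> Hom numOp_op p (real_graph (map fst xs ! i))"
    if "i < length (map fst xs)" for i
  proof -
    have "xs ! i \<in> A"
      unfolding xs[symmetric] using that by simp
    then show ?thesis
      using that by (auto simp: A_def small_tobj_def)
  qed
  ultimately show "\<exists>cs fs. length fs = length cs \<and>
      (\<forall>i<length cs. cs ! i \<in> Obj tree_cat \<and> fs ! i \<in> Hom numOp_op p (real_graph (cs ! i))) \<and>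
      (\<forall>c\<in>Obj tree_cat. \<forall>f\<in>Hom numOp_op p (real_graph c).
         \<exists>i<length cs. \<exists>g\<in>Hom tree_cat (cs ! i) c. f = cmp numOp_op (real_mor g) (fs ! i))"
    by (intro exI[of _ "map fst xs"] exI[of _ "map snd xs"]) (simp only: length_map, blast)
qed

section \<open>Countable categories\<close>

lemma well_order_on_dir_image:
  assumes "well_order_on A r" "inj_on f A"
  shows "well_order_on (f ` A) (dir_image r f)"
proof -
  have "A = Field r" "Well_order r"
    using assms(1) well_order_on_Field by blast+
  then show ?thesis
    using Well_order_dir_image[of r f] assms(2) dir_image_Field[of r f] by simp
qed

lemma quasi_groebner_countable:
  fixes C :: "('o :: countable, 'm :: countable) cat"
  assumes cat: "is_category C" and gr: "groebner C" and fu: "is_functor C D F0 F1"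
    and es: "ess_surj C D F0" and pF: "property_F C D F0 F1"
  shows "quasi_groebner D"
proof -
  define C' :: "(nat, nat) cat" where "C' = \<lparr>Obj = to_nat ` Obj C,
    Hom = (\<lambda>a b. {to_nat f | f x y. a = to_nat x \<and> b = to_nat y \<and> f \<in> Hom C x y}),
    cmp = (\<lambda>g f. to_nat (cmp C (from_nat g) (from_nat f))),
    idm = (\<lambda>a. to_nat (idm C (from_nat a)))\<rparr>"
  have Obj: "Obj C' = to_nat ` Obj C"
    and Hom_nat: "Hom C' (to_nat x) (to_nat y) = to_nat ` Hom C x y"
    and cmp: "cmp C' (to_nat g) (to_nat f) = to_nat (cmp C g f)"
    and idm: "idm C' (to_nat x) = to_nat (idm C x)" for x y f g
    by (auto simp: C'_def)
  have HomD: "\<exists>f' x y. f = to_nat f' \<and> a = to_nat x \<and> b = to_nat y \<and> f' \<in> Hom C x y"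
    if "f \<in> Hom C' a b" for f a b
    using that by (auto simp: C'_def)
  have obj: "x \<in> Obj C \<and> y \<in> Obj C" if "f \<in> Hom C x y" for x y f
    using cat that unfolding is_category_def by blast
  have "is_category C'"
    unfolding is_category_def
  proof (intro conjI allI ballI impI)
    fix a b
    assume "a \<notin> Obj C' \<or> b \<notin> Obj C'"
    then show "Hom C' a b = {}"
      using HomD obj Obj by blast
  next
    fix a
    assume "a \<in> Obj C'"
    then obtain x where "x \<in> Obj C" "a = to_nat x"
      using Obj by blast
    then show "idm C' a \<in> Hom C' a a"
      using cat idm Hom_nat by (auto simp: is_category_def)
  next
    fix a b c f g
    assume "f \<in> Hom C' a b" "g \<in> Hom C' b c"
    then obtain f' g' x y z where "f = to_nat f'" "g = to_nat g'" "a = to_nat x" "b = to_nat y" "c = to_nat z"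
      "f' \<in> Hom C x y" "g' \<in> Hom C y z"
      using HomD by (metis to_nat_split)
    moreover from this have "cmp C g' f' \<in> Hom C x z"
      using cat unfolding is_category_def by blast
    ultimately show "cmp C' g f \<in> Hom C' a c"
      by (simp add: Hom_nat cmp)
  next
    fix a b c d f g h
    assume "f \<in> Hom C' a b" "g \<in> Hom C' b c" "h \<in> Hom C' c d"
    then obtain f' g' h' x y z w where "f = to_nat f'" "g = to_nat g'" "h = to_nat h'"
      "f' \<in> Hom C x y" "g' \<in> Hom C y z" "h' \<in> Hom C z w"
      using HomD by (metis to_nat_split)
    moreover from this have "cmp C h' (cmp C g' f') = cmp C (cmp C h' g') f'"
      using cat unfolding is_category_def by blast
    ultimately show "cmp C' h (cmp C' g f) = cmp C' (cmp C' h g) f"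
      by (simp add: cmp)
  next
    fix a b f
    assume "f \<in> Hom C' a b"
    then obtain f' x y where f: "f = to_nat f'" "a = to_nat x" "b = to_nat y" "f' \<in> Hom C x y"
      using HomD by blast
    then have "cmp C (idm C y) f' = f' \<and> cmp C f' (idm C x) = f'"
      using cat unfolding is_category_def by blast
    then show "cmp C' (idm C' b) f = f" "cmp C' f (idm C' a) = f"
      by (simp_all add: f cmp idm)
  qed
  moreover have "groebner C'"
    unfolding groebner_def
  proof (intro ballI conjI)
    fix a
    assume "a \<in> Obj C'"
    then obtain c where c: "c \<in> Obj C" "a = to_nat c"
      using Obj by blast
    obtain W where W: "admissible_order C c W" and noeth: "noetherian_under C c"
      using gr c(1) unfolding groebner_def by blast
    define W' :: "nat \<Rightarrow> nat rel" where "W' b = dir_image (W (from_nat b)) to_nat" for b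
    have W'_iff: "(to_nat f, to_nat f') \<in> W' (to_nat x) \<longleftrightarrow> (f, f') \<in> W x" for f f' x
      by (auto simp: W'_def dir_image_def)
    have "admissible_order C' a W'"
      unfolding admissible_order_def
    proof (intro conjI ballI allI impI)
      fix b
      assume "b \<in> Obj C'"
      then obtain x where x: "x \<in> Obj C" "b = to_nat x"
        using Obj by blast
      have "well_order_on (Hom C c x) (W x)"
        using W x(1) unfolding admissible_order_def by blast
      from well_order_on_dir_image[OF this, of to_nat]
      show "well_order_on (Hom C' a b) (W' b)"
        by (simp add: c(2) x(2) Hom_nat W'_def inj_on_subset[OF inj_to_nat])
    next
      fix b b' f f' g
      assume "b \<in> Obj C'" "b' \<in> Obj C'" and f: "f \<in> Hom C' a b" "f' \<in> Hom C' a b"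
        and g: "g \<in> Hom C' b b'" and less: "(f, f') \<in> W' b" "f \<noteq> f'"
      then obtain x x' where x: "x \<in> Obj C" "b = to_nat x" "x' \<in> Obj C" "b' = to_nat x'"
        using Obj by blast
      obtain k where k: "f = to_nat k" "k \<in> Hom C c x"
        using f(1) unfolding c(2) x(2) Hom_nat by blast
      obtain k' where k': "f' = to_nat k'" "k' \<in> Hom C c x"
        using f(2) unfolding c(2) x(2) Hom_nat by blast
      obtain h where h: "g = to_nat h" "h \<in> Hom C x x'"
        using g unfolding x(2,4) Hom_nat by blast
      have "(k, k') \<in> W x" "k \<noteq> k'"
        using less W'_iff by (auto simp: k(1) k'(1) x(2))
      then have "(cmp C h k, cmp C h k') \<in> W x' \<and> cmp C h k \<noteq> cmp C h k'"
        using W x(1,3) k(2) k'(2) h(2) unfolding admissible_order_def by blast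
      then show "(cmp C' g f, cmp C' g f') \<in> W' b'" "cmp C' g f \<noteq> cmp C' g f'"
        using W'_iff by (simp_all add: k(1) k'(1) h(1) x(4) cmp)
    qed
    then show "\<exists>W. admissible_order C' a W"
      by blast
    show "noetherian_under C' a"
      unfolding noetherian_under_def
    proof (intro allI impI)
      fix d f :: "nat \<Rightarrow> nat"
      assume df: "\<forall>k. d k \<in> Obj C' \<and> f k \<in> Hom C' a (d k)"
      have "\<exists>x k'. d k = to_nat x \<and> x \<in> Obj C \<and> f k = to_nat k' \<and> k' \<in> Hom C c x" for k
      proof -
        obtain x where x: "x \<in> Obj C" "d k = to_nat x"
          using df Obj by blast
        then have "f k \<in> to_nat ` Hom C c x"
          using df[rule_format, of k] by (simp add: c(2) Hom_nat)
        then show ?thesis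
          using x by blast
      qed
      then obtain x f' where x: "\<And>k. d k = to_nat (x k)" "\<And>k. x k \<in> Obj C"
        and f': "\<And>k. f k = to_nat (f' k)" "\<And>k. f' k \<in> Hom C c (x k)"
        by metis
      obtain i j h where "i < j" "h \<in> Hom C (x i) (x j)" "f' j = cmp C h (f' i)"
        using noeth x(2) f'(2) unfolding noetherian_under_def by blast
      then have "i < j" "to_nat h \<in> Hom C' (d i) (d j)" "f j = cmp C' (to_nat h) (f i)"
        by (simp_all add: x(1) f'(1) Hom_nat cmp)
      then show "\<exists>i j. i < j \<and> (\<exists>h\<in>Hom C' (d i) (d j). f j = cmp C' h (f i))"
        by blast
    qed
  qed
  moreover have "is_functor C' D (F0 \<circ> from_nat) (F1 \<circ> from_nat)"
    unfolding is_functor_def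
  proof (intro conjI ballI allI impI)
    fix a
    assume "a \<in> Obj C'"
    then show "(F0 \<circ> from_nat) a \<in> Obj D" "(F1 \<circ> from_nat) (idm C' a) = idm D ((F0 \<circ> from_nat) a)"
      using fu by (auto simp: is_functor_def Obj idm)
  next
    fix a b f
    assume "f \<in> Hom C' a b"
    then obtain f' x y where f: "f = to_nat f'" "a = to_nat x" "b = to_nat y" "f' \<in> Hom C x y"
      using HomD by blast
    then show "(F1 \<circ> from_nat) f \<in> Hom D ((F0 \<circ> from_nat) a) ((F0 \<circ> from_nat) b)"
      using fu by (simp add: is_functor_def)
  next
    fix a b c f g
    assume "f \<in> Hom C' a b" "g \<in> Hom C' b c"
    then obtain f' g' x y z where f: "f = to_nat f'" "g = to_nat g'" "f' \<in> Hom C x y" "g' \<in> Hom C y z"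
      using HomD by (metis to_nat_split)
    then have "F1 (cmp C g' f') = cmp D (F1 g') (F1 f')"
      using fu unfolding is_functor_def by blast
    then show "(F1 \<circ> from_nat) (cmp C' g f) = cmp D ((F1 \<circ> from_nat) g) ((F1 \<circ> from_nat) f)"
      by (simp add: f cmp)
  qed
  moreover have "ess_surj C' D (F0 \<circ> from_nat)"
    using es unfolding ess_surj_def Obj by simp
  moreover have "property_F C' D (F0 \<circ> from_nat) (F1 \<circ> from_nat)"
    unfolding property_F_def
  proof
    fix d
    assume "d \<in> Obj D"
    from bspec[OF pF[unfolded property_F_def] this]
    obtain cs fs where len: "length fs = length cs"
      and obj: "\<forall>i<length cs. cs ! i \<in> Obj C \<and> fs ! i \<in> Hom D d (F0 (cs ! i))"
      and fac: "\<forall>c\<in>Obj C. \<forall>f\<in>Hom D d (F0 c). \<exists>i<length cs. \<exists>g\<in>Hom C (cs ! i) c. f = cmp D (F1 g) (fs ! i)"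
      by (elim exE conjE) (rule that)
    show "\<exists>cs fs. length fs = length cs \<and>
        (\<forall>i<length cs. cs ! i \<in> Obj C' \<and> fs ! i \<in> Hom D d ((F0 \<circ> from_nat) (cs ! i))) \<and>
        (\<forall>c\<in>Obj C'. \<forall>f\<in>Hom D d ((F0 \<circ> from_nat) c).
           \<exists>i<length cs. \<exists>g\<in>Hom C' (cs ! i) c. f = cmp D ((F1 \<circ> from_nat) g) (fs ! i))"
    proof (intro exI[of _ "map to_nat cs"] exI[of _ fs] conjI allI impI ballI)
      fix c f
      assume "c \<in> Obj C'" and f: "f \<in> Hom D d ((F0 \<circ> from_nat) c)"
      then obtain x where x: "x \<in> Obj C" "c = to_nat x"
        using Obj by blast
      obtain i g where "i < length cs" "g \<in> Hom C (cs ! i) x" "f = cmp D (F1 g) (fs ! i)"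
        using fac[rule_format, OF x(1), of f] f x(2) by auto
      then show "\<exists>i<length (map to_nat cs). \<exists>g\<in>Hom C' (map to_nat cs ! i) c. f = cmp D ((F1 \<circ> from_nat) g) (fs ! i)"
        by (intro exI[of _ i] conjI bexI[of _ "to_nat g"]) (simp_all add: x(2) Hom_nat)
    qed (use len obj in \<open>simp_all add: Obj\<close>)
  qed
  ultimately show ?thesis
    unfolding quasi_groebner_def by blast
qed

theorem theorem3p13:
  shows "quasi_groebner numOp_op"
  using quasi_groebner_countable[OF is_category_tree_cat groebner_tree_cat is_functor_real
      ess_surj_real property_F_real] .

end
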